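(* Suppose $Q\succeq0$, $R\succ0$, $W\succeq0$, $V\succ0$, $(A,W^{1/2})$ and $(A,B)$ are controllable, and $(Q^{1/2},A)$ and $(C,A)$ are observable. Let $J_{\mathtt{LQG},n}(\mathsf{K})=\|\mathbf{T}_{zd}(\mathsf{K},s)\|_{\mathcal{H}_2}$ for $\mathsf{K}\in\mathcal{C}_{n,0}$. Then the canonical projection of $\mathcal{L}_{\mathtt{LQG}}$ onto $(\mathsf{K},\gamma)$ satisfies $$\operatorname{epi}_>(J_{\mathtt{LQG},n})\subseteq\pi_{\mathsf{K},\gamma}(\mathcal{L}_{\mathtt{LQG}})\subseteq\operatorname{cl}\operatorname{epi}_\ge(J_{\mathtt{LQG},n}).$$ Furthermore, the mapping $\Phi_{\mathtt{LQG}}$ is a $C^2$ (and in fact $C^\infty$) diffeomorphism from $\mathcal{L}_{\mathtt{LQG}}$ to $\mathcal{F}_{\mathtt{LQG}}\times\mathrm{GL}_n$, and its inverse $\Phi_{\mathtt{LQG}}^{-1}$ is given by $\Psi_{\mathtt{LQG}}$.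
   Context: Data: $A\in\mathbb{R}^{n\times n}$, $B\in\mathbb{R}^{n\times m}$, $C\in\mathbb{R}^{p\times n}$, symmetric $Q,W\in\mathbb{S}^n$, $R\in\mathbb{S}^m$, $V\in\mathbb{S}^p$. $\mathrm{GL}_n$ is the set of invertible real $n\times n$ matrices; $\mathbb{S}^k_+$, $\mathbb{S}^k_{++}$ are the positive semidefinite / definite matrices. $B_1=[W^{1/2}\ \ 0_{n\times p}]$, $B_2=B$, $C_1=\begin{bmatrix}Q^{1/2}\\ 0_{m\times n}\end{bmatrix}$, $C_2=C$, $D_{12}=\begin{bmatrix}0_{n\times m}\\ R^{1/2}\end{bmatrix}$, $D_{21}=[0_{p\times n}\ \ V^{1/2}]$. Policies are $\mathsf{K}=\begin{bmatrix}D_{\mathsf K}&C_{\mathsf K}\\ B_{\mathsf K}&A_{\mathsf K}\end{bmatrix}\in\mathbb{R}^{(m+n)\times(p+n)}$ with $D_{\mathsf K}\in\mathbb{R}^{m\times p}$, and $A_{\mathrm{cl}}(\mathsf K)=\begin{bmatrix}A+BD_{\mathsf K}C&BC_{\mathsf K}\\ B_{\mathsf K}C&A_{\mathsf K}\end{bmatrix}$, $B_{\mathrm{cl}}(\mathsf K)=\begin{bmatrix}W^{1/2}&BD_{\mathsf K}V^{1/2}\\ 0&B_{\mathsf K}V^{1/2}\end{bmatrix}$, $C_{\mathrm{cl}}(\mathsf K)=\begin{bmatrix}Q^{1/2}&0\\ R^{1/2}D_{\mathsf K}C&R^{1/2}C_{\mathsf K}\end{bmatrix}$, $D_{\mathrm{cl}}(\mathsf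 K)=\begin{bmatrix}0&0\\ 0&R^{1/2}D_{\mathsf K}V^{1/2}\end{bmatrix}$. $\mathcal{V}_{n,0}$ is the linear space of $\mathsf K$ with $D_{\mathsf K}=0$; $\mathcal{C}_{n,0}=\{\mathsf K\in\mathcal{V}_{n,0}: A_{\mathrm{cl}}(\mathsf K)\text{ is Hurwitz stable}\}$. $\mathbf{T}_{zd}(\mathsf K,s)=C_{\mathrm{cl}}(\mathsf K)(sI-A_{\mathrm{cl}}(\mathsf K))^{-1}B_{\mathrm{cl}}(\mathsf K)+D_{\mathrm{cl}}(\mathsf K)$; $\|\mathbf{T}\|_{\mathcal{H}_2}^2=\frac1{2\pi}\int_{-\infty}^\infty\operatorname{tr}(\mathbf{T}(j\omega)^{\mathsf H}\mathbf{T}(j\omega))d\omega$. $\operatorname{epi}_>(J)=\{(\mathsf K,\gamma):\mathsf K\in\mathcal{C}_{n,0},\gamma>J(\mathsf K)\}$, $\operatorname{epi}_\ge(J)$ likewise with $\ge$; $\operatorname{cl}$ is closure. For a $2n\times2n$ matrix $P$ (or $P^{-1}$), $P_{ij}$ (or $(P^{-1})_{ij}$) denote its $n\times n$ blocks. Lifted set: $\mathcal{L}_{\mathtt{LQG}}$ is the set of $(\mathsf K,\gamma,P,\Gamma)$ with $\mathsf K\in\mathcal{V}_{n,0}$, $\gamma\in\mathbb{R}$, $P\in\mathbb{S}^{2n}_{++}$, $P_{12}\in\mathrm{GL}_n$, $\Gamma\in\mathbb{S}^{n+m}_+$, $$\begin{bmatrix}A_{\mathrm{cl}}(\mathsf K)^{\mathsf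 T}P+PA_{\mathrm{cl}}(\mathsf K)&PB_{\mathrm{cl}}(\mathsf K)\\ B_{\mathrm{cl}}(\mathsf K)^{\mathsf T}P&-\gamma I\end{bmatrix}\preceq0,\quad\begin{bmatrix}P&C_{\mathrm{cl}}(\mathsf K)^{\mathsf T}\\ C_{\mathrm{cl}}(\mathsf K)&\Gamma\end{bmatrix}\succeq0,\quad\operatorname{tr}(\Gamma)\le\gamma.$$ $\pi_{\mathsf K,\gamma}$ is the projection onto the first two components. Convex set: $\mathcal{F}_{\mathtt{LQG}}$ is the set of $(\gamma,\Lambda,X,Y,\Gamma)$ with $\gamma\in\mathbb{R}$, $\Lambda=\begin{bmatrix}0&F\\ H&M\end{bmatrix}\in\mathcal{V}_{n,0}$, $\begin{bmatrix}X&I\\ I&Y\end{bmatrix}\in\mathbb{S}^{2n}_{++}$ ($X,Y\in\mathbb{S}^n$), $\Gamma\in\mathbb{S}^{n+m}_+$, $\operatorname{tr}(\Gamma)\le\gamma$, $\mathcal{A}\preceq0$, $\mathcal{B}\succeq0$, where ($*$ denotes symmetric completion) $$\mathcal{A}=\begin{bmatrix}AX+B_2F+(AX+B_2F)^{\mathsf T}&M^{\mathsf T}+A&B_1\\ *&YA+HC_2+(YA+HC_2)^{\mathsf T}&YB_1+HD_{21}\\ *&*&-\gamma I\end{bmatrix},\quad\mathcal{B}=\begin{bmatrix}X&I&(C_1X+D_{12}F)^{\mathsf T}\\ *&Y&C_1^{\mathsf T}\\ *&*&\Gamma\end{bmatrix}.$$ Mappings: for $(\mathsf K,\gamma,P,\Gamma)\in\mathcal{L}_{\mathtt{LQG}}$,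 $$\Phi_{\mathtt{LQG}}(\mathsf K,\gamma,P,\Gamma)=\left(\gamma,\begin{bmatrix}0&C_{\mathsf K}(P^{-1})_{21}\\ P_{12}B_{\mathsf K}&\Phi_M\end{bmatrix},(P^{-1})_{11},P_{11},\Gamma,\ P_{12}\right),$$ $\Phi_M=P_{12}B_{\mathsf K}C_2(P^{-1})_{11}+P_{11}B_2C_{\mathsf K}(P^{-1})_{21}+P_{11}A(P^{-1})_{11}+P_{12}A_{\mathsf K}(P^{-1})_{21}$ (the last component $P_{12}$ lies in $\mathrm{GL}_n$, the others form the point of $\mathcal{F}_{\mathtt{LQG}}$). For $\mathsf Z=\left(\gamma,\begin{bmatrix}0&F\\ H&M\end{bmatrix},X,Y,\Gamma\right)\in\mathcal{F}_{\mathtt{LQG}}$, $\Xi\in\mathrm{GL}_n$, $\Psi_{\mathtt{LQG}}(\mathsf Z,\Xi)=(\Psi_{\mathsf K},\gamma,\Psi_P,\Gamma)$ with $$\Psi_{\mathsf K}=\begin{bmatrix}I&0\\ YB_2&\Xi\end{bmatrix}^{-1}\begin{bmatrix}0&F\\ H&M-YAX\end{bmatrix}\begin{bmatrix}I&C_2X\\ 0&-\Xi^{-1}(Y-X^{-1})X\end{bmatrix}^{-1},\quad\Psi_P=\begin{bmatrix}Y&\Xi\\ \Xi^{\mathsf T}&\Xi^{\mathsf T}(Y-X^{-1})^{-1}\Xi\end{bmatrix}.$$ A $C^2$ (resp. $C^\infty$) diffeomorphism between two subsets of Euclidean spaces means a bijection that extends to a $C^2$ (resp. $C^\infty$) function on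 an open set containing the first subset, the extension being a bijection onto its image with $C^2$ (resp. $C^\infty$) inverse. *)

theory Defs
  imports "HOL-Analysis.Analysis" "HOL-Library.Extended_Nat"
begin

section \<open>Block matrices and semidefiniteness\<close>

text \<open>The types \<^typ>\<open>real ^ 'n ^ 'm\<close> are the matrices with rows indexed by \<open>'m\<close> and columns
  indexed by \<open>'n\<close>.  Stacked vectors are indexed by sum types, so that a \<open>2n \<times> 2n\<close>
  matrix has the type \<open>real ^ ('n + 'n) ^ ('n + 'n)\<close>.\<close>

definition blkh :: "'a ^ 'c ^ 'r \<Rightarrow> 'a ^ 'd ^ 'r \<Rightarrow> 'a ^ ('c + 'd) ^ 'r" where
  "blkh L R = (\<chi> i j. case j of Inl k \<Rightarrow> L $ i $ k | Inr k \<Rightarrow> R $ i $ k)"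

definition blkv :: "'a ^ 'c ^ 'r \<Rightarrow> 'a ^ 'c ^ 's \<Rightarrow> 'a ^ 'c ^ ('r + 's)" where
  "blkv U L = (\<chi> i. case i of Inl k \<Rightarrow> U $ k | Inr k \<Rightarrow> L $ k)"

definition blk :: "'a ^ 'c ^ 'r \<Rightarrow> 'a ^ 'd ^ 'r \<Rightarrow> 'a ^ 'c ^ 's \<Rightarrow> 'a ^ 'd ^ 's
    \<Rightarrow> 'a ^ ('c + 'd) ^ ('r + 's)" where
  "blk M11 M12 M21 M22 = blkv (blkh M11 M12) (blkh M21 M22)"

definition blk11 :: "'a ^ ('c::finite + 'd::finite) ^ ('r::finite + 's::finite) \<Rightarrow> 'a ^ 'c ^ 'r" where
  "blk11 M = (\<chi> i j. M $ Inl i $ Inl j)"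

definition blk12 :: "'a ^ ('c::finite + 'd::finite) ^ ('r::finite + 's::finite) \<Rightarrow> 'a ^ 'd ^ 'r" where
  "blk12 M = (\<chi> i j. M $ Inl i $ Inr j)"

definition blk21 :: "'a ^ ('c::finite + 'd::finite) ^ ('r::finite + 's::finite) \<Rightarrow> 'a ^ 'c ^ 's" where
  "blk21 M = (\<chi> i j. M $ Inr i $ Inl j)"

definition blk22 :: "'a ^ ('c::finite + 'd::finite) ^ ('r::finite + 's::finite) \<Rightarrow> 'a ^ 'd ^ 's" where
  "blk22 M = (\<chi> i j. M $ Inr i $ Inr j)"

definition symmat :: "(real ^ 'n ^ 'n) set" where
  "symmat = {M. transpose M = M}"

definition psd :: "real ^ 'n ^ 'n \<Rightarrow> bool" where
  "psd M \<longleftrightarrow> M \<in> symmat \<and> (\<forall>x. 0 \<le> x \<bullet> (M *v x))"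

definition posdef :: "real ^ 'n ^ 'n \<Rightarrow> bool" where
  "posdef M \<longleftrightarrow> M \<in> symmat \<and> (\<forall>x. x \<noteq> 0 \<longrightarrow> 0 < x \<bullet> (M *v x))"

text \<open>The positive semidefinite square root (meaningful for positive semidefinite arguments).\<close>

definition msqrt :: "real ^ 'n ^ 'n \<Rightarrow> real ^ 'n ^ 'n" where
  "msqrt M = (THE S. psd S \<and> S ** S = M)"

definition GL :: "(real ^ 'n ^ 'n) set" where
  "GL = {M. invertible M}"

section \<open>Linear systems\<close>

text \<open>The multiplication of the type class \<open>power\<close> is entrywise on vectors, hence the
  explicit matrix power.\<close>

definition mpow :: "real ^ 'n ^ 'n \<Rightarrow> nat \<Rightarrow> real ^ 'n ^ 'n" where
  "mpow A k = (((**) A) ^^ k) (mat 1)"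

text \<open>Kalman rank conditions: the column rank of \<open>[B, A B, \<dots>, A\<^sup>n\<^sup>-\<^sup>1 B]\<close>,
  respectively the row rank of the stacked \<open>C, C A, \<dots>, C A\<^sup>n\<^sup>-\<^sup>1\<close>, is \<open>n\<close>.\<close>

definition controllable :: "real ^ 'n ^ 'n \<Rightarrow> real ^ 'm ^ 'n \<Rightarrow> bool" where
  "controllable A B \<longleftrightarrow> dim (\<Union>k<CARD('n). columns (mpow A k ** B)) = CARD('n)"

definition observable :: "real ^ 'n ^ 'p \<Rightarrow> real ^ 'n ^ 'n \<Rightarrow> bool" where
  "observable C A \<longleftrightarrow> dim (\<Union>k<CARD('n). rows (C ** mpow A k)) = CARD('n)"

abbreviation cmat :: "real ^ 'n ^ 'm \<Rightarrow> complex ^ 'n ^ 'm" where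
  "cmat \<equiv> map_matrix complex_of_real"

definition hurwitz :: "real ^ 'n ^ 'n \<Rightarrow> bool" where
  "hurwitz A \<longleftrightarrow> (\<forall>(l::complex) v. v \<noteq> 0 \<and> cmat A *v v = l *s v \<longrightarrow> Re l < 0)"

definition hermitian_transpose :: "complex ^ 'n ^ 'm \<Rightarrow> complex ^ 'm ^ 'n" where
  "hermitian_transpose T = map_matrix cnj (transpose T)"

text \<open>The trace below is real.  The integral is the Lebesgue integral, which is 0 for
  non-integrable integrands; for stable and strictly proper transfer matrices the integrand
  is integrable.\<close>

definition H2_norm :: "(complex \<Rightarrow> complex ^ 'd ^ 'z) \<Rightarrow> real" where
  "H2_norm T = sqrt (1 / (2 * pi) *
     (LINT \<omega>|lborel. Re (trace (hermitian_transpose (T (\<i> * complex_of_real \<omega>)) **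
                                T (\<i> * complex_of_real \<omega>)))))"

definition B1 :: "real ^ 'n ^ 'n \<Rightarrow> real ^ ('n + 'p::finite) ^ 'n" where
  "B1 W = blkh (msqrt W) 0"

definition C1 :: "real ^ 'n ^ 'n \<Rightarrow> real ^ 'n ^ ('n + 'm::finite)" where
  "C1 Q = blkv (msqrt Q) 0"

definition D12 :: "real ^ 'm ^ 'm \<Rightarrow> real ^ 'm ^ ('n::finite + 'm)" where
  "D12 R = blkv 0 (msqrt R)"

definition D21 :: "real ^ 'p ^ 'p \<Rightarrow> real ^ ('n::finite + 'p) ^ 'p" where
  "D21 V = blkh 0 (msqrt V)"

text \<open>A policy is the block matrix \<open>K = [D\<^sub>K, C\<^sub>K; B\<^sub>K, A\<^sub>K]\<close>.\<close>

abbreviation (input) DK :: "real ^ ('p::finite + 'n::finite) ^ ('m::finite + 'n) \<Rightarrow> real ^ 'p ^ 'm" where "DK \<equiv> blk11"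
abbreviation (input) CK :: "real ^ ('p::finite + 'n::finite) ^ ('m::finite + 'n) \<Rightarrow> real ^ 'n ^ 'm" where "CK \<equiv> blk12"
abbreviation (input) BK :: "real ^ ('p::finite + 'n::finite) ^ ('m::finite + 'n) \<Rightarrow> real ^ 'p ^ 'n" where "BK \<equiv> blk21"
abbreviation (input) AK :: "real ^ ('p::finite + 'n::finite) ^ ('m::finite + 'n) \<Rightarrow> real ^ 'n ^ 'n" where "AK \<equiv> blk22"

definition V0 :: "(real ^ ('p::finite + 'n::finite) ^ ('m::finite + 'n)) set" where
  "V0 = {K. DK K = 0}"

definition Acl :: "real ^ 'n ^ 'n \<Rightarrow> real ^ 'm ^ 'n \<Rightarrow> real ^ 'n ^ 'p
    \<Rightarrow> real ^ ('p + 'n) ^ ('m + 'n) \<Rightarrow> real ^ ('n + 'n) ^ ('n + 'n)" where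
  "Acl A B C K = blk (A + B ** DK K ** C) (B ** CK K) (BK K ** C) (AK K)"

definition Bcl :: "real ^ 'm ^ 'n \<Rightarrow> real ^ 'n ^ 'n \<Rightarrow> real ^ 'p ^ 'p
    \<Rightarrow> real ^ ('p + 'n) ^ ('m + 'n) \<Rightarrow> real ^ ('n + 'p) ^ ('n + 'n)" where
  "Bcl B W V K = blk (msqrt W) (B ** DK K ** msqrt V) 0 (BK K ** msqrt V)"

definition Ccl :: "real ^ 'n ^ 'p \<Rightarrow> real ^ 'n ^ 'n \<Rightarrow> real ^ 'm ^ 'm
    \<Rightarrow> real ^ ('p + 'n) ^ ('m + 'n) \<Rightarrow> real ^ ('n + 'n) ^ ('n + 'm)" where
  "Ccl C Q R K = blk (msqrt Q) 0 (msqrt R ** DK K ** C) (msqrt R ** CK K)"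

definition Dcl :: "real ^ 'm ^ 'm \<Rightarrow> real ^ 'p ^ 'p
    \<Rightarrow> real ^ ('p + 'n::finite) ^ ('m + 'n) \<Rightarrow> real ^ ('n + 'p) ^ ('n + 'm)" where
  "Dcl R V K = blk 0 0 0 (msqrt R ** DK K ** msqrt V)"

definition C0 :: "real ^ 'n ^ 'n \<Rightarrow> real ^ 'm ^ 'n \<Rightarrow> real ^ 'n ^ 'p
    \<Rightarrow> (real ^ ('p + 'n) ^ ('m + 'n)) set" where
  "C0 A B C = {K \<in> V0. hurwitz (Acl A B C K)}"

definition Tzd :: "real ^ 'n ^ 'n \<Rightarrow> real ^ 'm ^ 'n \<Rightarrow> real ^ 'n ^ 'p \<Rightarrow> real ^ 'n ^ 'n
    \<Rightarrow> real ^ 'm ^ 'm \<Rightarrow> real ^ 'n ^ 'n \<Rightarrow> real ^ 'p ^ 'p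
    \<Rightarrow> real ^ ('p + 'n) ^ ('m + 'n) \<Rightarrow> complex \<Rightarrow> complex ^ ('n + 'p) ^ ('n + 'm)" where
  "Tzd A B C Q R W V K s =
     cmat (Ccl C Q R K) ** matrix_inv (mat s - cmat (Acl A B C K)) ** cmat (Bcl B W V K)
     + cmat (Dcl R V K)"

definition J_LQG :: "real ^ 'n ^ 'n \<Rightarrow> real ^ 'm ^ 'n \<Rightarrow> real ^ 'n ^ 'p \<Rightarrow> real ^ 'n ^ 'n
    \<Rightarrow> real ^ 'm ^ 'm \<Rightarrow> real ^ 'n ^ 'n \<Rightarrow> real ^ 'p ^ 'p
    \<Rightarrow> real ^ ('p + 'n) ^ ('m + 'n) \<Rightarrow> real" where
  "J_LQG A B C Q R W V K = H2_norm (Tzd A B C Q R W V K)"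

definition epi_gt :: "'a set \<Rightarrow> ('a \<Rightarrow> real) \<Rightarrow> ('a \<times> real) set" where
  "epi_gt D J = {(K, \<gamma>). K \<in> D \<and> \<gamma> > J K}"

definition epi_ge :: "'a set \<Rightarrow> ('a \<Rightarrow> real) \<Rightarrow> ('a \<times> real) set" where
  "epi_ge D J = {(K, \<gamma>). K \<in> D \<and> \<gamma> \<ge> J K}"

section \<open>The lifted set, the convex set and the mappings between them\<close>

definition L_LQG :: "real ^ 'n ^ 'n \<Rightarrow> real ^ 'm ^ 'n \<Rightarrow> real ^ 'n ^ 'p \<Rightarrow> real ^ 'n ^ 'n
    \<Rightarrow> real ^ 'm ^ 'm \<Rightarrow> real ^ 'n ^ 'n \<Rightarrow> real ^ 'p ^ 'p
    \<Rightarrow> ((real ^ ('p + 'n) ^ ('m + 'n)) \<times> real \<times> (real ^ ('n + 'n) ^ ('n + 'n))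
        \<times> (real ^ ('n + 'm) ^ ('n + 'm))) set" where
  "L_LQG A B C Q R W V = {(K, \<gamma>, P, \<Gamma>).
     K \<in> V0 \<and> posdef P \<and> blk12 P \<in> GL \<and> psd \<Gamma> \<and>
     psd (- blk (transpose (Acl A B C K) ** P + P ** Acl A B C K) (P ** Bcl B W V K)
                (transpose (Bcl B W V K) ** P)                    (- mat \<gamma>)) \<and>
     psd (blk P             (transpose (Ccl C Q R K))
              (Ccl C Q R K) \<Gamma>) \<and>
     trace \<Gamma> \<le> \<gamma>}"

definition calA :: "real ^ 'n ^ 'n \<Rightarrow> real ^ 'm ^ 'n \<Rightarrow> real ^ 'n ^ 'p
    \<Rightarrow> real ^ 'n ^ 'n \<Rightarrow> real ^ 'p ^ 'p
    \<Rightarrow> real \<Rightarrow> real ^ 'n ^ 'm \<Rightarrow> real ^ 'p ^ 'n \<Rightarrow> real ^ 'n ^ 'n \<Rightarrow> real ^ 'n ^ 'n \<Rightarrow> real ^ 'n ^ 'n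
    \<Rightarrow> real ^ (('n + 'n) + ('n + 'p)) ^ (('n + 'n) + ('n + 'p))" where
  "calA A B C W V \<gamma> F H M X Y = blk
     (blk (A ** X + B ** F + transpose (A ** X + B ** F)) (transpose M + A)
          (transpose (transpose M + A))                   (Y ** A + H ** C + transpose (Y ** A + H ** C)))
     (blkv (B1 W)
           (Y ** B1 W + H ** D21 V))
     (blkh (transpose (B1 W)) (transpose (Y ** B1 W + H ** D21 V)))
     (- mat \<gamma>)"

definition calB :: "real ^ 'n ^ 'n \<Rightarrow> real ^ 'm ^ 'm
    \<Rightarrow> real ^ 'n ^ 'm \<Rightarrow> real ^ 'n ^ 'n \<Rightarrow> real ^ 'n ^ 'n \<Rightarrow> real ^ ('n + 'm) ^ ('n + 'm)
    \<Rightarrow> real ^ (('n + 'n) + ('n + 'm)) ^ (('n + 'n) + ('n + 'm))" where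
  "calB Q R F X Y \<Gamma> = blk
     (blk X       (mat 1)
          (mat 1) Y)
     (blkv (transpose (C1 Q ** X + D12 R ** F))
           (transpose (C1 Q)))
     (blkh (C1 Q ** X + D12 R ** F) (C1 Q))
     \<Gamma>"

text \<open>The point \<open>\<Lambda> = [0, F; H, M]\<close> of the space \<^const>\<open>V0\<close> has the blocks
  \<open>F = blk12 \<Lambda>\<close>, \<open>H = blk21 \<Lambda>\<close> and \<open>M = blk22 \<Lambda>\<close>.\<close>

definition F_LQG :: "real ^ 'n ^ 'n \<Rightarrow> real ^ 'm ^ 'n \<Rightarrow> real ^ 'n ^ 'p \<Rightarrow> real ^ 'n ^ 'n
    \<Rightarrow> real ^ 'm ^ 'm \<Rightarrow> real ^ 'n ^ 'n \<Rightarrow> real ^ 'p ^ 'p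
    \<Rightarrow> (real \<times> (real ^ ('p + 'n) ^ ('m + 'n)) \<times> (real ^ 'n ^ 'n) \<times> (real ^ 'n ^ 'n)
        \<times> (real ^ ('n + 'm) ^ ('n + 'm))) set" where
  "F_LQG A B C Q R W V = {(\<gamma>, \<Lambda>, X, Y, \<Gamma>).
     \<Lambda> \<in> V0 \<and> X \<in> symmat \<and> Y \<in> symmat \<and> posdef (blk X (mat 1) (mat 1) Y) \<and>
     psd \<Gamma> \<and> trace \<Gamma> \<le> \<gamma> \<and>
     psd (- calA A B C W V \<gamma> (blk12 \<Lambda>) (blk21 \<Lambda>) (blk22 \<Lambda>) X Y) \<and>
     psd (calB Q R (blk12 \<Lambda>) X Y \<Gamma>)}"

definition Phi_M :: "real ^ 'n ^ 'n \<Rightarrow> real ^ 'm ^ 'n \<Rightarrow> real ^ 'n ^ 'p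
    \<Rightarrow> real ^ ('p + 'n) ^ ('m + 'n) \<Rightarrow> real ^ ('n + 'n) ^ ('n + 'n) \<Rightarrow> real ^ 'n ^ 'n" where
  "Phi_M A B C K P =
     blk12 P ** BK K ** C ** blk11 (matrix_inv P)
     + blk11 P ** B ** CK K ** blk21 (matrix_inv P)
     + blk11 P ** A ** blk11 (matrix_inv P)
     + blk12 P ** AK K ** blk21 (matrix_inv P)"

fun Phi_LQG :: "real ^ 'n ^ 'n \<Rightarrow> real ^ 'm ^ 'n \<Rightarrow> real ^ 'n ^ 'p
    \<Rightarrow> (real ^ ('p + 'n) ^ ('m + 'n)) \<times> real \<times> (real ^ ('n + 'n) ^ ('n + 'n))
        \<times> (real ^ ('n + 'm) ^ ('n + 'm))
    \<Rightarrow> (real \<times> (real ^ ('p + 'n) ^ ('m + 'n)) \<times> (real ^ 'n ^ 'n) \<times> (real ^ 'n ^ 'n)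
        \<times> (real ^ ('n + 'm) ^ ('n + 'm))) \<times> (real ^ 'n ^ 'n)" where
  "Phi_LQG A B C (K, \<gamma>, P, \<Gamma>) =
     ((\<gamma>,
       blk 0                 (CK K ** blk21 (matrix_inv P))
           (blk12 P ** BK K) (Phi_M A B C K P),
       blk11 (matrix_inv P),
       blk11 P,
       \<Gamma>),
      blk12 P)"

definition Psi_K :: "real ^ 'n ^ 'n \<Rightarrow> real ^ 'm ^ 'n \<Rightarrow> real ^ 'n ^ 'p
    \<Rightarrow> real ^ ('p + 'n) ^ ('m + 'n) \<Rightarrow> real ^ 'n ^ 'n \<Rightarrow> real ^ 'n ^ 'n \<Rightarrow> real ^ 'n ^ 'n
    \<Rightarrow> real ^ ('p + 'n) ^ ('m + 'n)" where
  "Psi_K A B C \<Lambda> X Y \<Xi> =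
     matrix_inv (blk (mat 1)  0
                     (Y ** B) \<Xi>)
     ** blk 0         (blk12 \<Lambda>)
            (blk21 \<Lambda>) (blk22 \<Lambda> - Y ** A ** X)
     ** matrix_inv (blk (mat 1) (C ** X)
                        0       (- (matrix_inv \<Xi> ** (Y - matrix_inv X) ** X)))"

definition Psi_P :: "real ^ 'n ^ 'n \<Rightarrow> real ^ 'n ^ 'n \<Rightarrow> real ^ 'n ^ 'n
    \<Rightarrow> real ^ ('n + 'n) ^ ('n + 'n)" where
  "Psi_P X Y \<Xi> =
     blk Y             \<Xi>
         (transpose \<Xi>) (transpose \<Xi> ** matrix_inv (Y - matrix_inv X) ** \<Xi>)"

fun Psi_LQG :: "real ^ 'n ^ 'n \<Rightarrow> real ^ 'm ^ 'n \<Rightarrow> real ^ 'n ^ 'p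
    \<Rightarrow> (real \<times> (real ^ ('p + 'n) ^ ('m + 'n)) \<times> (real ^ 'n ^ 'n) \<times> (real ^ 'n ^ 'n)
        \<times> (real ^ ('n + 'm) ^ ('n + 'm))) \<times> (real ^ 'n ^ 'n)
    \<Rightarrow> (real ^ ('p + 'n) ^ ('m + 'n)) \<times> real \<times> (real ^ ('n + 'n) ^ ('n + 'n))
        \<times> (real ^ ('n + 'm) ^ ('n + 'm))" where
  "Psi_LQG A B C ((\<gamma>, \<Lambda>, X, Y, \<Gamma>), \<Xi>) =
     (Psi_K A B C \<Lambda> X Y \<Xi>, \<gamma>, Psi_P X Y \<Xi>, \<Gamma>)"

section \<open>Diffeomorphisms between subsets of linear subspaces\<close>

text \<open>\<open>Ck_on k E U f\<close>: the map \<open>f\<close> is \<open>k\<close> times continuously differentiable on \<open>U\<close>, where \<open>U\<close>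
  is a relatively open subset of the linear subspace \<open>E\<close>.  Only the directions in \<open>E\<close> matter: the
  Frechet derivative is taken within \<open>U\<close>, which determines it on \<open>E\<close>, and the
  directional derivatives along \<open>E\<close> are required to be of class \<open>C\<^sup>k\<^sup>-\<^sup>1\<close>.\<close>

primrec Ck_on :: "nat \<Rightarrow> 'a::euclidean_space set \<Rightarrow> 'a set \<Rightarrow> ('a \<Rightarrow> 'b::euclidean_space) \<Rightarrow> bool"
where
  "Ck_on 0 E U f = continuous_on U f"
| "Ck_on (Suc k) E U f =
     (\<exists>f'. (\<forall>x\<in>U. (f has_derivative f' x) (at x within U)) \<and>
           (\<forall>v\<in>E. Ck_on k E U (\<lambda>x. f' x v)))"

definition Cr_on :: "enat \<Rightarrow> 'a::euclidean_space set \<Rightarrow> 'a set \<Rightarrow> ('a \<Rightarrow> 'b::euclidean_space) \<Rightarrow> bool"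
where
  "Cr_on r E U f \<longleftrightarrow> (\<forall>k. enat k \<le> r \<longrightarrow> Ck_on k E U f)"

text \<open>\<open>Cr_diffeo r E E' S T f\<close>: the map \<open>f\<close> is a diffeomorphism of class \<open>C\<^sup>r\<close>
  (\<open>r = \<infinity>\<close> allowed) from \<open>S\<close> to \<open>T\<close>, which are arbitrary subsets of the Euclidean spaces
  \<open>E\<close> and \<open>E'\<close>: it is a bijection that extends to a \<open>C\<^sup>r\<close> bijection from an open neighbourhood
  of \<open>S\<close> in \<open>E\<close> to an open subset of \<open>E'\<close> with \<open>C\<^sup>r\<close> inverse.  The ambient
  spaces are linear subspaces of the types, because spaces of symmetric matrices occur.\<close>

definition Cr_diffeo :: "enat \<Rightarrow> 'a::euclidean_space set \<Rightarrow> 'b::euclidean_space set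
    \<Rightarrow> 'a set \<Rightarrow> 'b set \<Rightarrow> ('a \<Rightarrow> 'b) \<Rightarrow> bool" where
  "Cr_diffeo r E E' S T f \<longleftrightarrow>
     S \<subseteq> E \<and> T \<subseteq> E' \<and> bij_betw f S T \<and>
     (\<exists>U g. openin (top_of_set E) U \<and> S \<subseteq> U \<and> (\<forall>x\<in>S. g x = f x) \<and>
            Cr_on r E U g \<and> inj_on g U \<and>
            openin (top_of_set E') (g ` U) \<and> Cr_on r E' (g ` U) (inv_into U g))"

definition E_L :: "((real ^ ('p::finite + 'n::finite) ^ ('m::finite + 'n)) \<times> real \<times> (real ^ ('n + 'n) ^ ('n + 'n))
    \<times> (real ^ ('n + 'm) ^ ('n + 'm))) set" where
  "E_L = V0 \<times> UNIV \<times> symmat \<times> symmat"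

definition E_F :: "((real \<times> (real ^ ('p::finite + 'n::finite) ^ ('m::finite + 'n)) \<times> (real ^ 'n ^ 'n) \<times> (real ^ 'n ^ 'n)
    \<times> (real ^ ('n + 'm) ^ ('n + 'm))) \<times> (real ^ 'n ^ 'n)) set" where
  "E_F = (UNIV \<times> V0 \<times> symmat \<times> symmat \<times> symmat) \<times> UNIV"

end

theory Submission
  imports Defs "HOL-Complex_Analysis.Cauchy_Integral_Theorem" "HOL-Computational_Algebra.Polynomial"
begin

text \<open>The proof has two parts.

  \<^emph>\<open>The diffeomorphism.\<close>  Put \<open>X = (P\<inverse>)\<^sub>1\<^sub>1\<close>, \<open>N = (P\<inverse>)\<^sub>2\<^sub>1\<close>, \<open>Y = P\<^sub>1\<^sub>1\<close> and \<open>\<Xi> = P\<^sub>1\<^sub>2\<close>.  The first block column of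
  \<open>P P\<inverse> = I\<close> reads \<open>Y X + \<Xi> N = I\<close> and \<open>\<Xi>\<^sup>T X + P\<^sub>2\<^sub>2 N = 0\<close>, so \<open>N\<close> and \<open>P\<^sub>2\<^sub>2\<close> are determined by \<open>(X, Y, \<Xi>)\<close>,
  and the controller is recovered from \<open>[0, F; H, M - Y A X] = [I, 0; Y B, \<Xi>] K [I, C X; 0, N]\<close>
  (\<open>controller_factorization\<close>).  These identities use only that certain matrices are
  invertible; hence \<open>\<Phi>\<close> and \<open>\<Psi>\<close> are mutually inverse between two relatively open sets
  \<open>Phi_dom\<close> and \<open>Psi_dom\<close> that contain the lifted set and
  the product of the convex set with the invertible matrices (\<open>Psi_Phi\<close>, \<open>Phi_Psi\<close>).  Both maps are
  rational, hence smooth.  The congruence with \<open>T = [X, I; N, 0]\<close>, for which \<open>P T = [I, Y; 0, \<Xi>\<^sup>T]\<close>,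
  turns the matrix inequalities of the lifted set into those of the convex set (\<open>lmi_congruence\<close>).

  \<^emph>\<open>The epigraph.\<close>  For a Hurwitz matrix \<open>A\<close> the resolvent \<open>G(s) = (s - A)\<inverse>\<close> satisfies
  \<open>lim\<^sub>R \<integral>\<^sub>-\<^sub>R\<^sup>R Re G(i\<omega>) d\<omega> = \<pi> I\<close>, by Cauchy's theorem on half discs.  If \<open>A X + X A\<^sup>T + S = 0\<close> then the
  real part of \<open>G S G\<^sup>*\<close> on the imaginary axis is \<open>(Re G) X + X (Re G)\<^sup>T\<close>, and its integral
  is \<open>2 \<pi> X\<close>.  This one formula gives unique solvability of the Lyapunov equation, positivity of its
  solution and the expression \<open>J\<^sup>2 = tr (C X C\<^sup>T)\<close> with \<open>S = B B\<^sup>T\<close>.  For \<open>\<gamma> > J\<close> a slightly enlarged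
  Gramian \<open>X/\<gamma> + \<epsilon> X'\<close> is the inverse of a strictly feasible \<open>P\<close>, and strictness leaves room to make the
  off-diagonal block of \<open>P\<close> invertible (\<open>epi_gt_subset\<close>).  Conversely, the inequalities of the lifted
  set bound \<open>J\<close> by \<open>\<gamma>\<close> once \<open>A\<^sub>c\<^sub>l\<close> is Hurwitz, but being non-strict they do not force that.  The
  convex set has a strictly feasible point, obtained from shifted controllability and observability
  Gramians (\<open>F_LQG_strictly_feasible\<close>).  The segment from \<open>\<Phi>(z)\<close> to it consists, except
  possibly for its first end point, of strictly feasible points; their images under the continuous
  map \<open>\<Psi>\<close> lie over the epigraph and tend to \<open>z\<close> (\<open>L_LQG_closure\<close>).\<close>

(* This rule would replace every product of a transpose with a vector by a vector-matrix product. *)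
declare transpose_matrix_vector [simp del]

section \<open>Block matrices\<close>

text \<open>The column vector with upper part \<open>x\<close> and lower part \<open>y\<close>.\<close>

definition vcat :: "'a ^ 'c \<Rightarrow> 'a ^ 'd \<Rightarrow> 'a ^ ('c + 'd)" where
  "vcat x y = (\<chi> i. case i of Inl k \<Rightarrow> x $ k | Inr k \<Rightarrow> y $ k)"

lemma sum_UNIV_Plus:
  fixes f :: "'c::finite + 'd::finite \<Rightarrow> 'b::comm_monoid_add"
  shows "(\<Sum>i\<in>UNIV. f i) = (\<Sum>i\<in>UNIV. f (Inl i)) + (\<Sum>i\<in>UNIV. f (Inr i))"
  by (simp add: UNIV_Plus_UNIV[symmetric] sum.Plus del: UNIV_Plus_UNIV)

lemma vcat_nth [simp]: "vcat x y $ Inl i = x $ i" "vcat x y $ Inr j = y $ j"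
  by (simp_all add: vcat_def)

lemma blk_nth [simp]:
  "blk M11 M12 M21 M22 $ Inl i $ Inl j = M11 $ i $ j"
  "blk M11 M12 M21 M22 $ Inl i $ Inr j' = M12 $ i $ j'"
  "blk M11 M12 M21 M22 $ Inr i' $ Inl j = M21 $ i' $ j"
  "blk M11 M12 M21 M22 $ Inr i' $ Inr j' = M22 $ i' $ j'"
  by (simp_all add: blk_def blkv_def blkh_def)

lemma blkh_nth [simp]: "blkh L R $ i $ Inl j = L $ i $ j" "blkh L R $ i $ Inr k = R $ i $ k"
  by (simp_all add: blkh_def)

lemma blkv_nth [simp]: "blkv U L $ Inl i = U $ i" "blkv U L $ Inr k = L $ k"
  by (simp_all add: blkv_def)

lemma forall_sum: "(\<forall>i. P i) \<longleftrightarrow> (\<forall>i. P (Inl i)) \<and> (\<forall>i. P (Inr i))"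
  by (metis sum.exhaust)

lemma vcat_exhaust:
  fixes v :: "'a ^ ('c::finite + 'd::finite)"
  obtains x y where "v = vcat x y"
proof
  show "v = vcat (\<chi> i. v $ Inl i) (\<chi> i. v $ Inr i)"
    by (simp add: vec_eq_iff forall_sum)
qed

lemma vcat_eq_0_iff [simp]: "vcat x y = 0 \<longleftrightarrow> x = 0 \<and> y = (0 :: 'a::zero ^ 'd)"
  by (auto simp: vec_eq_iff forall_sum)

lemma inner_vcat [simp]: "vcat x y \<bullet> vcat u v = x \<bullet> u + y \<bullet> (v::real^'d)"
  by (simp add: inner_vec_def sum_UNIV_Plus)

lemma blk_blocks [simp]:
  "blk11 (blk M11 M12 M21 M22) = M11" "blk12 (blk M11 M12 M21 M22) = M12"
  "blk21 (blk M11 M12 M21 M22) = M21" "blk22 (blk M11 M12 M21 M22) = M22"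
  by (simp_all add: blk11_def blk12_def blk21_def blk22_def vec_eq_iff)

lemma blk_collapse: "blk (blk11 M) (blk12 M) (blk21 M) (blk22 M) = M"
  by (simp add: blk11_def blk12_def blk21_def blk22_def vec_eq_iff forall_sum)

lemma blk_eq_iff [simp]:
  "blk a b c d = blk a' b' c' d' \<longleftrightarrow> a = a' \<and> b = b' \<and> c = c' \<and> d = d'"
  by (metis blk_blocks)

lemma blk_mult:
  fixes a :: "'a::semiring_1 ^ _ ^ _"
  shows "blk a b c d ** blk a' b' c' d' =
    blk (a ** a' + b ** c') (a ** b' + b ** d') (c ** a' + d ** c') (c ** b' + d ** d')"
  by (simp add: vec_eq_iff forall_sum matrix_matrix_mult_def sum_UNIV_Plus)

lemma blk_mult_blkv:
  fixes a :: "'a::semiring_1 ^ _ ^ _"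
  shows "blk a b c d ** blkv u l = blkv (a ** u + b ** l) (c ** u + d ** l)"
  by (simp add: vec_eq_iff forall_sum matrix_matrix_mult_def sum_UNIV_Plus)

lemma mult_blkh:
  fixes m :: "'a::semiring_1 ^ _ ^ _"
  shows "m ** blkh u l = blkh (m ** u) (m ** l)"
  by (simp add: vec_eq_iff forall_sum matrix_matrix_mult_def)

lemma blkv_mult:
  fixes m :: "'a::semiring_1 ^ _ ^ _"
  shows "blkv u l ** m = blkv (u ** m) (l ** m)"
  by (simp add: vec_eq_iff forall_sum matrix_matrix_mult_def)

lemma blk_mult_vcat:
  fixes a :: "'a::semiring_1 ^ _ ^ _"
  shows "blk a b c d *v vcat x y = vcat (a *v x + b *v y) (c *v x + d *v y)"
  by (simp add: vec_eq_iff forall_sum matrix_vector_mult_def sum_UNIV_Plus)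

lemma transpose_blk: "transpose (blk a b c d) = blk (transpose a) (transpose c) (transpose b) (transpose d)"
  by (simp add: vec_eq_iff forall_sum transpose_def)

lemma transpose_blkh: "transpose (blkh u l) = blkv (transpose u) (transpose l)"
  by (simp add: vec_eq_iff forall_sum transpose_def)

lemma transpose_blkv: "transpose (blkv u l) = blkh (transpose u) (transpose l)"
  by (simp add: vec_eq_iff forall_sum transpose_def)

lemma blk_eq_blkv: "blk a b c d = blkv (blkh a b) (blkh c d)"
  by (simp add: blk_def)

lemma blk_eq_blkh: "blk a b c d = blkh (blkv a c) (blkv b d)"
  by (simp add: vec_eq_iff forall_sum)

lemma blk_add: "blk a b c d + blk a' b' c' d' = blk (a + a') (b + b') (c + c') (d + d')"
  by (simp add: vec_eq_iff forall_sum)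

lemma blk_uminus: "- blk a b c d = blk (- a) (- b) (- c) (- d)"
  by (simp add: vec_eq_iff forall_sum)

lemma blk_scaleR: "t *\<^sub>R blk a b c d = blk (t *\<^sub>R a) (t *\<^sub>R b) (t *\<^sub>R c) (t *\<^sub>R d)"
  by (simp add: vec_eq_iff forall_sum)

lemma mat_blk: "mat k = blk (mat k) 0 0 (mat k)"
  by (simp add: vec_eq_iff forall_sum mat_def)

lemma transpose_add: "transpose (M + N) = transpose M + transpose N"
  by (simp add: vec_eq_iff transpose_def)

lemma transpose_diff: "transpose (M - N) = transpose M - transpose (N::'a::ab_group_add^_^_)"
  by (simp add: vec_eq_iff transpose_def)

lemma transpose_uminus: "transpose (- M) = - transpose (M::'a::ab_group_add^_^_)"
  by (simp add: vec_eq_iff transpose_def)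

lemma transpose_zero [simp]: "transpose 0 = 0"
  by (simp add: vec_eq_iff transpose_def)

lemma matrix_mul_zero [simp]: "M ** 0 = (0 :: 'a::semiring_1^_^_)" "0 ** M = (0 :: 'a::semiring_1^_^_)"
  by (simp_all add: vec_eq_iff matrix_matrix_mult_def)

lemma matrix_mul_uminus [simp]:
  fixes M :: "'a::ring_1^_^_"
  shows "M ** (- N) = - (M ** N)" "(- M) ** N = - (M ** N)"
  by (simp_all add: vec_eq_iff matrix_matrix_mult_def sum_negf)

lemma matrix_mul_add:
  fixes M :: "'a::ring_1^_^_"
  shows "M ** (N + N') = M ** N + M ** N'" "(M + M') ** N = M ** N + M' ** N"
  by (simp_all add: vec_eq_iff matrix_matrix_mult_def sum.distrib algebra_simps)

lemma matrix_mul_diff: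
  fixes M :: "'a::ring_1^_^_"
  shows "M ** (N - N') = M ** N - M ** N'" "(M - M') ** N = M ** N - M' ** N"
  by (simp_all add: vec_eq_iff matrix_matrix_mult_def sum_subtractf algebra_simps)

lemma matrix_mul_scaleR [simp]:
  fixes M :: "real^_^_"
  shows "M ** (t *\<^sub>R N) = t *\<^sub>R (M ** N)" "(t *\<^sub>R M) ** N = t *\<^sub>R (M ** N)"
  by (simp_all add: vec_eq_iff matrix_matrix_mult_def sum_distrib_left mult_ac)

lemma mat_mult_left [simp]: "mat k ** M = k *\<^sub>R (M :: real^_^_)"
proof -
  have "mat k = k *\<^sub>R (mat 1 :: real^_^_)" by (simp add: vec_eq_iff mat_def)
  then show ?thesis by (metis matrix_mul_lid matrix_mul_scaleR(2))
qed

lemma mat_mult_vec [simp]: "mat k *v x = k *\<^sub>R (x :: real^_)"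
proof -
  have "(if i = j then k else 0) * x $ j = (if i = j then k * x $ j else 0)" for i j by simp
  then show ?thesis by (simp add: vec_eq_iff mat_def matrix_vector_mult_def)
qed

lemma inner_transpose: "x \<bullet> (transpose M *v y) = (M *v x) \<bullet> (y :: real^_)"
  by (metis dot_lmul_matrix inner_commute transpose_matrix_vector)

lemma uminus_matrix_vector [simp]: "(- M) *v x = - (M *v (x :: 'a::ring_1^_))"
  by (simp add: vec_eq_iff matrix_vector_mult_def sum_negf)

lemma matrix_vector_uminus [simp]: "M *v (- x) = - (M *v (x :: 'a::ring_1^_))"
  by (simp add: vec_eq_iff matrix_vector_mult_def sum_negf)

section \<open>Inverses\<close>

lemma matrix_inv_inverse:
  assumes "invertible M"
  shows "M ** matrix_inv M = mat 1" "matrix_inv M ** M = mat 1"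
  using assms unfolding invertible_def matrix_inv_def
  by (metis (mono_tags, lifting) someI_ex)+

lemma matrix_inv_eqI:
  fixes M :: "'a::field^'n^'n"
  assumes "M ** N = mat 1"
  shows "invertible M" "matrix_inv M = N"
proof -
  have *: "N ** M = mat 1" using assms matrix_left_right_inverse by blast
  show i: "invertible M" using assms * invertible_def by blast
  show "matrix_inv M = N"
    using matrix_inv_inverse[OF i] * by (metis assms matrix_mul_assoc matrix_mul_lid matrix_mul_rid)
qed

lemma invertible_iff_ker:
  fixes M :: "'a::field^'n^'n"
  shows "invertible M \<longleftrightarrow> (\<forall>x. M *v x = 0 \<longrightarrow> x = 0)"
  using invertible_left_inverse matrix_left_invertible_ker by blast

lemma transpose_matrix_inv:
  fixes M :: "'a::field^'n^'n"
  assumes "invertible M"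
  shows "transpose (matrix_inv M) = matrix_inv (transpose M)"
  by (metis assms matrix_inv_eqI(2) matrix_inv_inverse(2) matrix_transpose_mul transpose_mat)

section \<open>Semidefinite matrices\<close>

lemma symmat_D: "M \<in> symmat \<Longrightarrow> transpose M = M"
  by (simp add: symmat_def)

lemma symmat_inner: "M \<in> symmat \<Longrightarrow> x \<bullet> (M *v y) = (M *v x) \<bullet> y"
  by (metis inner_transpose symmat_D)

lemma posdef_imp_psd: "posdef M \<Longrightarrow> psd M"
  unfolding posdef_def psd_def by (metis inner_zero_left less_imp_le order_refl)

lemma congruence_inner: "x \<bullet> ((transpose T ** M ** T) *v x) = (T *v x) \<bullet> (M *v (T *v x))"
  for M :: "real^_^_"
  by (simp add: matrix_vector_mul_assoc[symmetric] inner_transpose)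

lemma congruence_symmat: "M \<in> symmat \<Longrightarrow> transpose T ** M ** T \<in> symmat"
  for M :: "real^_^_"
  by (simp add: symmat_def matrix_transpose_mul matrix_mul_assoc)

lemma psd_congruence: "psd M \<Longrightarrow> psd (transpose T ** M ** T)"
  unfolding psd_def by (simp add: congruence_inner congruence_symmat)

lemma posdef_congruence:
  assumes "posdef M" "\<And>x. T *v x = 0 \<Longrightarrow> x = 0"
  shows "posdef (transpose T ** M ** T)"
  using assms unfolding posdef_def by (auto simp: congruence_inner congruence_symmat)

lemma congruence_inverse:
  fixes M :: "real^'n^'n"
  assumes "invertible T"
  shows "M = transpose (matrix_inv T) ** (transpose T ** M ** T) ** matrix_inv T"
proof -
  have "transpose (matrix_inv T) ** (transpose T ** M ** T) ** matrix_inv T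
      = transpose (T ** matrix_inv T) ** M ** (T ** matrix_inv T)"
    by (simp add: matrix_transpose_mul matrix_mul_assoc)
  then show ?thesis using assms by (simp add: matrix_inv_inverse)
qed

lemma psd_congruence_iff:
  assumes "invertible T"
  shows "psd (transpose T ** M ** T) \<longleftrightarrow> psd M"
  using psd_congruence congruence_inverse[OF assms, of M] by metis

lemma invertible_matrix_inv: "invertible T \<Longrightarrow> invertible (matrix_inv T)"
  for T :: "'a::field^'n^'n"
  using matrix_inv_inverse(2) matrix_inv_eqI(1) by metis

lemma posdef_congruence_iff:
  fixes T :: "real^'n^'n"
  assumes "invertible T"
  shows "posdef (transpose T ** M ** T) \<longleftrightarrow> posdef M"
proof
  assume "posdef (transpose T ** M ** T)"
  moreover have "x = 0" if "matrix_inv T *v x = 0" for x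
    using invertible_matrix_inv[OF assms] that by (simp add: invertible_iff_ker)
  ultimately show "posdef M"
    using posdef_congruence congruence_inverse[OF assms, of M] by metis
next
  assume "posdef M"
  then show "posdef (transpose T ** M ** T)"
    using assms by (intro posdef_congruence) (simp_all add: invertible_iff_ker)
qed

lemma psd_kernel:
  assumes "psd M" "x \<bullet> (M *v x) = 0"
  shows "M *v x = 0"
proof -
  define y where "y = M *v x"
  have sym: "M \<in> symmat" and nn: "\<And>z. 0 \<le> z \<bullet> (M *v z)"
    using assms(1) unfolding psd_def by auto
  have eq: "(x + t *\<^sub>R y) \<bullet> (M *v (x + t *\<^sub>R y)) = 2 * t * (y \<bullet> y) + t\<^sup>2 * (y \<bullet> (M *v y))" for t
    using assms(2) symmat_inner[OF sym, of x y]
    by (simp add: algebra_simps inner_add_left inner_add_right y_def[symmetric] power2_eq_square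
        matrix_vector_right_distrib matrix_vector_mult_scaleR)
  define c where "c = y \<bullet> (M *v y)"
  have c0: "c \<ge> 0" using nn c_def by simp
  show ?thesis
  proof (rule ccontr)
    assume "M *v x \<noteq> 0"
    then have yy: "y \<bullet> y > 0" by (simp add: y_def)
    have "0 \<le> 2 * t * (y \<bullet> y) + t\<^sup>2 * c" for t using nn[of "x + t *\<^sub>R y"] eq[of t] c_def by simp
    \<comment> \<open>The linear term dominates for small negative \<open>t\<close>; the denominator \<open>c + 1\<close> avoids the case \<open>c = 0\<close>.\<close>
    from this[of "- (y \<bullet> y) / (c + 1)"]
    have "0 \<le> - 2 * (y \<bullet> y)\<^sup>2 / (c + 1) + (y \<bullet> y)\<^sup>2 * (c / (c + 1)\<^sup>2)"
      by (simp add: power_divide power2_eq_square)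
    moreover have "c / (c + 1)\<^sup>2 \<le> 1 / (c + 1)"
      using c0 by (simp add: divide_simps power2_eq_square)
    then have "(y \<bullet> y)\<^sup>2 * (c / (c + 1)\<^sup>2) \<le> (y \<bullet> y)\<^sup>2 * (1 / (c + 1))"
      by (intro mult_left_mono) auto
    moreover have "(y \<bullet> y)\<^sup>2 * (1 / (c + 1)) > 0" using yy c0 by simp
    ultimately show False by simp
  qed
qed

lemma posdef_iff_psd_invertible: "posdef M \<longleftrightarrow> psd M \<and> invertible M"
proof
  assume p: "posdef M"
  then have "x = 0" if "M *v x = 0" for x using that unfolding posdef_def
    by (metis inner_zero_right less_irrefl)
  with p show "psd M \<and> invertible M" using posdef_imp_psd invertible_iff_ker by blast
next
  assume p: "psd M \<and> invertible M"
  then have "0 < x \<bullet> (M *v x)" if "x \<noteq> 0" for x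
    using psd_kernel[of M x] that unfolding psd_def invertible_iff_ker
    by (metis order_le_less)
  with p show "posdef M" by (auto simp: posdef_def psd_def)
qed

lemma posdef_bound:
  fixes M :: "real^'n^'n"
  assumes "posdef M"
  obtains c where "c > 0" "\<And>x. c * (x \<bullet> x) \<le> x \<bullet> (M *v x)"
proof -
  have "compact (sphere (0::real^'n) 1)" by simp
  moreover have "sphere (0::real^'n) 1 \<noteq> {}" by simp
  moreover have "continuous_on (sphere (0::real^'n) 1) (\<lambda>x. x \<bullet> (M *v x))"
    by (intro continuous_intros linear_continuous_on matrix_vector_mul_bounded_linear)
  ultimately obtain x0 where x0: "x0 \<in> sphere 0 1"
    "\<And>x. x \<in> sphere 0 1 \<Longrightarrow> x0 \<bullet> (M *v x0) \<le> x \<bullet> (M *v x)"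
    using continuous_attains_inf by metis
  define c where "c = x0 \<bullet> (M *v x0)"
  have "x0 \<noteq> 0" using x0(1) by auto
  then have "c > 0" using assms unfolding posdef_def c_def by blast
  moreover have "c * (x \<bullet> x) \<le> x \<bullet> (M *v x)" for x
  proof (cases "x = 0")
    case False
    then have "c \<le> (x /\<^sub>R norm x) \<bullet> (M *v (x /\<^sub>R norm x))"
      using x0(2)[of "x /\<^sub>R norm x"] c_def by simp
    also have "\<dots> = (x \<bullet> (M *v x)) / (x \<bullet> x)"
      using False by (simp add: matrix_vector_mult_scaleR divide_inverse
          dot_square_norm power2_eq_square mult_ac)
    finally show ?thesis using False by (simp add: field_simps)
  qed simp
  ultimately show ?thesis using that by blast
qed

lemma quadratic_form_bound:
  fixes M :: "real^'n^'m"
  obtains k where "k > 0" "\<And>x y. \<bar>x \<bullet> (M *v y)\<bar> \<le> k * (norm x * norm y)"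
proof -
  obtain k where k: "k > 0" "\<And>y. norm (M *v y) \<le> norm y * k"
    using bounded_linear.pos_bounded[OF matrix_vector_mul_bounded_linear[of M]] by blast
  show ?thesis
  proof
    show "k > 0" by fact
    fix x y
    have "\<bar>x \<bullet> (M *v y)\<bar> \<le> norm x * norm (M *v y)" by (rule Cauchy_Schwarz_ineq2)
    also have "\<dots> \<le> norm x * (norm y * k)" by (intro mult_left_mono k norm_ge_zero)
    finally show "\<bar>x \<bullet> (M *v y)\<bar> \<le> k * (norm x * norm y)" by (simp add: mult_ac)
  qed
qed

lemma symmat_add: "M \<in> symmat \<Longrightarrow> N \<in> symmat \<Longrightarrow> M + N \<in> symmat"
  by (simp add: symmat_def transpose_add)

lemma symmat_scaleR: "M \<in> symmat \<Longrightarrow> t *\<^sub>R M \<in> symmat"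
  by (simp add: symmat_def transpose_scalar)

lemma posdef_add_psd: "posdef M \<Longrightarrow> psd N \<Longrightarrow> posdef (M + N)"
  unfolding posdef_def psd_def
  by (auto simp: symmat_add matrix_vector_mult_add_rdistrib inner_add_right intro: add_pos_nonneg)

lemma psd_add: "psd M \<Longrightarrow> psd N \<Longrightarrow> psd (M + N)"
  unfolding psd_def by (auto simp: symmat_add matrix_vector_mult_add_rdistrib inner_add_right)

lemma psd_scaleR: "psd M \<Longrightarrow> t \<ge> 0 \<Longrightarrow> psd (t *\<^sub>R M)"
  unfolding psd_def by (auto simp: symmat_scaleR scaleR_matrix_vector_assoc[symmetric])

lemma posdef_scaleR: "posdef M \<Longrightarrow> t > 0 \<Longrightarrow> posdef (t *\<^sub>R M)"
  unfolding posdef_def by (auto simp: symmat_scaleR scaleR_matrix_vector_assoc[symmetric])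

lemma posdef_perturb:
  fixes M E :: "real^'n^'n"
  assumes "posdef M" "E \<in> symmat"
  obtains \<delta> where "\<delta> > 0" "\<And>t. \<bar>t\<bar> < \<delta> \<Longrightarrow> posdef (M + t *\<^sub>R E)"
proof -
  obtain c where c: "c > 0" "\<And>x. c * (x \<bullet> x) \<le> x \<bullet> (M *v x)" using posdef_bound assms(1) by blast
  obtain k where k: "k > 0" "\<And>x y. \<bar>x \<bullet> (E *v y)\<bar> \<le> k * (norm x * norm y)"
    using quadratic_form_bound by blast
  show ?thesis
  proof
    show "c / k > 0" using c k by simp
    fix t assume t: "\<bar>t\<bar> < c / k"
    have "0 < x \<bullet> ((M + t *\<^sub>R E) *v x)" if x: "x \<noteq> 0" for x
    proof -
      have xx: "x \<bullet> x > 0" using x by simp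
      have "\<bar>t * (x \<bullet> (E *v x))\<bar> \<le> \<bar>t\<bar> * (k * (x \<bullet> x))"
        using k(2)[of x x] by (simp add: abs_mult mult_left_mono dot_square_norm power2_eq_square)
      also have "\<dots> < (c / k) * (k * (x \<bullet> x))" using t xx k by (intro mult_strict_right_mono) auto
      also have "\<dots> = c * (x \<bullet> x)" using k by simp
      also have "\<dots> \<le> x \<bullet> (M *v x)" by (rule c(2))
      finally show ?thesis
        by (simp add: matrix_vector_mult_add_rdistrib inner_add_right scaleR_matrix_vector_assoc[symmetric])
    qed
    then show "posdef (M + t *\<^sub>R E)" using assms unfolding posdef_def
      by (auto intro: symmat_add symmat_scaleR)
  qed
qed

lemma blk_symmat_iff: "blk a b c d \<in> symmat \<longleftrightarrow> a \<in> symmat \<and> c = transpose b \<and> d \<in> symmat"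
  by (auto simp: symmat_def transpose_blk)

lemma blk_inner:
  fixes a :: "real^'n^'n" and b :: "real^'m^'n"
  shows "vcat x y \<bullet> (blk a b (transpose b) d *v vcat x y) = x \<bullet> (a *v x) + 2 * (x \<bullet> (b *v y)) + y \<bullet> (d *v y)"
  using inner_transpose[of y b x] by (simp add: blk_mult_vcat inner_add_right inner_commute)

lemma psd_blk_iff: "psd (blk a b (transpose b) d) \<longleftrightarrow> a \<in> symmat \<and> d \<in> symmat \<and>
    (\<forall>x y. 0 \<le> x \<bullet> (a *v x) + 2 * (x \<bullet> (b *v y)) + y \<bullet> (d *v y))"
  unfolding psd_def blk_symmat_iff by (metis blk_inner vcat_exhaust)

lemma posdef_blk_iff: "posdef (blk a b (transpose b) d) \<longleftrightarrow> a \<in> symmat \<and> d \<in> symmat \<and>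
    (\<forall>x y. x \<noteq> 0 \<or> y \<noteq> 0 \<longrightarrow> 0 < x \<bullet> (a *v x) + 2 * (x \<bullet> (b *v y)) + y \<bullet> (d *v y))"
  unfolding posdef_def blk_symmat_iff by (metis blk_inner vcat_exhaust vcat_eq_0_iff)

lemma mat_symmat [simp]: "mat k \<in> symmat" by (simp add: symmat_def)

lemma posdef_blk_large:
  fixes a :: "real^'n^'n" and b :: "real^'m^'n"
  assumes "posdef a"
  obtains k where "k > 0" "\<And>g. g \<ge> k \<Longrightarrow> posdef (blk a b (transpose b) (mat g))"
proof -
  obtain c where c: "c > 0" "\<And>x. c * (x \<bullet> x) \<le> x \<bullet> (a *v x)" using posdef_bound assms(1) by blast
  obtain k where k: "k > 0" "\<And>x y. \<bar>x \<bullet> (b *v y)\<bar> \<le> k * (norm x * norm y)"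
    using quadratic_form_bound by blast
  show ?thesis
  proof
    \<comment> \<open>\<open>k\<^sup>2/c\<close> pays for the completed square, the remaining \<open>1\<close> makes the form definite in \<open>y\<close>.\<close>
    show "k\<^sup>2 / c + 1 > 0" using c k by (simp add: add_pos_pos)
    fix g assume g: "k\<^sup>2 / c + 1 \<le> g"
    have "0 < x \<bullet> (a *v x) + 2 * (x \<bullet> (b *v y)) + y \<bullet> (mat g *v y)" if xy: "x \<noteq> 0 \<or> y \<noteq> 0" for x y
    proof -
      have le: "x \<bullet> (a *v x) + 2 * (x \<bullet> (b *v y)) + y \<bullet> (mat g *v y)
        \<ge> c * (norm x)\<^sup>2 - 2 * k * (norm x * norm y) + g * (norm y)\<^sup>2"
        using c(2)[of x] k(2)[of x y] by (simp add: dot_square_norm)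
      have "g * (norm y)\<^sup>2 \<ge> (k\<^sup>2 / c + 1) * (norm y)\<^sup>2" using g by (intro mult_right_mono) auto
      then have "c * (norm x)\<^sup>2 - 2 * k * (norm x * norm y) + g * (norm y)\<^sup>2
         \<ge> c * (norm x - k / c * norm y)\<^sup>2 + (norm y)\<^sup>2"
      proof -
        have "c * (norm x - k / c * norm y)\<^sup>2
            = c * (norm x)\<^sup>2 - 2 * k * (norm x * norm y) + k\<^sup>2 / c * (norm y)\<^sup>2"
          using c(1) by (simp add: power2_diff field_simps power2_eq_square)
        then show ?thesis using \<open>g * (norm y)\<^sup>2 \<ge> (k\<^sup>2 / c + 1) * (norm y)\<^sup>2\<close>
          by (simp add: algebra_simps)
      qed
      moreover have "c * (norm x - k / c * norm y)\<^sup>2 + (norm y)\<^sup>2 > 0"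
      proof (cases "y = 0")
        case True then show ?thesis using xy c by simp
      next
        case False then show ?thesis using c by (intro add_nonneg_pos) auto
      qed
      ultimately show ?thesis using le by linarith
    qed
    then show "posdef (blk a b (transpose b) (mat g))"
      using assms unfolding posdef_blk_iff by (auto simp: posdef_def)
  qed
qed

section \<open>The resolvent on the imaginary axis\<close>

text \<open>Cramer's rule: the entries of the inverse are rational functions of the entries of the matrix.  Holomorphy of the
  resolvent and smoothness of matrix inversion both come from this.\<close>

lemma matrix_inv_entry:
  fixes M :: "'a::field^'n^'n"
  assumes "invertible M"
  shows "matrix_inv M $ i $ j = det (\<chi> r c. if c = i then (if r = j then 1 else 0) else M $ r $ c) / det M"
proof -
  have "M *v column j (matrix_inv M) = axis j 1"
  proof -
    have "(M *v column j (matrix_inv M)) $ r = (M ** matrix_inv M) $ r $ j" for r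
      by (simp add: matrix_vector_mult_def matrix_matrix_mult_def column_def)
    then show ?thesis using assms by (simp add: vec_eq_iff matrix_inv_inverse mat_def axis_def)
  qed
  moreover have "det M \<noteq> 0" using assms invertible_det_nz by blast
  ultimately have "column j (matrix_inv M) =
      (\<chi> k. det (\<chi> r c. if c = k then axis j 1 $ r else M $ r $ c) / det M)"
    using cramer[of M "column j (matrix_inv M)" "axis j 1"] by blast
  then have "column j (matrix_inv M) $ i = det (\<chi> r c. if c = i then axis j 1 $ r else M $ r $ c) / det M"
    by simp
  moreover have "(\<chi> r c. if c = i then axis j 1 $ r else M $ r $ c)
      = (\<chi> r c. if c = i then (if r = j then 1 else 0) else M $ r $ c)"
    by (auto simp: vec_eq_iff axis_def)
  ultimately show ?thesis by (simp add: column_def)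
qed

text \<open>The resolvent \<open>(s - A)\<inverse>\<close>; its values are meaningful where \<open>s\<close> is not an eigenvalue of \<open>A\<close>.\<close>

definition resolvent :: "real^'n^'n \<Rightarrow> complex \<Rightarrow> complex^'n^'n" where
  "resolvent A s = matrix_inv (mat s - cmat A)"

lemma mat_scaled_vec: "mat s *v v = s *s (v :: 'a::comm_ring_1^'n)"
proof -
  have "(if i = j then s else 0) * v $ j = (if i = j then s * v $ j else 0)" for i j by simp
  then show ?thesis by (simp add: vec_eq_iff mat_def matrix_vector_mult_def)
qed

lemma hurwitz_invertible:
  assumes "hurwitz A" "Re s \<ge> 0"
  shows "invertible (mat s - cmat A)"
  unfolding invertible_iff_ker
proof (intro allI impI)
  fix v assume "(mat s - cmat A) *v v = 0"
  then have "cmat A *v v = s *s v" by (simp add: matrix_vector_mult_diff_rdistrib mat_scaled_vec)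
  then show "v = 0" using assms unfolding hurwitz_def by fastforce
qed

lemma holomorphic_on_det:
  assumes "\<And>i j. (\<lambda>s. M s $ i $ j) holomorphic_on S"
  shows "(\<lambda>s. det (M s :: complex^'n^'n)) holomorphic_on S"
  unfolding det_def by (intro holomorphic_intros assms)

lemma holomorphic_resolvent:
  fixes A :: "real^'n^'n"
  shows "(\<lambda>s. resolvent A s $ i $ j) holomorphic_on {s. det (mat s - cmat A) \<noteq> 0}" (is "_ holomorphic_on ?O")
proof -
  have ent: "(\<lambda>s. (mat s - cmat A) $ r $ c) holomorphic_on S" for r c S
    by (cases "r = c") (auto simp: mat_def intro!: holomorphic_intros)
  have "(\<lambda>s. det (\<chi> r c. if c = i then (if r = j then 1 else 0) else (mat s - cmat A) $ r $ c) / det (mat s - cmat A))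
     holomorphic_on ?O"
  proof (intro holomorphic_intros holomorphic_on_det ent)
    show "(\<lambda>s. (\<chi> r c. if c = i then (if r = j then 1 else 0) else (mat s - cmat A) $ r $ c) $ r $ c) holomorphic_on ?O" for r c
      using ent by (cases "c = i"; cases "r = j") (auto intro!: holomorphic_intros)
  qed auto
  then show ?thesis
    by (rule holomorphic_transform) (simp add: resolvent_def matrix_inv_entry invertible_det_nz)
qed

lemma norm_smult_complex: "norm (s *s (x :: complex^'n)) = cmod s * norm x"
  by (simp add: norm_vec_def L2_set_def norm_mult power_mult_distrib sum_distrib_left[symmetric] real_sqrt_mult)

lemma resolvent_column_eq:
  assumes "hurwitz A" "Re s \<ge> 0"
  shows "s *s column j (resolvent A s) = axis j 1 + cmat A *v column j (resolvent A s)"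
proof -
  have "(mat s - cmat A) ** resolvent A s = mat 1"
    using hurwitz_invertible[OF assms] by (simp add: resolvent_def matrix_inv_inverse)
  then have "(mat s - cmat A) *v column j (resolvent A s) = axis j 1"
    by (simp add: vec_eq_iff matrix_vector_mult_def matrix_matrix_mult_def column_def mat_def axis_def)
  then show ?thesis
    by (simp add: matrix_vector_mult_diff_rdistrib mat_scaled_vec algebra_simps)
qed

text \<open>\<open>G(s) = I/(s + 1) + O(1/|s|\<^sup>2)\<close> in the closed right half plane, because \<open>s G = I + A G\<close>.  The comparison function has
  its pole at \<open>-1\<close>, outside of that half plane, so that the difference stays holomorphic there.\<close>

lemma resolvent_asymptotics:
  fixes A :: "real^'n^'n"
  assumes "hurwitz A"
  obtains K R0 where "R0 > 0" "K \<ge> 0"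
    "\<And>s. Re s \<ge> 0 \<Longrightarrow> cmod s \<ge> R0 \<Longrightarrow>
       cmod (resolvent A s $ i $ j - (if i = j then 1 else 0) / (s + 1)) \<le> K / (cmod s)\<^sup>2"
proof -
  obtain k where k: "k > 0" "\<And>x. norm (cmat A *v x) \<le> norm x * k"
    using bounded_linear.pos_bounded[OF matrix_vector_mul_bounded_linear[of "cmat A"]] by blast
  show ?thesis
  proof
    show "2 * k > 0" "1 + 2 * k \<ge> 0" using k by simp_all
    fix s assume s: "Re s \<ge> 0" "cmod s \<ge> 2 * k"
    define x where "x = column j (resolvent A s)"
    have eq: "s *s x = axis j 1 + cmat A *v x"
      unfolding x_def by (rule resolvent_column_eq[OF assms s(1)])
    have spos: "cmod s > 0" using s(2) k(1) by linarith
    have "cmod s * norm x \<le> 1 + k * norm x"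
    proof -
      have "cmod s * norm x = norm (axis j 1 + cmat A *v x)" by (simp add: eq[symmetric] norm_smult_complex)
      also have "\<dots> \<le> norm (axis j (1::complex) :: complex^'n) + norm (cmat A *v x)" by (rule norm_triangle_ineq)
      also have "norm (axis j (1::complex) :: complex^'n) = 1" by simp
      finally show ?thesis using k(2)[of x] by (simp add: mult.commute)
    qed
    moreover have "2 * (k * norm x) \<le> cmod s * norm x"
      using s(2) mult_right_mono[of "2 * k" "cmod s" "norm x"] by simp
    ultimately have x: "cmod s * norm x \<le> 2" by linarith
    have s1: "cmod (s + 1) \<ge> cmod s"
    proof -
      have "(cmod s)\<^sup>2 \<le> (cmod (s + 1))\<^sup>2" using s(1) by (simp add: cmod_power2 power2_sum)
      then show ?thesis by (rule power2_le_imp_le) simp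
    qed
    then have s1': "s + 1 \<noteq> 0" "s \<noteq> 0" using spos by auto
    define d where "d = x - (1 / (s + 1)) *s axis j 1"
    have "s *s d = (1 / (s + 1)) *s axis j 1 + cmat A *v x"
    proof -
      have "s *s d = axis j 1 + cmat A *v x - (s / (s + 1)) *s axis j 1"
        by (simp add: d_def vector_ssub_ldistrib eq vector_smult_assoc)
      moreover have "axis j 1 = (1 / (s + 1)) *s axis j (1::complex) + (s / (s + 1)) *s axis j 1"
        using s1' by (simp add: vec_eq_iff axis_def add_divide_distrib[symmetric] add.commute)
      ultimately show ?thesis by (metis (no_types, lifting) add.commute add_diff_cancel_left' diff_add_eq)
    qed
    then have "cmod s * norm d \<le> cmod (1 / (s + 1)) + norm x * k"
      using norm_triangle_ineq[of "(1 / (s + 1)) *s axis j 1" "cmat A *v x"] k(2)[of x]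
      by (simp add: norm_smult_complex[symmetric]) (simp add: norm_smult_complex)
    moreover have "cmod (1 / (s + 1)) \<le> 1 / cmod s"
      using s1 spos by (simp add: norm_divide frac_le)
    moreover have "norm x * k \<le> 2 / cmod s * k"
      using x spos k by (intro mult_right_mono) (simp_all add: field_simps)
    ultimately have "cmod s * norm d \<le> (1 + 2 * k) / cmod s" by (simp add: add_divide_distrib)
    then have "norm d \<le> (1 + 2 * k) / (cmod s)\<^sup>2" using spos by (simp add: field_simps power2_eq_square)
    moreover have "resolvent A s $ i $ j - (if i = j then 1 else 0) / (s + 1) = d $ i"
      by (auto simp: d_def x_def column_def axis_def)
    ultimately show "cmod (resolvent A s $ i $ j - (if i = j then 1 else 0) / (s + 1)) \<le> (1 + 2 * k) / (cmod s)\<^sup>2"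
      using Finite_Cartesian_Product.norm_nth_le[of d i] by simp
  qed
qed

lemma continuous_on_resolvent:
  fixes A :: "real^'n^'n"
  assumes "hurwitz A"
  shows "continuous_on S (\<lambda>w. resolvent A (Complex 0 w) $ i $ j)"
proof -
  have "continuous_on {s. det (mat s - cmat A) \<noteq> 0} (\<lambda>s. resolvent A s $ i $ j)"
    by (rule holomorphic_on_imp_continuous_on[OF holomorphic_resolvent])
  moreover have "continuous_on S (\<lambda>w. Complex 0 w)"
    by (simp add: Complex_eq continuous_intros)
  ultimately show ?thesis
    by (rule continuous_on_compose2)
      (use hurwitz_invertible[OF assms] in \<open>auto simp: invertible_det_nz\<close>)
qed

text \<open>Cauchy's theorem for the half disc of radius \<open>R\<close> in the right half plane moves the integral over the imaginary segment
  to the arc, which has length \<open>\<pi> R\<close>.\<close>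

lemma Cauchy_half_disc:
  fixes f :: "complex \<Rightarrow> complex"
  assumes hol: "f holomorphic_on U" and U: "{s. 0 \<le> Re s} \<subseteq> U" and R: "R > 0"
    and K: "K \<ge> 0" "\<And>s. Re s \<ge> 0 \<Longrightarrow> cmod s = R \<Longrightarrow> cmod (f s) \<le> K"
  shows "cmod (integral {-R..R} (\<lambda>w. f (Complex 0 w))) \<le> K * R * pi"
proof -
  define arc where "arc = part_circlepath 0 R (- pi / 2) (pi / 2)"
  define a b where "a = Complex 0 (- R)" and "b = Complex 0 R"
  have hol': "f holomorphic_on {s. 0 \<le> Re s}" using hol U holomorphic_on_subset by blast
  have cont: "continuous_on {s. 0 \<le> Re s} f" by (rule holomorphic_on_imp_continuous_on[OF hol'])
  have arc_sub: "path_image arc \<subseteq> {s. 0 \<le> Re s}"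
    using R unfolding arc_def path_image_part_circlepath'
    by (auto simp: closed_segment_eq_real_ivl Re_exp intro!: mult_nonneg_nonneg cos_ge_zero)
  have seg_sub: "path_image (linepath b a) \<subseteq> {s. 0 \<le> Re s}"
    unfolding path_image_linepath
    by (rule closed_segment_subset) (auto simp: a_def b_def convex_halfspace_Re_ge)
  have ends: "pathstart arc = a" "pathfinish arc = b"
    by (simp_all add: arc_def a_def b_def complex_eq_iff Re_exp Im_exp)
  have valid: "valid_path arc" by (simp add: arc_def)
  have 1: "(f has_contour_integral 0) (arc +++ linepath b a)"
  proof (rule Cauchy_theorem_convex_simple[OF hol' convex_halfspace_Re_ge])
    show "valid_path (arc +++ linepath b a)" using valid ends by (simp add: valid_path_join)
    show "path_image (arc +++ linepath b a) \<subseteq> {x. 0 \<le> Re x}"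
      using arc_sub seg_sub ends by (simp add: path_image_join)
    show "pathfinish (arc +++ linepath b a) = pathstart (arc +++ linepath b a)" using ends by simp
  qed
  have i1: "f contour_integrable_on arc"
    unfolding arc_def by (intro contour_integrable_continuous_part_circlepath continuous_on_subset[OF cont])
      (use arc_sub arc_def in simp)
  have i2: "f contour_integrable_on (linepath b a)"
    by (intro contour_integrable_continuous_linepath continuous_on_subset[OF cont])
      (use seg_sub in simp)
  have "contour_integral arc f + contour_integral (linepath b a) f = 0"
    using contour_integral_unique[OF 1] contour_integral_join[OF i1 i2 valid] ends by simp
  moreover have "contour_integral (linepath a b) f = - contour_integral (linepath b a) f"
    by (rule contour_integral_reverse_linepath)
      (use seg_sub in \<open>auto intro!: continuous_on_subset[OF cont] simp: closed_segment_commute\<close>)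
  moreover have "contour_integral (linepath a b) f = \<i> * integral {-R..R} (\<lambda>w. f (Complex 0 w))"
    by (rule contour_integral_linepath_same_Re) (use R in \<open>simp_all add: a_def b_def\<close>)
  ultimately have "\<i> * integral {-R..R} (\<lambda>w. f (Complex 0 w)) = contour_integral arc f"
    by (simp add: eq_neg_iff_add_eq_0 add.commute) (metis add_right_cancel add.commute)
  then have "cmod (integral {-R..R} (\<lambda>w. f (Complex 0 w))) = cmod (contour_integral arc f)"
    by (metis norm_mult norm_ii mult_1)
  also have "\<dots> \<le> K * R * \<bar>pi / 2 - (- pi / 2)\<bar>"
    unfolding arc_def
  proof (rule contour_integral_bound_part_circlepath)
    show "f contour_integrable_on part_circlepath 0 R (- pi / 2) (pi / 2)" using i1 arc_def by simp
    fix x assume x: "x \<in> path_image (part_circlepath 0 R (- pi / 2) (pi / 2))"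
    then have "cmod x = R" using in_path_image_part_circlepath[OF x] R by simp
    then show "cmod (f x) \<le> K" using K(2) x arc_sub arc_def by auto
  qed (use K R in auto)
  finally show ?thesis by simp
qed

lemma integral_cauchy_density:
  assumes "R \<ge> 0"
  shows "integral {-R..R} (\<lambda>w. 1 / (1 + w\<^sup>2)) = 2 * arctan R"
proof -
  have "((\<lambda>w. 1 / (1 + w\<^sup>2)) has_integral (arctan R - arctan (- R))) {-R..R}"
    by (rule fundamental_theorem_of_calculus)
      (use assms in \<open>auto simp: has_real_derivative_iff_has_vector_derivative[symmetric] divide_inverse
         intro!: derivative_eq_intros\<close>)
  then show ?thesis by (simp add: integral_unique arctan_minus)
qed

text \<open>The principal value integral of \<open>Re G(i\<omega>)\<close> is \<open>\<pi> I\<close>.\<close>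

lemma resolvent_integral_entry:
  fixes A :: "real^'n^'n"
  assumes "hurwitz A"
  shows "((\<lambda>R. integral {-R..R} (\<lambda>w. Re (resolvent A (Complex 0 w) $ i $ j))) \<longlongrightarrow>
      (if i = j then pi else 0)) at_top"
proof -
  define d :: real where "d = (if i = j then 1 else 0)"
  obtain K R0 where K: "R0 > 0" "K \<ge> 0"
    "\<And>s. Re s \<ge> 0 \<Longrightarrow> cmod s \<ge> R0 \<Longrightarrow>
       cmod (resolvent A s $ i $ j - (if i = j then 1 else 0) / (s + 1)) \<le> K / (cmod s)\<^sup>2"
    using resolvent_asymptotics[OF assms] by metis
  define f where "f s = resolvent A s $ i $ j - (if i = j then 1 else 0) / (s + 1)" for s
  define U where "U = {s. det (mat s - cmat A) \<noteq> 0} - {-1}"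
  have hol: "f holomorphic_on U"
    unfolding f_def U_def
    by (intro holomorphic_intros holomorphic_on_subset[OF holomorphic_resolvent])
      (auto simp: eq_neg_iff_add_eq_0)
  have U: "{s. 0 \<le> Re s} \<subseteq> U"
    using hurwitz_invertible[OF assms] by (auto simp: U_def invertible_det_nz)
  have cont: "continuous_on T (\<lambda>w. f (Complex 0 w))" for T
  proof (rule continuous_on_compose2[OF holomorphic_on_imp_continuous_on[OF hol]])
    show "continuous_on T (\<lambda>w. Complex 0 w)" by (simp add: Complex_eq continuous_intros)
    show "Complex 0 ` T \<subseteq> U" using U by auto
  qed
  have int: "integral {-R..R} (\<lambda>w. Re (resolvent A (Complex 0 w) $ i $ j))
      = Re (integral {-R..R} (\<lambda>w. f (Complex 0 w))) + d * (2 * arctan R)" if R: "R > 0" for R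
  proof -
    have eq: "Re (resolvent A (Complex 0 w) $ i $ j) = Re (f (Complex 0 w)) + d * (1 / (1 + w\<^sup>2))" for w
      by (simp add: f_def d_def complex_eq_iff Re_divide power2_eq_square)
    have fi: "(\<lambda>w. f (Complex 0 w)) integrable_on {-R..R}"
      by (rule integrable_continuous_real[OF cont])
    have gi: "(\<lambda>w. d * (1 / (1 + w\<^sup>2))) integrable_on {-R..R}"
      by (rule integrable_continuous_real) (auto intro!: continuous_intros simp: add_nonneg_eq_0_iff)
    have "integral {-R..R} (\<lambda>w. Re (f (Complex 0 w)) + d * (1 / (1 + w\<^sup>2)))
       = integral {-R..R} (\<lambda>w. Re (f (Complex 0 w))) + integral {-R..R} (\<lambda>w. d * (1 / (1 + w\<^sup>2)))"
      by (rule integral_add) (use integrable_linear[OF fi bounded_linear_Re] gi in \<open>simp_all add: o_def\<close>)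
    also have "integral {-R..R} (\<lambda>w. Re (f (Complex 0 w))) = Re (integral {-R..R} (\<lambda>w. f (Complex 0 w)))"
      using integral_linear[OF fi bounded_linear_Re] by (simp add: o_def)
    also have "integral {-R..R} (\<lambda>w. d * (1 / (1 + w\<^sup>2))) = d * (2 * arctan R)"
      using integral_cauchy_density[of R] R by (subst integral_mult_right) simp
    finally show ?thesis by (simp add: eq)
  qed
  have lim0: "((\<lambda>R. integral {-R..R} (\<lambda>w. f (Complex 0 w))) \<longlongrightarrow> 0) at_top"
  proof (rule Lim_null_comparison)
    show "\<forall>\<^sub>F R in at_top. norm (integral {-R..R} (\<lambda>w. f (Complex 0 w))) \<le> K * pi / R"
      using eventually_ge_at_top[of R0]
    proof eventually_elim
      case (elim R)
      then have R: "R > 0" using K(1) by simp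
      have "cmod (integral {-R..R} (\<lambda>w. f (Complex 0 w))) \<le> K / R\<^sup>2 * R * pi"
        by (rule Cauchy_half_disc[OF hol U R]) (use K elim in \<open>auto simp: f_def\<close>)
      then show ?case using R by (simp add: power2_eq_square)
    qed
    show "((\<lambda>R. K * pi / R) \<longlongrightarrow> 0) at_top"
      by (rule tendsto_divide_0[OF tendsto_const]) (simp add: filterlim_at_top_imp_at_infinity filterlim_ident)
  qed
  have "((\<lambda>R. Re (integral {-R..R} (\<lambda>w. f (Complex 0 w))) + d * (2 * arctan R)) \<longlongrightarrow> Re 0 + d * (2 * (pi / 2))) at_top"
    by (intro tendsto_intros lim0 tendsto_arctan_at_top)
  then have "((\<lambda>R. integral {-R..R} (\<lambda>w. Re (resolvent A (Complex 0 w) $ i $ j))) \<longlongrightarrow> Re 0 + d * (2 * (pi / 2))) at_top"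
    by (rule Lim_transform_eventually) (use int in \<open>auto intro: eventually_mono[OF eventually_gt_at_top[of 0]]\<close>)
  then show ?thesis by (cases "i = j") (simp_all add: d_def)
qed

section \<open>The Lyapunov equation\<close>

text \<open>Real and imaginary part of \<open>(i\<omega> - A)\<inverse>\<close>, entry by entry.\<close>

definition resolvent_re :: "real^'n^'n \<Rightarrow> real \<Rightarrow> real^'n^'n" where
  "resolvent_re A w = map_matrix Re (resolvent A (Complex 0 w))"

definition resolvent_im :: "real^'n^'n \<Rightarrow> real \<Rightarrow> real^'n^'n" where
  "resolvent_im A w = map_matrix Im (resolvent A (Complex 0 w))"

lemma resolvent_re_im_mult:
  assumes "hurwitz A"
  shows "resolvent_re A w ** A = - mat 1 - w *\<^sub>R resolvent_im A w"
    and "resolvent_im A w ** A = w *\<^sub>R resolvent_re A w"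
proof -
  let ?G = "resolvent A (Complex 0 w)"
  have "?G ** (mat (Complex 0 w) - cmat A) = mat 1"
    using hurwitz_invertible[OF assms] by (simp add: resolvent_def matrix_inv_inverse)
  then have eq: "?G ** mat (Complex 0 w) - ?G ** cmat A = mat 1" by (simp add: matrix_mul_diff)
  have ent: "(?G ** mat (Complex 0 w)) $ i $ j = ?G $ i $ j * Complex 0 w" for i j
    by (simp add: matrix_matrix_mult_def mat_def if_distrib[of "(*) _"] cong: if_cong)
  have eq': "?G $ i $ j * Complex 0 w - (?G ** cmat A) $ i $ j = (if i = j then 1 else 0)" for i j
    using arg_cong[OF eq, of "\<lambda>M. M $ i $ j"] by (simp add: ent) (simp add: mat_def)
  have re: "Re ((?G ** cmat A) $ i $ j) = (resolvent_re A w ** A) $ i $ j"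
    and im: "Im ((?G ** cmat A) $ i $ j) = (resolvent_im A w ** A) $ i $ j" for i j
    by (simp_all add: matrix_matrix_mult_def resolvent_re_def resolvent_im_def)
  show "resolvent_re A w ** A = - mat 1 - w *\<^sub>R resolvent_im A w"
    unfolding vec_eq_iff
  proof (intro allI)
    fix i j
    show "(resolvent_re A w ** A) $ i $ j = (- mat 1 - w *\<^sub>R resolvent_im A w) $ i $ j"
      using arg_cong[OF eq'[of i j], of Re] re[of i j]
      by (auto simp: mat_def resolvent_im_def algebra_simps split: if_splits)
  qed
  show "resolvent_im A w ** A = w *\<^sub>R resolvent_re A w"
    unfolding vec_eq_iff
  proof (intro allI)
    fix i j
    show "(resolvent_im A w ** A) $ i $ j = (w *\<^sub>R resolvent_re A w) $ i $ j"
      using arg_cong[OF eq'[of i j], of Im] im[of i j]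
      by (auto simp: resolvent_re_def algebra_simps split: if_splits)
  qed
qed

text \<open>The left-hand side is the real part of \<open>G S G\<^sup>*\<close> at \<open>i\<omega>\<close>.  In complex form the identity is
  \<open>G S G\<^sup>* = X G\<^sup>* + G X\<close>, which follows from \<open>S = (i\<omega> - A) X + X (i\<omega> - A)\<^sup>*\<close>.\<close>

lemma resolvent_gramian:
  assumes "hurwitz A" and lyap: "A ** X + X ** transpose A + S = 0"
  shows "resolvent_re A w ** S ** transpose (resolvent_re A w) + resolvent_im A w ** S ** transpose (resolvent_im A w)
     = resolvent_re A w ** X + X ** transpose (resolvent_re A w)"
proof -
  define g where "g = resolvent_re A w"
  define h where "h = resolvent_im A w"
  have gA: "g ** A = - mat 1 - w *\<^sub>R h" and hA: "h ** A = w *\<^sub>R g"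
    using resolvent_re_im_mult[OF assms(1)] by (simp_all add: g_def h_def)
  have gA': "transpose A ** transpose g = - mat 1 - w *\<^sub>R transpose h"
    using arg_cong[OF gA, of transpose]
    by (simp add: matrix_transpose_mul transpose_diff transpose_uminus transpose_scalar)
  have hA': "transpose A ** transpose h = w *\<^sub>R transpose g"
    using arg_cong[OF hA, of transpose] by (simp add: matrix_transpose_mul transpose_scalar)
  have S: "S = - (A ** X) - X ** transpose A" using lyap
    by (metis (no_types, lifting) add.commute add_diff_cancel_left' diff_add_eq eq_neg_iff_add_eq_0 minus_add_distrib uminus_add_conv_diff)
  have MSM: "M ** S ** transpose M = - ((M ** A) ** X ** transpose M) - M ** X ** (transpose A ** transpose M)" for M
    by (simp add: S matrix_mul_diff matrix_mul_assoc)
  have "g ** S ** transpose g + h ** S ** transpose h = g ** X + X ** transpose g"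
    unfolding MSM gA hA gA' hA' by (simp add: matrix_mul_diff matrix_mul_add scaleR_right_diff_distrib)
  then show ?thesis by (simp add: g_def h_def)
qed

lemma tendsto_matrix:
  fixes l :: "real^'n^'m"
  assumes "\<And>i j. ((\<lambda>R. f R $ i $ j) \<longlongrightarrow> l $ i $ j) F"
  shows "(f \<longlongrightarrow> l) F"
  by (rule vec_tendstoI, rule vec_tendstoI) (rule assms)

lemma continuous_on_matrix:
  fixes f :: "'a::topological_space \<Rightarrow> real^'n^'m"
  assumes "\<And>i j. continuous_on S (\<lambda>x. f x $ i $ j)"
  shows "continuous_on S f"
  using assms unfolding continuous_on_def by (auto intro: tendsto_matrix)

lemma continuous_on_resolvent_re: "hurwitz A \<Longrightarrow> continuous_on S (resolvent_re A)"
  by (rule continuous_on_matrix) (simp add: resolvent_re_def continuous_on_resolvent continuous_on_Re)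

lemma continuous_on_resolvent_im: "hurwitz A \<Longrightarrow> continuous_on S (resolvent_im A)"
  by (rule continuous_on_matrix) (simp add: resolvent_im_def continuous_on_resolvent continuous_on_Im)

lemma resolvent_re_integral:
  fixes A :: "real^'n^'n"
  assumes "hurwitz A"
  shows "((\<lambda>R. integral {-R..R} (resolvent_re A)) \<longlongrightarrow> pi *\<^sub>R mat 1) at_top"
proof (rule tendsto_matrix)
  fix i j
  have int: "resolvent_re A integrable_on {-R..R}" for R
    by (rule integrable_continuous_real[OF continuous_on_resolvent_re[OF assms]])
  have bl: "bounded_linear (\<lambda>M::real^'n^'n. M $ i $ j)"
    by (intro bounded_linear_compose[OF bounded_linear_vec_nth bounded_linear_vec_nth])
  have "integral {-R..R} (resolvent_re A) $ (i::'n) $ (j::'n) = integral {-R..R} (\<lambda>w. Re (resolvent A (Complex 0 w) $ i $ j))" for R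
    using integral_linear[OF int bl] by (simp add: o_def resolvent_re_def)
  then show "((\<lambda>R. integral {-R..R} (resolvent_re A) $ i $ j) \<longlongrightarrow> (pi *\<^sub>R mat 1) $ i $ j) at_top"
    using resolvent_integral_entry[OF assms, of i j] by (cases "i = j") (simp_all add: mat_def)
qed

text \<open>The frequency integral of the real part of \<open>G S G\<^sup>*\<close> is \<open>2 \<pi> X\<close>, tested against a linear functional.\<close>

lemma linear_functional_gramian_integral:
  fixes f :: "real^'n^'n \<Rightarrow> real"
  assumes "hurwitz A" and "linear f"
    and lyap: "A ** X + X ** transpose A + S = 0"
  shows "((\<lambda>R. integral {-R..R} (\<lambda>w. f (resolvent_re A w ** S ** transpose (resolvent_re A w)
            + resolvent_im A w ** S ** transpose (resolvent_im A w)))) \<longlongrightarrow> 2 * pi * f X) at_top"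
proof -
  define L where "L M = f (M ** X + X ** transpose M)" for M
  have "linear L"
  proof (rule linearI)
    fix M N :: "real^'n^'n" and r :: real
    have "(M + N) ** X + X ** transpose (M + N) = (M ** X + X ** transpose M) + (N ** X + X ** transpose N)"
      by (simp add: matrix_mul_add transpose_add)
    then show "L (M + N) = L M + L N" unfolding L_def by (simp only: linear_add[OF \<open>linear f\<close>])
    have "(r *\<^sub>R M) ** X + X ** transpose (r *\<^sub>R M) = r *\<^sub>R (M ** X + X ** transpose M)"
      by (simp add: transpose_scalar scaleR_right_distrib)
    then show "L (r *\<^sub>R M) = r *\<^sub>R L M" unfolding L_def by (simp only: linear_scale[OF \<open>linear f\<close>])
  qed
  then have bl: "bounded_linear L" by (simp add: linear_conv_bounded_linear)
  have int: "resolvent_re A integrable_on {-R..R}" for R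
    by (rule integrable_continuous_real[OF continuous_on_resolvent_re[OF assms(1)]])
  have "integral {-R..R} (\<lambda>w. L (resolvent_re A w)) = L (integral {-R..R} (resolvent_re A))" for R
    using integral_linear[OF int bl] by (simp add: o_def)
  moreover have "((\<lambda>R. L (integral {-R..R} (resolvent_re A))) \<longlongrightarrow> L (pi *\<^sub>R mat 1)) at_top"
    by (rule bounded_linear.tendsto[OF bl resolvent_re_integral[OF assms(1)]])
  moreover have "L (pi *\<^sub>R mat 1) = 2 * pi * f X"
  proof -
    have "pi *\<^sub>R mat 1 ** X + X ** transpose (pi *\<^sub>R mat 1) = (2 * pi) *\<^sub>R X"
      by (simp add: transpose_scalar scaleR_left_distrib[symmetric])
    then show ?thesis by (simp add: L_def linear_scale[OF \<open>linear f\<close>])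
  qed
  ultimately show ?thesis
    by (simp add: resolvent_gramian[OF assms(1) lyap] L_def)
qed

lemma linear_lyapunov: "linear (\<lambda>X :: real^'n^'n. A ** X + X ** transpose A)"
  by (intro linearI) (simp_all add: matrix_mul_add scaleR_right_distrib)

lemma lyapunov_unique:
  fixes A :: "real^'n^'n"
  assumes "hurwitz A" "A ** X + X ** transpose A + S = 0" "A ** Y + Y ** transpose A + S = 0"
  shows "X = Y"
proof -
  have lyap: "A ** (X - Y) + (X - Y) ** transpose A + 0 = 0"
  proof -
    have "A ** (X - Y) + (X - Y) ** transpose A + 0
        = (A ** X + X ** transpose A + S) - (A ** Y + Y ** transpose A + S)"
      by (simp add: matrix_mul_diff)
    then show ?thesis by (simp only: assms(2,3) diff_self)
  qed
  have "(X - Y) $ i $ j = 0" for i j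
  proof -
    have "linear (\<lambda>M::real^'n^'n. M $ i $ j)" by (intro linearI) simp_all
    from linear_functional_gramian_integral[OF assms(1) this lyap]
    have "((\<lambda>R::real. 0) \<longlongrightarrow> 2 * pi * (X - Y) $ i $ j) at_top" by simp
    then have "2 * pi * (X - Y) $ i $ j = 0"
      using tendsto_unique[OF trivial_limit_at_top_linorder] tendsto_const by metis
    then show ?thesis by simp
  qed
  then show ?thesis by (simp add: vec_eq_iff)
qed

text \<open>The Lyapunov operator is injective by the preceding lemma, and therefore surjective on the finite-dimensional space of matrices.\<close>

lemma lyapunov_exists:
  fixes A :: "real^'n^'n"
  assumes "hurwitz A"
  obtains X where "A ** X + X ** transpose A + S = 0"
proof -
  have "inj (\<lambda>X :: real^'n^'n. A ** X + X ** transpose A)"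
  proof (subst linear_injective_0[OF linear_lyapunov], intro allI impI)
    fix X assume "A ** X + X ** transpose A = 0"
    then show "X = 0" using lyapunov_unique[OF assms, of X 0 0] by simp
  qed
  then have "surj (\<lambda>X :: real^'n^'n. A ** X + X ** transpose A)"
    by (rule linear_inj_imp_surj[OF linear_lyapunov])
  then obtain X where "- S = A ** X + X ** transpose A" by (rule surjE)
  then have "A ** X + X ** transpose A + S = 0" by (metis add.left_inverse)
  then show ?thesis by (rule that)
qed

text \<open>Integrability is not needed, since the integral of a non-integrable function is 0.\<close>

lemma integral_nonneg_always:
  fixes f :: "'n::euclidean_space \<Rightarrow> real"
  assumes "\<And>x. 0 \<le> f x"
  shows "0 \<le> integral S f"
  by (cases "f integrable_on S") (simp_all add: assms Henstock_Kurzweil_Integration.integral_nonneg not_integrable_integral)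

lemma lyapunov_psd:
  fixes A :: "real^'n^'n"
  assumes "hurwitz A" and lyap: "A ** X + X ** transpose A + S = 0" and S: "psd S"
  shows "psd X"
proof -
  have symS: "transpose S = S" using S unfolding psd_def symmat_def by simp
  have "transpose (A ** X + X ** transpose A + S) = 0" by (simp add: lyap)
  then have "A ** transpose X + transpose X ** transpose A + S = 0"
    by (simp add: transpose_add matrix_transpose_mul symS add.commute)
  then have sym: "transpose X = X" using lyapunov_unique[OF assms(1)] lyap by blast
  have "0 \<le> x \<bullet> (X *v x)" for x
  proof -
    have lin: "linear (\<lambda>M::real^'n^'n. x \<bullet> (M *v x))"
      by (intro linearI) (simp_all add: matrix_vector_mult_add_rdistrib inner_add_right scaleR_matrix_vector_assoc[symmetric])
    have quad: "0 \<le> x \<bullet> ((M ** S ** transpose M) *v x)" for M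
      using psd_congruence[OF S, of "transpose M"] by (simp add: psd_def)
    have "0 \<le> 2 * pi * (x \<bullet> (X *v x))"
    proof (rule tendsto_lowerbound[OF linear_functional_gramian_integral[OF assms(1) lin lyap]])
      show "\<forall>\<^sub>F R in at_top. 0 \<le> integral {- R..R} (\<lambda>w. x \<bullet> ((resolvent_re A w ** S ** transpose (resolvent_re A w)
          + resolvent_im A w ** S ** transpose (resolvent_im A w)) *v x))"
        using quad by (intro always_eventually allI integral_nonneg_always)
          (simp add: matrix_vector_mult_add_rdistrib inner_add_right)
    qed simp
    then show ?thesis using pi_gt_zero by (simp add: zero_le_mult_iff)
  qed
  then show ?thesis using sym by (simp add: psd_def symmat_def)
qed


lemma lyapunov_posdef:
  assumes "hurwitz A" and lyap: "A ** X + X ** transpose A + S = 0" and S: "posdef S"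
  shows "posdef X"
proof -
  have X: "psd X" using lyapunov_psd[OF assms(1) lyap posdef_imp_psd[OF S]] .
  then have sym: "X \<in> symmat" by (simp add: psd_def)
  have "x = 0" if x: "X *v x = 0" for x
  proof -
    have "x \<bullet> ((A ** X + X ** transpose A + S) *v x) = x \<bullet> (S *v x)"
      using x symmat_inner[OF sym, of x "transpose A *v x"]
      by (simp add: matrix_vector_mult_add_rdistrib inner_add_right matrix_vector_mul_assoc[symmetric])
    then have "x \<bullet> (S *v x) = 0" by (simp add: lyap)
    then show ?thesis using S unfolding posdef_def by (metis less_irrefl)
  qed
  then show ?thesis using X by (simp add: posdef_iff_psd_invertible invertible_iff_ker)
qed

section \<open>The H2 norm\<close>

lemma trace_scaleR: "trace (r *\<^sub>R M) = r * trace (M :: real^'n^'n)"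
  by (simp add: trace_def sum_distrib_left)

lemma linear_trace: "linear (trace :: real^'n^'n \<Rightarrow> real)"
  by (intro linearI) (simp_all add: trace_add trace_scaleR)

lemma linear_trace_congruence: "linear (\<lambda>M. trace (C ** M ** transpose (C :: real^'n^'m)))"
  by (intro linearI) (simp_all add: matrix_mul_add trace_add trace_scaleR)

lemma psd_trace_nonneg:
  assumes "psd (M :: real^'n^'n)" shows "0 \<le> trace M"
proof -
  have "M $ i $ i = axis i 1 \<bullet> (M *v axis i 1)" for i
    by (simp add: inner_axis' matrix_vector_mult_basis column_def)
  then show ?thesis using assms unfolding trace_def psd_def by (simp add: sum_nonneg)
qed

lemma psd_congruence_transpose: "psd M \<Longrightarrow> psd (C ** M ** transpose C)"
  using psd_congruence[of M "transpose C"] by simp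

lemma psd_mat1: "psd (mat 1)"
  by (simp add: psd_def)

lemma psd_gram: "psd (M ** transpose M)"
  using psd_congruence_transpose[OF psd_mat1, of M] by simp

lemma trace_hermitian_square:
  "Re (trace (hermitian_transpose T ** T)) =
     trace (map_matrix Re T ** transpose (map_matrix Re T))
   + trace (map_matrix Im T ** transpose (map_matrix Im T))" for T :: "complex^'n^'m"
proof -
  have "Re (trace (hermitian_transpose T ** T)) = (\<Sum>i\<in>UNIV. \<Sum>k\<in>UNIV. (Re (T $ k $ i))\<^sup>2 + (Im (T $ k $ i))\<^sup>2)"
    by (simp add: trace_def matrix_matrix_mult_def hermitian_transpose_def transpose_def power2_eq_square)
  also have "\<dots> = (\<Sum>k\<in>UNIV. \<Sum>i\<in>UNIV. (Re (T $ k $ i))\<^sup>2 + (Im (T $ k $ i))\<^sup>2)"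
    by (rule sum.swap)
  finally show ?thesis
    by (simp add: trace_def matrix_matrix_mult_def transpose_def power2_eq_square sum.distrib)
qed

lemma map_matrix_Re_cmat: "map_matrix Re (cmat C ** G ** cmat B) = C ** map_matrix Re G ** B"
  by (simp add: vec_eq_iff matrix_matrix_mult_def)

lemma map_matrix_Im_cmat: "map_matrix Im (cmat C ** G ** cmat B) = C ** map_matrix Im G ** B"
  by (simp add: vec_eq_iff matrix_matrix_mult_def)

lemma continuous_on_matrix_mult:
  fixes f :: "'a::topological_space \<Rightarrow> real^'n^'m" and g :: "'a \<Rightarrow> real^'k^'n"
  assumes "continuous_on S f" "continuous_on S g"
  shows "continuous_on S (\<lambda>x. f x ** g x)"
  using assms by (intro continuous_on_matrix) (simp add: matrix_matrix_mult_def, intro continuous_intros)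

lemma continuous_on_transpose:
  fixes f :: "'a::topological_space \<Rightarrow> real^'n^'m"
  assumes "continuous_on S f"
  shows "continuous_on S (\<lambda>x. transpose (f x))"
  using assms by (intro continuous_on_matrix) (simp add: transpose_def, intro continuous_intros)

text \<open>A nonnegative continuous function whose integrals over \<open>[-R, R]\<close> converge is Lebesgue integrable, by monotone
  convergence.\<close>

lemma lborel_integral_symmetric_limit:
  fixes u :: "real \<Rightarrow> real"
  assumes cont: "continuous_on UNIV u" and nonneg: "\<And>w. 0 \<le> u w"
    and lim: "((\<lambda>R. integral {-R..R} u) \<longlongrightarrow> L) at_top"
  shows "(LINT w|lborel. u w) = L"
proof -
  define f where "f n w = indicator {- real n..real n} w * u w" for n w
  have int: "set_integrable lborel {- real n..real n} u" for n
    by (rule borel_integrable_atLeastAtMost') (use cont continuous_on_subset in blast)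
  have i: "integrable lborel (f n)" for n
    using int[of n] by (simp add: set_integrable_def f_def[abs_def])
  have eq: "integral\<^sup>L lborel (f n) = integral {- real n..real n} u" for n
    using set_borel_integral_eq_integral(2)[OF int[of n]]
    by (simp add: set_lebesgue_integral_def f_def[abs_def])
  show ?thesis
  proof (rule integral_monotone_convergence_nonneg(2)[where f = f, OF i])
    show "AE w in lborel. mono (\<lambda>n. f n w)"
      by (intro AE_I2 monoI) (auto simp: f_def indicator_def nonneg)
    show "AE w in lborel. 0 \<le> f n w" for n by (simp add: f_def nonneg)
    show "AE w in lborel. (\<lambda>n. f n w) \<longlonglongrightarrow> u w"
    proof (intro AE_I2)
      fix w
      obtain N :: nat where N: "\<bar>w\<bar> \<le> real N" using real_arch_simple by blast
      have "\<forall>\<^sub>F n in sequentially. f n w = u w"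
        using eventually_ge_at_top[of N] by eventually_elim (use N in \<open>auto simp: f_def indicator_def\<close>)
      then show "(\<lambda>n. f n w) \<longlonglongrightarrow> u w" by (rule tendsto_eventually)
    qed
    show "(\<lambda>n. integral\<^sup>L lborel (f n)) \<longlonglongrightarrow> L"
      unfolding eq using filterlim_compose[OF lim filterlim_real_sequentially] .
    show "u \<in> borel_measurable lborel"
      using borel_measurable_continuous_onI[OF cont] by simp
  qed
qed

lemma H2_norm_gramian:
  fixes A :: "real^'n^'n" and B :: "real^'d^'n" and C :: "real^'n^'z"
  assumes "hurwitz A" and lyap: "A ** X + X ** transpose A + B ** transpose B = 0"
  shows "H2_norm (\<lambda>s. cmat C ** resolvent A s ** cmat B) = sqrt (trace (C ** X ** transpose C))"
proof -
  define S where "S = B ** transpose B"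
  define u where "u w = trace (C ** (resolvent_re A w ** S ** transpose (resolvent_re A w)
            + resolvent_im A w ** S ** transpose (resolvent_im A w)) ** transpose C)" for w
  have u: "Re (trace (hermitian_transpose (cmat C ** resolvent A (\<i> * complex_of_real w) ** cmat B) **
       (cmat C ** resolvent A (\<i> * complex_of_real w) ** cmat B))) = u w" for w
  proof -
    have "\<i> * complex_of_real w = Complex 0 w" by (simp add: complex_eq_iff)
    then show ?thesis
      unfolding trace_hermitian_square map_matrix_Re_cmat map_matrix_Im_cmat
      by (simp add: u_def S_def resolvent_re_def resolvent_im_def matrix_mul_add trace_add matrix_transpose_mul matrix_mul_assoc)
  qed
  have "psd S" unfolding S_def by (rule psd_gram)
  then have nonneg: "0 \<le> u w" for w
    unfolding u_def by (intro psd_trace_nonneg psd_congruence_transpose psd_add)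
  have cont: "continuous_on UNIV u"
    unfolding u_def
    by (intro continuous_on_compose2[OF linear_continuous_on[OF linear_conv_bounded_linear[THEN iffD1, OF linear_trace]] _ subset_UNIV]
        continuous_on_matrix_mult continuous_on_add continuous_on_transpose continuous_on_const
        continuous_on_resolvent_re continuous_on_resolvent_im assms(1))
  have "(LINT w|lborel. u w) = 2 * pi * trace (C ** X ** transpose C)"
    by (rule lborel_integral_symmetric_limit[OF cont nonneg])
      (use linear_functional_gramian_integral[OF assms(1) linear_trace_congruence lyap, of C]
        in \<open>simp add: u_def[abs_def] S_def\<close>)
  then show ?thesis unfolding H2_norm_def u by simp
qed

section \<open>Linear matrix inequalities and the H2 norm\<close>

lemma posdef_lyapunov_hurwitz:
  fixes A :: "real^'n^'n"
  assumes P: "posdef P" and LMI: "posdef (- (transpose A ** P + P ** A))"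
  shows "hurwitz A"
  unfolding hurwitz_def
proof (intro allI impI)
  fix l v assume v: "v \<noteq> 0 \<and> cmat A *v v = l *s v"
  define a where "a = (\<chi> i. Re (v $ i))"
  define b where "b = (\<chi> i. Im (v $ i))"
  have Aa: "A *v a = Re l *\<^sub>R a - Im l *\<^sub>R b"
  proof -
    have "(A *v a) $ i = Re ((cmat A *v v) $ i)" for i by (simp add: matrix_vector_mult_def a_def)
    then show ?thesis using v by (simp add: vec_eq_iff a_def b_def)
  qed
  have Ab: "A *v b = Im l *\<^sub>R a + Re l *\<^sub>R b"
  proof -
    have "(A *v b) $ i = Im ((cmat A *v v) $ i)" for i by (simp add: matrix_vector_mult_def b_def)
    then show ?thesis using v by (simp add: vec_eq_iff a_def b_def)
  qed
  have ab: "a \<noteq> 0 \<or> b \<noteq> 0" using v by (auto simp: vec_eq_iff a_def b_def complex_eq_iff)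
  have sym: "P \<in> symmat" using P by (simp add: posdef_def)
  have quad: "x \<bullet> ((- (transpose A ** P + P ** A)) *v x) = - 2 * (x \<bullet> (P *v (A *v x)))" for x
    using symmat_inner[OF sym, of x "A *v x"]
    by (simp add: matrix_vector_mult_add_rdistrib matrix_vector_mult_diff_rdistrib inner_add_right
        inner_diff_right matrix_vector_mul_assoc[symmetric] inner_transpose inner_commute)
  have pos: "0 \<le> x \<bullet> (M *v x)" "x \<noteq> 0 \<Longrightarrow> 0 < x \<bullet> (M *v x)" if "posdef M" for M :: "real^'n^'n" and x
    using that posdef_imp_psd unfolding posdef_def psd_def by blast+
  have "a \<bullet> (P *v (A *v a)) + b \<bullet> (P *v (A *v b)) = Re l * (a \<bullet> (P *v a) + b \<bullet> (P *v b))"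
    using symmat_inner[OF sym, of a b]
    by (simp add: Aa Ab algebra_simps inner_add_right inner_diff_right inner_commute)
  moreover have "a \<bullet> (P *v (A *v a)) + b \<bullet> (P *v (A *v b)) < 0"
    using pos[OF LMI, of a] pos[OF LMI, of b] ab unfolding quad by fastforce
  moreover have "a \<bullet> (P *v a) + b \<bullet> (P *v b) > 0"
    using pos[OF P, of a] pos[OF P, of b] ab by (metis add_nonneg_pos add_pos_nonneg)
  ultimately show "Re l < 0" by (simp add: mult_less_0_iff)
qed

text \<open>The negative of the first matrix of the lifted set, so that the inequality reads \<open>psd (lyapunov_lmi A B \<gamma> P)\<close>.\<close>

definition lyapunov_lmi :: "real^'n^'n \<Rightarrow> real^'d^'n \<Rightarrow> real \<Rightarrow> real^'n^'n \<Rightarrow> real^('n+'d)^('n+'d)" where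
  "lyapunov_lmi A B \<gamma> P = - blk (transpose A ** P + P ** A) (P ** B) (transpose B ** P) (- mat \<gamma>)"

lemma lyapunov_lmi_blk:
  assumes "P \<in> symmat"
  shows "lyapunov_lmi A B \<gamma> P = blk (- (transpose A ** P + P ** A)) (- (P ** B)) (transpose (- (P ** B))) (mat \<gamma>)"
  using symmat_D[OF assms] by (simp add: lyapunov_lmi_def blk_uminus matrix_transpose_mul transpose_uminus)

lemma lyapunov_lmi_quad:
  assumes "P \<in> symmat"
  shows "vcat x w \<bullet> (lyapunov_lmi A B \<gamma> P *v vcat x w)
     = - 2 * ((P *v x) \<bullet> (A *v x)) - 2 * ((P *v x) \<bullet> (B *v w)) + \<gamma> * (w \<bullet> w)"
  unfolding lyapunov_lmi_blk[OF assms] blk_inner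
  using symmat_inner[OF assms, of x "A *v x"] symmat_inner[OF assms, of x "B *v w"]
  by (simp add: matrix_vector_mult_add_rdistrib matrix_vector_mult_diff_rdistrib inner_add_right
        inner_diff_right matrix_vector_mul_assoc[symmetric] inner_transpose inner_commute)

lemma lyapunov_lmi_symmat:
  assumes "P \<in> symmat" shows "lyapunov_lmi A B \<gamma> P \<in> symmat"
  unfolding lyapunov_lmi_blk[OF assms] blk_symmat_iff
  using symmat_D[OF assms] by (simp add: symmat_def transpose_uminus transpose_diff matrix_transpose_mul)

lemma posdef_lyapunov_lmi_hurwitz:
  assumes P: "posdef P" and LMI: "posdef (lyapunov_lmi A B \<gamma> P)"
  shows "hurwitz A"
proof (rule posdef_lyapunov_hurwitz[OF P])
  have sym: "P \<in> symmat" using P by (simp add: posdef_def)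
  have "0 < x \<bullet> (- (transpose A ** P + P ** A) *v x)" if "x \<noteq> 0" for x
    using LMI that unfolding lyapunov_lmi_blk[OF sym] posdef_blk_iff
    by (metis inner_zero_left matrix_vector_mult_0_right inner_zero_right mult_zero_right add_0_right)
  then show "posdef (- (transpose A ** P + P ** A))"
    using LMI unfolding lyapunov_lmi_blk[OF sym] posdef_blk_iff by (auto simp: posdef_def)
qed

lemma posdef_inverse:
  assumes "posdef P"
  shows "P ** matrix_inv P = mat 1" "matrix_inv P ** P = mat 1" "posdef (matrix_inv P)"
proof -
  have inv: "invertible P" and P: "P \<in> symmat" using assms posdef_iff_psd_invertible by (auto simp: posdef_def)
  show 1: "P ** matrix_inv P = mat 1" "matrix_inv P ** P = mat 1" using matrix_inv_inverse[OF inv] .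
  have "transpose (matrix_inv P) = matrix_inv P" using transpose_matrix_inv[OF inv] symmat_D[OF P] by simp
  then have "transpose (matrix_inv P) ** P ** matrix_inv P = matrix_inv P" by (simp add: 1)
  moreover have "posdef (transpose (matrix_inv P) ** P ** matrix_inv P)"
    using posdef_congruence_iff[OF invertible_matrix_inv[OF inv]] assms by blast
  ultimately show "posdef (matrix_inv P)" by simp
qed

text \<open>With \<open>X = P\<inverse>\<close> the first inequality says \<open>A X + X A\<^sup>T + B B\<^sup>T/\<gamma> \<le> 0\<close>, whence \<open>X\<^sub>c \<le> \<gamma> X\<close>, and the second one says
  \<open>C X C\<^sup>T \<le> G\<close>.  Taking traces bounds the squared H2 norm by \<open>\<gamma> tr G\<close>.\<close>

lemma lmi_gramian_bound:
  fixes A :: "real^'n^'n" and B :: "real^'d^'n" and C :: "real^'n^'z"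
  assumes "hurwitz A" and P: "posdef P" and \<gamma>: "\<gamma> > 0"
    and L1: "psd (lyapunov_lmi A B \<gamma> P)" and L2: "psd (blk P (transpose C) C G)"
    and lyap: "A ** Xc + Xc ** transpose A + B ** transpose B = 0"
  shows "trace (C ** Xc ** transpose C) \<le> \<gamma> * trace G"
proof -
  define X where "X = matrix_inv P"
  have PX: "P ** X = mat 1" and XP: "X ** P = mat 1" and X: "posdef X"
    using posdef_inverse[OF P] by (simp_all add: X_def)
  have sym: "P \<in> symmat" "X \<in> symmat" using P X by (simp_all add: posdef_def)
  have PXv: "P *v (X *v y) = y" for y by (simp add: matrix_vector_mul_assoc PX)
  define S where "S = - (A ** X + X ** transpose A) - (1 / \<gamma>) *\<^sub>R (B ** transpose B)"
  have "psd S"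
    unfolding psd_def
  proof
    show "S \<in> symmat" using symmat_D[OF sym(2)]
      by (simp add: symmat_def S_def transpose_diff transpose_uminus transpose_add transpose_scalar matrix_transpose_mul add.commute)
    show "\<forall>y. 0 \<le> y \<bullet> (S *v y)"
    proof
      fix y
      define w where "w = (1 / \<gamma>) *\<^sub>R (transpose B *v y)"
      have Bw: "y \<bullet> (B *v w) = \<gamma> * (w \<bullet> w)"
        using \<gamma> inner_transpose[of w B y] by (simp add: w_def inner_commute matrix_vector_mult_scaleR inner_transpose)
      have "y \<bullet> (S *v y) = - 2 * (y \<bullet> (A *v (X *v y))) - \<gamma> * (w \<bullet> w)"
      proof -
        have "(1 / \<gamma>) * (y \<bullet> (B *v (transpose B *v y))) = \<gamma> * (w \<bullet> w)"
          using Bw by (simp add: w_def matrix_vector_mult_scaleR)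
        moreover have "y \<bullet> (X *v (transpose A *v y)) = y \<bullet> (A *v (X *v y))"
          using symmat_inner[OF sym(2), of y "transpose A *v y"] inner_transpose[of "X *v y" A y]
          by (simp add: inner_commute)
        ultimately show ?thesis
          by (simp add: S_def matrix_vector_mult_diff_rdistrib matrix_vector_mult_add_rdistrib inner_add_right
            inner_diff_right scaleR_matrix_vector_assoc[symmetric] matrix_vector_mul_assoc[symmetric])
      qed
      also have "\<dots> = vcat (X *v y) w \<bullet> (lyapunov_lmi A B \<gamma> P *v vcat (X *v y) w)"
        unfolding lyapunov_lmi_quad[OF sym(1)] PXv Bw by simp
      also have "\<dots> \<ge> 0" using L1 by (simp add: psd_def)
      finally show "0 \<le> y \<bullet> (S *v y)" .
    qed
  qed
  then have "psd (\<gamma> *\<^sub>R S)" using \<gamma> by (intro psd_scaleR) auto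
  moreover have "A ** (\<gamma> *\<^sub>R X - Xc) + (\<gamma> *\<^sub>R X - Xc) ** transpose A + \<gamma> *\<^sub>R S = 0"
  proof -
    have BB: "B ** transpose B = - (A ** Xc + Xc ** transpose A)" using lyap by (simp add: add_eq_0_iff2)
    show ?thesis using \<gamma> by (simp add: S_def BB matrix_mul_diff algebra_simps)
  qed
  ultimately have "psd (\<gamma> *\<^sub>R X - Xc)" using lyapunov_psd[OF assms(1)] by blast
  then have "0 \<le> trace (C ** (\<gamma> *\<^sub>R X - Xc) ** transpose C)" by (intro psd_trace_nonneg psd_congruence_transpose)
  then have "trace (C ** Xc ** transpose C) \<le> \<gamma> * trace (C ** X ** transpose C)"
    by (simp add: matrix_mul_diff trace_sub trace_scaleR)
  also have "trace (C ** X ** transpose C) \<le> trace G"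
  proof -
    have L2': "psd (blk P (transpose C) (transpose (transpose C)) G)" using L2 by simp
    have "0 \<le> y \<bullet> ((G - C ** X ** transpose C) *v y)" for y
    proof -
      define x where "x = - (X *v (transpose C *v y))"
      have "0 \<le> x \<bullet> (P *v x) + 2 * (x \<bullet> (transpose C *v y)) + y \<bullet> (G *v y)"
        using L2' unfolding psd_blk_iff by blast
      also have "x \<bullet> (P *v x) = - (x \<bullet> (transpose C *v y))" by (simp add: x_def PXv)
      also have "- (x \<bullet> (transpose C *v y)) + 2 * (x \<bullet> (transpose C *v y)) + y \<bullet> (G *v y)
           = y \<bullet> ((G - C ** X ** transpose C) *v y)"
        using inner_transpose[of "X *v (transpose C *v y)" C y]
        by (simp add: x_def matrix_vector_mult_diff_rdistrib inner_diff_right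
            matrix_vector_mul_assoc[symmetric] inner_commute)
      finally show ?thesis .
    qed
    moreover have "G - C ** X ** transpose C \<in> symmat"
      using L2' symmat_D[OF sym(2)] unfolding psd_blk_iff
      by (simp add: symmat_def transpose_diff matrix_transpose_mul matrix_mul_assoc)
    ultimately have "psd (G - C ** X ** transpose C)" by (simp add: psd_def)
    from psd_trace_nonneg[OF this] show ?thesis by (simp add: trace_sub)
  qed
  finally show ?thesis using \<gamma> by (simp add: mult_left_mono)
qed

text \<open>The matrix \<open>P\<close> is the inverse of the perturbed Gramian \<open>X\<^sub>c/\<gamma> + e X\<^sub>i\<close>, where \<open>X\<^sub>i\<close> solves the Lyapunov equation with
  right-hand side \<open>-I\<close>.\<close>

lemma lmi_strictly_feasible:
  fixes A :: "real^'n^'n" and B :: "real^'d^'n" and C :: "real^'n^'z"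
  assumes "hurwitz A" and \<gamma>: "\<gamma> > 0"
    and lyap: "A ** Xc + Xc ** transpose A + B ** transpose B = 0"
    and less: "trace (C ** Xc ** transpose C) < \<gamma>\<^sup>2"
  obtains P G where "posdef P" "posdef (lyapunov_lmi A B \<gamma> P)" "posdef (blk P (transpose C) C G)" "trace G \<le> \<gamma>"
proof -
  obtain Xi where Xi: "A ** Xi + Xi ** transpose A + mat 1 = 0" using lyapunov_exists[OF assms(1)] .
  have m1: "posdef (mat 1 :: real^'n^'n)" by (simp add: posdef_def)
  define t where "t = trace (C ** Xi ** transpose C)"
  have t: "t \<ge> 0" unfolding t_def
    by (intro psd_trace_nonneg psd_congruence_transpose lyapunov_psd[OF assms(1) Xi] psd_mat1)
  define gap where "gap = \<gamma> - trace (C ** Xc ** transpose C) / \<gamma>"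
  have gap: "gap > 0" using \<gamma> less by (simp add: gap_def field_simps power2_eq_square)
  \<comment> \<open>The perturbation raises the trace of \<open>G\<close> by \<open>e (t + CARD('z))\<close>; this choice uses up the gap exactly.\<close>
  define e where "e = gap / (t + real CARD('z))"
  have den: "t + real CARD('z) > 0" using t by (simp add: add_nonneg_pos)
  have e: "e > 0" using gap den by (simp add: e_def)
  define X where "X = (1 / \<gamma>) *\<^sub>R Xc + e *\<^sub>R Xi"
  have lyapX: "A ** X + X ** transpose A + ((1 / \<gamma>) *\<^sub>R (B ** transpose B) + e *\<^sub>R mat 1) = 0"
  proof -
    have "A ** X + X ** transpose A + ((1 / \<gamma>) *\<^sub>R (B ** transpose B) + e *\<^sub>R mat 1) =
       (1 / \<gamma>) *\<^sub>R (A ** Xc + Xc ** transpose A + B ** transpose B) + e *\<^sub>R (A ** Xi + Xi ** transpose A + mat 1)"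
      by (simp add: X_def matrix_mul_add scaleR_right_distrib)
    then show ?thesis by (simp add: lyap Xi)
  qed
  have X: "posdef X"
    by (rule lyapunov_posdef[OF assms(1) lyapX])
      (use e \<gamma> in \<open>simp add: add.commute[of "(1/\<gamma>) *\<^sub>R _"] posdef_add_psd posdef_scaleR m1 psd_scaleR psd_gram\<close>)
  define P where "P = matrix_inv X"
  have PX: "P ** X = mat 1" and XP: "X ** P = mat 1" and P: "posdef P"
    using posdef_inverse[OF X] by (simp_all add: P_def)
  have sym: "P \<in> symmat" "X \<in> symmat" using P X by (simp_all add: posdef_def)
  have XPv: "X *v (P *v y) = y" and PXv: "P *v (X *v y) = y" for y by (simp_all add: matrix_vector_mul_assoc PX XP)
  define G where "G = C ** X ** transpose C + e *\<^sub>R mat 1"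
  show ?thesis
  proof
    show "posdef P" by fact
    have "trace (mat 1 :: real^'z^'z) = real CARD('z)" by (rule trace_I)
    then have "trace G = trace (C ** Xc ** transpose C) / \<gamma> + e * (t + real CARD('z))"
      by (simp add: G_def X_def matrix_mul_add trace_add trace_scaleR t_def algebra_simps)
    also have "\<dots> = \<gamma>" using den by (simp add: e_def gap_def)
    finally show "trace G \<le> \<gamma>" by simp
    show "posdef (lyapunov_lmi A B \<gamma> P)"
      unfolding posdef_def
    proof (intro conjI allI impI lyapunov_lmi_symmat sym)
      fix v :: "real^('n+'d)" assume v: "v \<noteq> 0"
      obtain x w where vxw: "v = vcat x w" by (rule vcat_exhaust)
      define y where "y = P *v x"
      have x: "x = X *v y" by (simp add: y_def XPv)
      have A: "- 2 * (y \<bullet> (A *v x)) = (1 / \<gamma>) * ((transpose B *v y) \<bullet> (transpose B *v y)) + e * (y \<bullet> y)"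
      proof -
        have "y \<bullet> ((A ** X + X ** transpose A + ((1 / \<gamma>) *\<^sub>R (B ** transpose B) + e *\<^sub>R mat 1)) *v y) = 0"
          by (simp add: lyapX)
        moreover have "y \<bullet> (X *v (transpose A *v y)) = y \<bullet> (A *v (X *v y))"
          using symmat_inner[OF sym(2), of y "transpose A *v y"] inner_transpose[of "X *v y" A y]
          by (simp add: inner_commute)
        moreover have "y \<bullet> (B *v (transpose B *v y)) = (transpose B *v y) \<bullet> (transpose B *v y)"
          using inner_transpose[of "transpose B *v y" B y] by (simp add: inner_commute)
        ultimately show ?thesis
          by (simp add: x matrix_vector_mult_add_rdistrib inner_add_right
            scaleR_matrix_vector_assoc[symmetric] matrix_vector_mul_assoc[symmetric])
      qed
      have "v \<bullet> (lyapunov_lmi A B \<gamma> P *v v) = e * (y \<bullet> y) + \<gamma> * ((w - (1 / \<gamma>) *\<^sub>R (transpose B *v y)) \<bullet> (w - (1 / \<gamma>) *\<^sub>R (transpose B *v y)))"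
        unfolding vxw lyapunov_lmi_quad[OF sym(1)] y_def[symmetric] A
        using inner_transpose[of w B y] \<gamma>
        by (simp add: inner_diff_left inner_diff_right inner_commute field_simps)
      moreover have "0 < \<dots>"
      proof (cases "y = 0")
        case True
        then have "w \<noteq> 0" using v vxw x by auto
        then show ?thesis using \<gamma> True by simp
      next
        case False
        then show ?thesis using \<gamma> e by (intro add_pos_nonneg) auto
      qed
      ultimately show "0 < v \<bullet> (lyapunov_lmi A B \<gamma> P *v v)" by simp
    qed
    have "posdef (blk P (transpose C) (transpose (transpose C)) G)"
      unfolding posdef_blk_iff
    proof (intro conjI allI impI)
      show "P \<in> symmat" by fact
      show "G \<in> symmat" using symmat_D[OF sym(2)]
        by (simp add: G_def symmat_def transpose_add matrix_transpose_mul matrix_mul_assoc transpose_scalar)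
      fix x :: "real^'n" and y :: "real^'z" assume xy: "x \<noteq> 0 \<or> y \<noteq> 0"
      define z where "z = X *v (transpose C *v y)"
      have Pz: "P *v z = transpose C *v y" by (simp add: z_def PXv)
      have "x \<bullet> (P *v x) + 2 * (x \<bullet> (transpose C *v y)) + y \<bullet> (G *v y)
         = (x + z) \<bullet> (P *v (x + z)) + e * (y \<bullet> y)"
      proof -
        have "y \<bullet> (G *v y) = z \<bullet> (P *v z) + e * (y \<bullet> y)"
          unfolding Pz using inner_transpose[of z C y]
          by (simp add: G_def z_def matrix_vector_mult_add_rdistrib inner_add_right
            scaleR_matrix_vector_assoc[symmetric] matrix_vector_mul_assoc[symmetric] inner_commute)
        then show ?thesis using symmat_inner[OF sym(1), of z x]
          by (simp add: matrix_vector_right_distrib inner_add_left inner_add_right Pz inner_commute)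
      qed
      moreover have "0 < \<dots>"
      proof (cases "y = 0")
        case True
        then have "x + z \<noteq> 0" using xy by (simp add: z_def)
        then show ?thesis using P True by (simp add: posdef_def)
      next
        case False
        then show ?thesis using e posdef_imp_psd[OF P] by (intro add_nonneg_pos) (auto simp: psd_def)
      qed
      ultimately show "0 < x \<bullet> (P *v x) + 2 * (x \<bullet> (transpose C *v y)) + y \<bullet> (G *v y)" by simp
    qed
    then show "posdef (blk P (transpose C) C G)" by simp
  qed
qed

text \<open>The determinant of \<open>N + t I\<close> is a nonzero polynomial in \<open>t\<close>.\<close>

lemma finite_singular_shifts:
  fixes N :: "real^'n^'n"
  shows "finite {t. \<not> invertible (N + t *\<^sub>R mat 1)}"
proof -
  define p where "p = det (\<chi> i j. if i = j then [:N $ i $ j, 1:] else [:N $ i $ j:])"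
  have p: "poly p t = det (N + t *\<^sub>R mat 1)" for t
  proof -
    have "poly (if i = j then [:N $ i $ j, 1:] else [:N $ i $ j:]) t = (N + t *\<^sub>R mat 1) $ i $ j" for i j
      by (simp add: mat_def)
    then show ?thesis
      unfolding p_def det_def
      by (simp add: poly_sum poly_prod del: vector_add_component vector_scaleR_component)
  qed
  obtain k where k: "k > 0" "\<And>x y. \<bar>x \<bullet> (N *v y)\<bar> \<le> k * (norm x * norm y)"
    using quadratic_form_bound by blast
  have "invertible (N + (k + 1) *\<^sub>R mat 1)"
    unfolding invertible_iff_ker
  proof (intro allI impI)
    fix x assume "(N + (k + 1) *\<^sub>R mat 1) *v x = 0"
    then have "x \<bullet> ((N + (k + 1) *\<^sub>R mat 1) *v x) = 0" by simp
    then have "x \<bullet> (N *v x) + (k + 1) * (x \<bullet> x) = 0"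
      by (simp add: matrix_vector_mult_add_rdistrib inner_add_right scaleR_matrix_vector_assoc[symmetric])
    moreover have "\<bar>x \<bullet> (N *v x)\<bar> \<le> k * (x \<bullet> x)" using k(2)[of x x]
      by (simp add: dot_square_norm power2_eq_square)
    ultimately have "x \<bullet> x \<le> 0" by (simp add: algebra_simps)
    then show "x = 0" by (metis inner_ge_zero inner_eq_zero_iff order_antisym)
  qed
  then have "p \<noteq> 0" using p[of "k + 1"] invertible_det_nz by force
  then have "finite {t. poly p t = 0}" by (rule poly_roots_finite)
  then show ?thesis by (simp add: p invertible_det_nz)
qed

lemma psd_blk_lower: "psd (blk a b c d) \<Longrightarrow> psd d"
proof -
  assume *: "psd (blk a b c d)"
  then have c: "c = transpose b" by (simp add: psd_def blk_symmat_iff)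
  have "0 \<le> y \<bullet> (d *v y)" for y
    using * unfolding c psd_blk_iff
    by (metis inner_zero_left matrix_vector_mult_0_right inner_zero_right mult_zero_right add_0)
  then show "psd d" using * by (simp add: psd_def blk_symmat_iff)
qed

text \<open>Strict inequalities survive the perturbation of \<open>P\<close> in the direction \<open>[0, I; I, 0]\<close>, which shifts the off-diagonal block
  by \<open>t I\<close>.\<close>

lemma lmi_strictly_feasible_offdiag_invertible:
  fixes A :: "real^('n::finite+'n)^('n+'n)" and B :: "real^'d^('n+'n)" and C :: "real^('n+'n)^'z"
  assumes "hurwitz A" and \<gamma>: "\<gamma> > 0"
    and lyap: "A ** Xc + Xc ** transpose A + B ** transpose B = 0"
    and less: "trace (C ** Xc ** transpose C) < \<gamma>\<^sup>2"
  obtains P G where "posdef P" "posdef (lyapunov_lmi A B \<gamma> P)" "posdef (blk P (transpose C) C G)" "trace G \<le> \<gamma>"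
    "invertible (blk12 P)"
proof -
  obtain P G where P: "posdef P" and L1: "posdef (lyapunov_lmi A B \<gamma> P)" and L2: "posdef (blk P (transpose C) C G)"
    and tr: "trace G \<le> \<gamma>"
    using lmi_strictly_feasible[OF assms] by blast
  define E :: "real^('n+'n)^('n+'n)" where "E = blk 0 (mat 1) (mat 1) 0"
  have E: "E \<in> symmat" by (simp add: E_def blk_symmat_iff) (simp add: symmat_def)
  obtain d1 where d1: "d1 > 0" "\<And>t. \<bar>t\<bar> < d1 \<Longrightarrow> posdef (P + t *\<^sub>R E)"
    using posdef_perturb[OF P E] by blast
  obtain d2 where d2: "d2 > 0" "\<And>t. \<bar>t\<bar> < d2 \<Longrightarrow> posdef (lyapunov_lmi A B \<gamma> P + t *\<^sub>R lyapunov_lmi A B 0 E)"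
    using posdef_perturb[OF L1 lyapunov_lmi_symmat[OF E]] by blast
  have "blk E 0 0 0 \<in> symmat" using E by (simp add: blk_symmat_iff) (simp add: symmat_def)
  then obtain d3 where d3: "d3 > 0" "\<And>t. \<bar>t\<bar> < d3 \<Longrightarrow> posdef (blk P (transpose C) C G + t *\<^sub>R blk E 0 0 0)"
    using posdef_perturb[OF L2] by metis
  define d where "d = min d1 (min d2 d3)"
  have "d > 0" using d1 d2 d3 by (simp add: d_def)
  then have "infinite {0<..<d}" by (rule infinite_Ioo)
  then obtain t where t: "t \<in> {0<..<d}" "invertible (blk12 P + t *\<^sub>R mat 1)"
    using finite_singular_shifts[of "blk12 P"] by (metis (mono_tags, lifting) finite_subset mem_Collect_eq subsetI)
  have 1: "lyapunov_lmi A B \<gamma> P + t *\<^sub>R lyapunov_lmi A B 0 E = lyapunov_lmi A B \<gamma> (P + t *\<^sub>R E)"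
    by (simp add: lyapunov_lmi_def blk_uminus blk_add blk_scaleR matrix_mul_add scaleR_right_distrib scaleR_right_diff_distrib)
  have 2: "blk P (transpose C) C G + t *\<^sub>R blk E 0 0 0 = blk (P + t *\<^sub>R E) (transpose C) C G"
    by (simp add: blk_add blk_scaleR)
  have 3: "blk12 (P + t *\<^sub>R E) = blk12 P + t *\<^sub>R mat 1"
    by (simp add: E_def blk12_def vec_eq_iff)
  show ?thesis
    by (rule that[of "P + t *\<^sub>R E" G]) (use t d1(2)[of t] d2(2)[of t] d3(2)[of t] tr in \<open>simp_all add: d_def 1 2 3\<close>)
qed

lemma J_LQG_gramian:
  assumes "K \<in> C0 A B C"
    and "Acl A B C K ** X + X ** transpose (Acl A B C K) + Bcl B W V K ** transpose (Bcl B W V K) = 0"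
  shows "J_LQG A B C Q R W V K = sqrt (trace (Ccl C Q R K ** X ** transpose (Ccl C Q R K)))"
proof -
  have K: "blk11 K = 0" "hurwitz (Acl A B C K)" using assms(1) by (simp_all add: C0_def V0_def)
  have "Dcl R V K = 0" by (simp add: Dcl_def K vec_eq_iff forall_sum)
  then have "cmat (Dcl R V K) = 0" by (simp add: vec_eq_iff)
  then have "Tzd A B C Q R W V K = (\<lambda>s. cmat (Ccl C Q R K) ** resolvent (Acl A B C K) s ** cmat (Bcl B W V K))"
    by (simp add: Tzd_def[abs_def] resolvent_def)
  then show ?thesis by (simp add: J_LQG_def H2_norm_gramian[OF K(2) assms(2)])
qed

lemma epi_gt_subset:
  "epi_gt (C0 A B C) (J_LQG A B C Q R W V) \<subseteq> (\<lambda>(K, \<gamma>, P, \<Gamma>). (K, \<gamma>)) ` L_LQG A B C Q R W V"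
proof
  fix z assume "z \<in> epi_gt (C0 A B C) (J_LQG A B C Q R W V)"
  then obtain K \<gamma> where z: "z = (K, \<gamma>)" and K: "K \<in> C0 A B C" and less: "J_LQG A B C Q R W V K < \<gamma>"
    by (auto simp: epi_gt_def)
  have hur: "hurwitz (Acl A B C K)" and V0: "K \<in> V0" using K by (simp_all add: C0_def)
  obtain X where X: "Acl A B C K ** X + X ** transpose (Acl A B C K) + Bcl B W V K ** transpose (Bcl B W V K) = 0"
    using lyapunov_exists[OF hur] .
  define t where "t = trace (Ccl C Q R K ** X ** transpose (Ccl C Q R K))"
  have "t \<ge> 0" unfolding t_def
    by (intro psd_trace_nonneg psd_congruence_transpose lyapunov_psd[OF hur X] psd_gram)
  moreover have "sqrt t < \<gamma>" using less J_LQG_gramian[OF K X] by (simp add: t_def)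
  ultimately have \<gamma>: "\<gamma> > 0" and "t < \<gamma>\<^sup>2"
    by (meson less_le_trans not_le real_sqrt_ge_zero order_le_less_trans, metis real_sqrt_less_iff real_sqrt_unique
        order_le_less_trans real_sqrt_ge_zero less_imp_le)
  then obtain P G where "posdef P" "posdef (lyapunov_lmi (Acl A B C K) (Bcl B W V K) \<gamma> P)"
     "posdef (blk P (transpose (Ccl C Q R K)) (Ccl C Q R K) G)" "trace G \<le> \<gamma>" "invertible (blk12 P)"
    using lmi_strictly_feasible_offdiag_invertible[OF hur \<gamma> X, of "Ccl C Q R K"] unfolding t_def by blast
  moreover from this have "psd G" using psd_blk_lower posdef_imp_psd by blast
  ultimately have "(K, \<gamma>, P, G) \<in> L_LQG A B C Q R W V"
    using V0 by (auto simp: L_LQG_def GL_def lyapunov_lmi_def intro: posdef_imp_psd)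
  then show "z \<in> (\<lambda>(K, \<gamma>, P, \<Gamma>). (K, \<gamma>)) ` L_LQG A B C Q R W V"
    unfolding z by force
qed

section \<open>Smooth maps\<close>

text \<open>The class \<open>C\<^sup>k\<close> relative to \<open>E\<close> and \<open>U\<close> is closed under linear maps, bilinear products and reciprocals of nowhere
  vanishing functions.  None of these facts uses
  that \<open>U\<close> is open in \<open>E\<close>.\<close>

lemma Ck_on_SucD: "Ck_on (Suc k) E U f \<Longrightarrow> Ck_on k E U f"
proof (induction k arbitrary: f)
  case 0
  then show ?case by (auto intro: has_derivative_continuous_on)
next
  case (Suc k)
  then show ?case by (metis Ck_on.simps(2))
qed

lemma Ck_on_cong:
  assumes "Ck_on k E U f" "\<And>x. x \<in> U \<Longrightarrow> g x = f x"
  shows "Ck_on k E U g"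
proof (cases k)
  case 0
  then show ?thesis using assms by (simp cong: continuous_on_cong)
next
  case (Suc k')
  then obtain f' where "\<forall>x\<in>U. (f has_derivative f' x) (at x within U)" "\<forall>v\<in>E. Ck_on k' E U (\<lambda>x. f' x v)"
    using assms(1) by auto
  moreover from this have "\<forall>x\<in>U. (g has_derivative f' x) (at x within U)"
    using assms(2) by (auto intro: has_derivative_transform)
  ultimately show ?thesis using Suc by auto
qed

lemma Ck_on_const: "Ck_on k E U (\<lambda>x. c)"
proof (induction k arbitrary: c)
  case (Suc k)
  show ?case unfolding Ck_on.simps
    by (rule exI[of _ "\<lambda>x v. 0"]) (auto simp: Suc)
qed simp

lemma Ck_on_id: "Ck_on k E U (\<lambda>x. x)"
proof (cases k)
  case (Suc k')
  show ?thesis unfolding Suc Ck_on.simps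
    by (rule exI[of _ "\<lambda>x v. v"]) (auto simp: Ck_on_const)
qed (simp add: continuous_on_id)

lemma Ck_on_linear_compose:
  assumes L: "bounded_linear L" and "Ck_on k E U f"
  shows "Ck_on k E U (\<lambda>x. L (f x))"
  using assms(2)
proof (induction k arbitrary: f)
  case 0
  then show ?case using bounded_linear.continuous_on[OF L] by auto
next
  case (Suc k)
  then obtain f' where "\<forall>x\<in>U. (f has_derivative f' x) (at x within U)" "\<forall>v\<in>E. Ck_on k E U (\<lambda>x. f' x v)"
    by auto
  then show ?case unfolding Ck_on.simps
    by (intro exI[of _ "\<lambda>x v. L (f' x v)"]) (auto intro: bounded_linear.has_derivative[OF L] Suc.IH)
qed

lemma Ck_on_add:
  assumes "Ck_on k E U f" "Ck_on k E U g"
  shows "Ck_on k E U (\<lambda>x. f x + g x)"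
  using assms
proof (induction k arbitrary: f g)
  case 0
  then show ?case by (auto intro: continuous_intros)
next
  case (Suc k)
  then obtain f' g' where
    "\<forall>x\<in>U. (f has_derivative f' x) (at x within U)" "\<forall>v\<in>E. Ck_on k E U (\<lambda>x. f' x v)"
    "\<forall>x\<in>U. (g has_derivative g' x) (at x within U)" "\<forall>v\<in>E. Ck_on k E U (\<lambda>x. g' x v)"
    by auto
  then show ?case unfolding Ck_on.simps
    by (intro exI[of _ "\<lambda>x v. f' x v + g' x v"]) (auto intro: has_derivative_add Suc.IH)
qed

lemma Ck_on_sum:
  assumes "finite I" "\<And>i. i \<in> I \<Longrightarrow> Ck_on k E U (f i)"
  shows "Ck_on k E U (\<lambda>x. \<Sum>i\<in>I. f i x)"
  using assms by (induction I rule: finite_induct) (simp_all add: Ck_on_const Ck_on_add)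

lemma Ck_on_bilinear:
  assumes P: "bounded_bilinear h" and "Ck_on k E U f" "Ck_on k E U g"
  shows "Ck_on k E U (\<lambda>x. h (f x) (g x))"
  using assms(2,3)
proof (induction k arbitrary: f g)
  case 0
  then show ?case using bounded_bilinear.continuous_on[OF P] by auto
next
  case (Suc k)
  then obtain f' g' where
    "\<forall>x\<in>U. (f has_derivative f' x) (at x within U)" "\<forall>v\<in>E. Ck_on k E U (\<lambda>x. f' x v)"
    "\<forall>x\<in>U. (g has_derivative g' x) (at x within U)" "\<forall>v\<in>E. Ck_on k E U (\<lambda>x. g' x v)"
    by auto
  note d = this
  have fg: "Ck_on k E U f" "Ck_on k E U g" using Suc.prems Ck_on_SucD by blast+
  show ?case unfolding Ck_on.simps
  proof (intro exI[of _ "\<lambda>x v. h (f x) (g' x v) + h (f' x v) (g x)"] conjI ballI)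
    show "((\<lambda>x. h (f x) (g x)) has_derivative (\<lambda>v. h (f x) (g' x v) + h (f' x v) (g x))) (at x within U)"
      if "x \<in> U" for x using d that by (intro bounded_bilinear.FDERIV[OF P]) auto
    show "Ck_on k E U (\<lambda>x. h (f x) (g' x v) + h (f' x v) (g x))" if "v \<in> E" for v
      using d fg that by (intro Ck_on_add Suc.IH) auto
  qed
qed

lemma Ck_on_times:
  fixes f g :: "'a::euclidean_space \<Rightarrow> real"
  shows "Ck_on k E U f \<Longrightarrow> Ck_on k E U g \<Longrightarrow> Ck_on k E U (\<lambda>x. f x * g x)"
  by (rule Ck_on_bilinear[OF bounded_bilinear_mult])

lemma Ck_on_uminus: "Ck_on k E U f \<Longrightarrow> Ck_on k E U (\<lambda>x. - f x)"
  by (rule Ck_on_linear_compose[OF bounded_linear_minus[OF bounded_linear_ident]])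

lemma Ck_on_diff: "Ck_on k E U f \<Longrightarrow> Ck_on k E U g \<Longrightarrow> Ck_on k E U (\<lambda>x. f x - g x)"
  using Ck_on_add[OF _ Ck_on_uminus, of k E U f g] by simp

lemma Ck_on_inverse:
  fixes f :: "'a::euclidean_space \<Rightarrow> real"
  assumes "Ck_on k E U f" and nz: "\<And>x. x \<in> U \<Longrightarrow> f x \<noteq> 0"
  shows "Ck_on k E U (\<lambda>x. inverse (f x))"
  using assms(1)
proof (induction k)
  case 0
  then show ?case using nz by (auto intro: continuous_on_inverse)
next
  case (Suc k)
  then obtain f' where f': "\<forall>x\<in>U. (f has_derivative f' x) (at x within U)" "\<forall>v\<in>E. Ck_on k E U (\<lambda>x. f' x v)"
    by auto
  have inv: "Ck_on k E U (\<lambda>x. inverse (f x))" using Suc Ck_on_SucD by blast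
  show ?case unfolding Ck_on.simps
  proof (intro exI[of _ "\<lambda>x v. - (inverse (f x) * f' x v * inverse (f x))"] conjI ballI)
    show "((\<lambda>x. inverse (f x)) has_derivative (\<lambda>v. - (inverse (f x) * f' x v * inverse (f x)))) (at x within U)"
      if "x \<in> U" for x using f' nz[OF that] that by (intro Deriv.has_derivative_inverse) auto
    show "Ck_on k E U (\<lambda>x. - (inverse (f x) * f' x v * inverse (f x)))" if "v \<in> E" for v
      using f' inv that by (intro Ck_on_uminus Ck_on_times) auto
  qed
qed

lemma Ck_on_prod:
  fixes f :: "'i \<Rightarrow> 'a::euclidean_space \<Rightarrow> real"
  assumes "finite I" "\<And>i. i \<in> I \<Longrightarrow> Ck_on k E U (f i)"
  shows "Ck_on k E U (\<lambda>x. \<Prod>i\<in>I. f i x)"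
  using assms by (induction I rule: finite_induct) (simp_all add: Ck_on_const Ck_on_times)

lemma Ck_on_componentwise:
  assumes "\<And>b. b \<in> Basis \<Longrightarrow> Ck_on k E U (\<lambda>x. f x \<bullet> b)"
  shows "Ck_on k E U f"
proof -
  have "Ck_on k E U (\<lambda>x. \<Sum>b\<in>Basis. (f x \<bullet> b) *\<^sub>R b)"
    by (intro Ck_on_sum finite_Basis Ck_on_linear_compose[OF bounded_linear_scaleR_left] assms)
  then show ?thesis by (simp add: euclidean_representation)
qed

lemma Ck_on_Pair:
  assumes "Ck_on k E U f" "Ck_on k E U g"
  shows "Ck_on k E U (\<lambda>x. (f x, g x))"
proof -
  have "Ck_on k E U (\<lambda>x. (f x, 0) + (0, g x))"
    by (intro Ck_on_add Ck_on_linear_compose[OF bounded_linear_Pair[OF bounded_linear_ident bounded_linear_zero]]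
        Ck_on_linear_compose[OF bounded_linear_Pair[OF bounded_linear_zero bounded_linear_ident]] assms)
  then show ?thesis by simp
qed

lemma Ck_on_fst: "Ck_on k E U f \<Longrightarrow> Ck_on k E U (\<lambda>x. fst (f x))"
  by (rule Ck_on_linear_compose[OF bounded_linear_fst])

lemma Ck_on_snd: "Ck_on k E U f \<Longrightarrow> Ck_on k E U (\<lambda>x. snd (f x))"
  by (rule Ck_on_linear_compose[OF bounded_linear_snd])

lemma Ck_on_matrix:
  fixes f :: "'a::euclidean_space \<Rightarrow> real^'n^'m"
  assumes "\<And>i j. Ck_on k E U (\<lambda>x. f x $ i $ j)"
  shows "Ck_on k E U f"
proof (rule Ck_on_componentwise)
  fix b :: "real^'n^'m" assume "b \<in> Basis"
  then obtain i j where "b = axis i (axis j 1)" by (auto simp: Basis_vec_def)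
  then have "(\<lambda>x. f x \<bullet> b) = (\<lambda>x. f x $ i $ j)" by (simp add: inner_axis)
  then show "Ck_on k E U (\<lambda>x. f x \<bullet> b)" using assms by simp
qed

lemma Ck_on_nth: "Ck_on k E U f \<Longrightarrow> Ck_on k E U (\<lambda>x. f x $ i $ j :: real)"
  by (rule Ck_on_linear_compose[OF bounded_linear_compose[OF bounded_linear_vec_nth bounded_linear_vec_nth]])

lemma Ck_on_mult:
  fixes f :: "'a::euclidean_space \<Rightarrow> real^'n^'m" and g :: "'a \<Rightarrow> real^'k^'n"
  assumes "Ck_on r E U f" "Ck_on r E U g"
  shows "Ck_on r E U (\<lambda>x. f x ** g x)"
  by (rule Ck_on_matrix)
    (simp add: matrix_matrix_mult_def, intro Ck_on_sum finite Ck_on_times Ck_on_nth assms)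

lemma Ck_on_transpose:
  fixes f :: "'a::euclidean_space \<Rightarrow> real^'n^'m"
  shows "Ck_on r E U f \<Longrightarrow> Ck_on r E U (\<lambda>x. transpose (f x))"
  by (rule Ck_on_matrix) (simp add: transpose_def Ck_on_nth)

lemma Ck_on_blocks:
  fixes f :: "'a::euclidean_space \<Rightarrow> real^('c::finite+'d::finite)^('r::finite+'s::finite)"
  assumes "Ck_on r E U f"
  shows "Ck_on r E U (\<lambda>x. blk11 (f x))" "Ck_on r E U (\<lambda>x. blk12 (f x))"
    "Ck_on r E U (\<lambda>x. blk21 (f x))" "Ck_on r E U (\<lambda>x. blk22 (f x))"
  using assms
  by (auto intro!: Ck_on_matrix simp: blk11_def blk12_def blk21_def blk22_def Ck_on_nth)

lemma Ck_on_blk: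
  fixes a :: "'a::euclidean_space \<Rightarrow> real^'c^'r" and d :: "'a \<Rightarrow> real^'d^'s"
  assumes "Ck_on r E U a" "Ck_on r E U b" "Ck_on r E U c" "Ck_on r E U d"
  shows "Ck_on r E U (\<lambda>x. blk (a x) (b x) (c x) (d x))"
proof (rule Ck_on_matrix)
  fix i :: "'r + 's" and j :: "'c + 'd"
  show "Ck_on r E U (\<lambda>x. blk (a x) (b x) (c x) (d x) $ i $ j)"
    using assms by (cases i; cases j) (simp_all add: Ck_on_nth)
qed

lemma Ck_on_det:
  fixes f :: "'a::euclidean_space \<Rightarrow> real^'n^'n"
  assumes "\<And>i j. Ck_on k E U (\<lambda>x. f x $ i $ j)"
  shows "Ck_on k E U (\<lambda>x. det (f x))"
  unfolding det_def
  by (intro Ck_on_sum Ck_on_times Ck_on_const Ck_on_prod assms finite finite_permutations)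

lemma Ck_on_matrix_inv:
  fixes f :: "'a::euclidean_space \<Rightarrow> real^'n^'n"
  assumes f: "Ck_on k E U f" and inv: "\<And>x. x \<in> U \<Longrightarrow> invertible (f x)"
  shows "Ck_on k E U (\<lambda>x. matrix_inv (f x))"
proof (rule Ck_on_matrix)
  fix i j
  have nth: "Ck_on k E U (\<lambda>x. f x $ r $ c)" for r c using f by (rule Ck_on_nth)
  have "Ck_on k E U (\<lambda>x. (\<chi> r c. if c = i then (if r = j then 1 else 0) else f x $ r $ c) $ r $ c)" for r c
    by (cases "c = i") (simp_all add: Ck_on_const nth)
  then have "Ck_on k E U (\<lambda>x. det (\<chi> r c. if c = i then (if r = j then 1 else 0) else f x $ r $ c) * inverse (det (f x)))"
    using inv by (intro Ck_on_times Ck_on_inverse Ck_on_det nth) (simp_all add: invertible_det_nz)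
  then show "Ck_on k E U (\<lambda>x. matrix_inv (f x) $ i $ j)"
    by (rule Ck_on_cong) (simp add: matrix_inv_entry inv divide_inverse)
qed

lemmas Ck_on_intros = Ck_on_const Ck_on_id Ck_on_add Ck_on_diff Ck_on_uminus Ck_on_Pair Ck_on_fst Ck_on_snd
  Ck_on_mult Ck_on_transpose Ck_on_blocks Ck_on_blk Ck_on_matrix_inv

lemma open_invertible:
  fixes f :: "'a::topological_space \<Rightarrow> real^'n^'n"
  assumes "continuous_on UNIV f"
  shows "open {x. invertible (f x)}"
proof -
  have "continuous_on UNIV (\<lambda>x. det (f x))"
    unfolding det_def by (intro continuous_intros assms)
  then show ?thesis unfolding invertible_det_nz by (intro open_Collect_neq continuous_intros)
qed

section \<open>The change of variables\<close>

text \<open>A relatively open set on which \<open>\<Phi>\<close> is injective and smooth: the controller has no direct feedthrough, \<open>P\<close> and \<open>\<Gamma>\<close> are symmetric,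
  and \<open>P\<close>, \<open>P\<^sub>1\<^sub>2\<close>, \<open>P\<^sub>2\<^sub>2\<close> are invertible.  For symmetric invertible \<open>P\<close>, invertibility of \<open>P\<^sub>2\<^sub>2\<close> amounts to that of
  \<open>(P\<inverse>)\<^sub>1\<^sub>1\<close>.\<close>

definition Phi_dom :: "((real ^ ('p::finite + 'n::finite) ^ ('m::finite + 'n)) \<times> real \<times> (real ^ ('n + 'n) ^ ('n + 'n))
    \<times> (real ^ ('n + 'm) ^ ('n + 'm))) set" where
  "Phi_dom = E_L \<inter> {z. invertible (fst (snd (snd z))) \<and> invertible (blk12 (fst (snd (snd z))))
      \<and> invertible (blk22 (fst (snd (snd z))))}"

text \<open>The image of \<open>Phi_dom\<close> under \<open>\<Phi>\<close>: the matrices \<open>X\<close>, \<open>X Y - I\<close> and \<open>\<Xi>\<close> are invertible.  As \<open>X Y - I = X (Y - X\<inverse>)\<close>, the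
  second condition is the invertibility of \<open>Y - X\<inverse>\<close>, in polynomial form.\<close>

definition Psi_dom :: "((real \<times> (real ^ ('p::finite + 'n::finite) ^ ('m::finite + 'n)) \<times> (real ^ 'n ^ 'n) \<times> (real ^ 'n ^ 'n)
    \<times> (real ^ ('n + 'm) ^ ('n + 'm))) \<times> (real ^ 'n ^ 'n)) set" where
  "Psi_dom = E_F \<inter> {w. invertible (fst (snd (snd (fst w)))) \<and>
      invertible (fst (snd (snd (fst w))) ** fst (snd (snd (snd (fst w)))) - mat 1) \<and> invertible (snd w)}"

lemma Phi_dom_iff: "(K, \<gamma>, P, \<Gamma>) \<in> Phi_dom \<longleftrightarrow> K \<in> V0 \<and> P \<in> symmat \<and> \<Gamma> \<in> symmat \<and>
    invertible P \<and> invertible (blk12 P) \<and> invertible (blk22 P)"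
  by (auto simp: Phi_dom_def E_L_def)

lemma Psi_dom_iff: "((\<gamma>, \<Lambda>, X, Y, \<Gamma>), \<Xi>) \<in> Psi_dom \<longleftrightarrow> \<Lambda> \<in> V0 \<and> X \<in> symmat \<and> Y \<in> symmat \<and> \<Gamma> \<in> symmat \<and>
    invertible X \<and> invertible (X ** Y - mat 1) \<and> invertible \<Xi>"
  by (auto simp: Psi_dom_def E_F_def)

lemma continuous_on_blocks:
  fixes f :: "'a::topological_space \<Rightarrow> real^('c::finite+'d::finite)^('r::finite+'s::finite)"
  assumes "continuous_on S f"
  shows "continuous_on S (\<lambda>x. blk12 (f x))" "continuous_on S (\<lambda>x. blk22 (f x))"
  by (rule continuous_on_matrix, simp add: blk12_def blk22_def, intro continuous_intros assms)+

lemma openin_Phi_dom: "openin (top_of_set E_L) Phi_dom"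
  unfolding Phi_dom_def Collect_conj_eq
  by (intro openin_open_Int open_Int open_invertible continuous_on_blocks
      continuous_on_fst continuous_on_snd continuous_on_id)

lemma openin_Psi_dom: "openin (top_of_set E_F) Psi_dom"
  unfolding Psi_dom_def Collect_conj_eq
  by (intro openin_open_Int open_Int open_invertible continuous_on_diff continuous_on_matrix_mult
      continuous_on_fst continuous_on_snd continuous_on_id continuous_on_const)

text \<open>The first block column of \<open>P P\<inverse> = I\<close> and its consequences.\<close>

lemma inverse_block_equations:
  fixes P :: "real^('n::finite+'n)^('n+'n)"
  assumes sym: "P \<in> symmat" and inv: "invertible P" "invertible (blk12 P)" "invertible (blk22 P)"
  defines "X \<equiv> blk11 (matrix_inv P)" and "N \<equiv> blk21 (matrix_inv P)"
  shows "blk11 P ** X + blk12 P ** N = mat 1"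
    and "transpose (blk12 P) ** X + blk22 P ** N = 0"
    and "transpose X = X" "invertible X" "invertible N"
    and "P = blk (blk11 P) (blk12 P) (transpose (blk12 P)) (blk22 P)" "transpose (blk11 P) = blk11 P"
proof -
  have "transpose (blk (blk11 P) (blk12 P) (blk21 P) (blk22 P)) = blk (blk11 P) (blk12 P) (blk21 P) (blk22 P)"
    using symmat_D[OF sym] by (simp add: blk_collapse)
  then have s: "blk21 P = transpose (blk12 P)" "transpose (blk11 P) = blk11 P"
    by (auto simp: transpose_blk)
  show P: "P = blk (blk11 P) (blk12 P) (transpose (blk12 P)) (blk22 P)" "transpose (blk11 P) = blk11 P"
    using s by (simp_all add: blk_collapse flip: s(1))
  have "blk (blk11 P) (blk12 P) (transpose (blk12 P)) (blk22 P) **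
      blk X (blk12 (matrix_inv P)) N (blk22 (matrix_inv P)) = blk (mat 1) 0 0 (mat 1)"
    using matrix_inv_inverse(1)[OF inv(1)] unfolding X_def N_def blk_collapse P(1)[symmetric] mat_blk[symmetric] .
  then show e1: "blk11 P ** X + blk12 P ** N = mat 1" and e2: "transpose (blk12 P) ** X + blk22 P ** N = 0"
    by (auto simp: blk_mult)
  have "transpose (matrix_inv P) = matrix_inv P" using transpose_matrix_inv[OF inv(1)] symmat_D[OF sym] by simp
  then have "transpose (blk X (blk12 (matrix_inv P)) N (blk22 (matrix_inv P))) = blk X (blk12 (matrix_inv P)) N (blk22 (matrix_inv P))"
    by (simp add: X_def N_def blk_collapse)
  then show "transpose X = X" by (auto simp: transpose_blk)
  show iX: "invertible X" unfolding invertible_iff_ker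
  proof (intro allI impI)
    fix v assume v: "X *v v = 0"
    have "(transpose (blk12 P) ** X + blk22 P ** N) *v v = 0" by (simp add: e2)
    then have "blk22 P *v (N *v v) = 0" using v
      by (simp add: matrix_vector_mult_add_rdistrib matrix_vector_mul_assoc[symmetric])
    then have "N *v v = 0" using inv(3) invertible_iff_ker by blast
    moreover have "(blk11 P ** X + blk12 P ** N) *v v = v" by (simp add: e1)
    ultimately show "v = 0" using v
      by (simp add: matrix_vector_mult_add_rdistrib matrix_vector_mul_assoc[symmetric])
  qed
  show "invertible N" unfolding invertible_iff_ker
  proof (intro allI impI)
    fix v assume v: "N *v v = 0"
    have "(transpose (blk12 P) ** X + blk22 P ** N) *v v = 0" by (simp add: e2)
    then have "transpose (blk12 P) *v (X *v v) = 0" using v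
      by (simp add: matrix_vector_mult_add_rdistrib matrix_vector_mul_assoc[symmetric])
    moreover have "invertible (transpose (blk12 P))" using inv(2) transpose_invertible by blast
    ultimately have "X *v v = 0" using invertible_iff_ker by blast
    then show "v = 0" using iX invertible_iff_ker by blast
  qed
qed

lemma invertible_blk_lower: 
  fixes S :: "real^'n^'n" and T :: "real^'m^'n"
  shows "invertible S \<Longrightarrow> invertible (blk (mat 1) 0 (T :: real^'m^'n) S)"
  unfolding invertible_iff_ker
proof (intro allI impI)
  fix v assume S: "\<forall>x. S *v x = 0 \<longrightarrow> x = 0" and v: "blk (mat 1) 0 T S *v v = 0"
  obtain x y where "v = vcat x y" by (rule vcat_exhaust)
  then show "v = 0" using v S by (auto simp: blk_mult_vcat)
qed

lemma invertible_blk_upper: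
  fixes S :: "real^'n^'n" and T :: "real^'n^'m"
  shows "invertible S \<Longrightarrow> invertible (blk (mat 1) T 0 S)"
  unfolding invertible_iff_ker
proof (intro allI impI)
  fix v assume S: "\<forall>x. S *v x = 0 \<longrightarrow> x = 0" and v: "blk (mat 1) T 0 S *v v = 0"
  obtain x y where "v = vcat x y" by (rule vcat_exhaust)
  then show "v = 0" using v S by (auto simp: blk_mult_vcat)
qed

text \<open>The multiplications by the two block triangular matrices turn the controller parameters into those of the convex set.\<close>

lemma controller_factorization:
  fixes A :: "real^'n^'n" and B :: "real^'m^'n" and C :: "real^'n^'p"
    and K :: "real ^ ('p + 'n) ^ ('m + 'n)"
  shows "blk (mat 1) 0 (Y ** B) \<Xi> ** K ** blk (mat 1) (C ** X) 0 N =
    blk (blk11 K) (blk11 K ** C ** X + blk12 K ** N)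
      (Y ** B ** blk11 K + \<Xi> ** blk21 K)
      (Y ** B ** blk11 K ** C ** X + \<Xi> ** blk21 K ** C ** X + Y ** B ** blk12 K ** N + \<Xi> ** blk22 K ** N)"
proof -
  have "blk (mat 1) 0 (Y ** B) \<Xi> ** blk (blk11 K) (blk12 K) (blk21 K) (blk22 K) ** blk (mat 1) (C ** X) 0 N =
    blk (blk11 K) (blk11 K ** C ** X + blk12 K ** N)
      (Y ** B ** blk11 K + \<Xi> ** blk21 K)
      (Y ** B ** blk11 K ** C ** X + \<Xi> ** blk21 K ** C ** X + Y ** B ** blk12 K ** N + \<Xi> ** blk22 K ** N)"
    by (simp add: blk_mult matrix_mul_add matrix_mul_assoc add_ac)
  then show ?thesis by (simp add: blk_collapse)
qed

lemma V0_iff: "K \<in> V0 \<longleftrightarrow> blk11 K = 0" by (simp add: V0_def)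

lemma Psi_Phi:
  fixes A :: "real^'n^'n" and B :: "real^'m^'n" and C :: "real^'n^'p"
  assumes "z \<in> Phi_dom"
  shows "Psi_LQG A B C (Phi_LQG A B C z) = z" "Phi_LQG A B C z \<in> Psi_dom"
proof -
  obtain K \<gamma> P \<Gamma> where z: "z = (K, \<gamma>, P, \<Gamma>)" by (cases z) auto
  define X where "X = blk11 (matrix_inv P)"
  define N where "N = blk21 (matrix_inv P)"
  define Y where "Y = blk11 P"
  define \<Xi> where "\<Xi> = blk12 P"
  define D where "D = blk22 P"
  have K: "blk11 K = 0" and sym: "P \<in> symmat" "\<Gamma> \<in> symmat" and inv: "invertible P" "invertible \<Xi>" "invertible D"
    using assms unfolding z Phi_dom_iff by (simp_all add: V0_iff \<Xi>_def D_def)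
  note eqs = inverse_block_equations[OF sym(1) inv(1) inv(2,3)[unfolded \<Xi>_def D_def],
      folded X_def N_def Y_def \<Xi>_def D_def]
  define \<Delta> where "\<Delta> = Y - matrix_inv X"
  have \<Delta>X: "\<Delta> ** X = - (\<Xi> ** N)"
    using eqs(1) matrix_inv_inverse(2)[OF eqs(4)]
    by (simp add: \<Delta>_def matrix_mul_diff) (metis add_diff_cancel_left' minus_diff_eq diff_diff_eq2 diff_add_eq cancel_comm_monoid_add_class.diff_cancel diff_0)
  have \<Xi>N: "invertible (\<Xi> ** N)" using invertible_mult inv(2) eqs(5) by blast
  \<comment> \<open>The lower right block of the second factor in \<open>\<Psi>\<^sub>K\<close> is \<open>N\<close>.\<close>
  have N: "- (matrix_inv \<Xi> ** \<Delta> ** X) = N"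
  proof -
    have "matrix_inv \<Xi> ** \<Delta> ** X = matrix_inv \<Xi> ** (\<Delta> ** X)" by (simp add: matrix_mul_assoc)
    also have "\<dots> = - (matrix_inv \<Xi> ** \<Xi> ** N)" by (simp add: \<Delta>X matrix_mul_assoc)
    finally show ?thesis using matrix_inv_inverse(2)[OF inv(2)] by simp
  qed
  have inv\<Delta>: "matrix_inv \<Delta> = - (X ** matrix_inv (\<Xi> ** N))"
  proof (rule matrix_inv_eqI(2))
    have "\<Delta> ** X ** matrix_inv (\<Xi> ** N) = - mat 1"
      using matrix_inv_inverse(1)[OF \<Xi>N] by (simp add: \<Delta>X)
    then show "\<Delta> ** - (X ** matrix_inv (\<Xi> ** N)) = mat 1" by (simp add: matrix_mul_assoc)
  qed
  \<comment> \<open>The lower right block of \<open>\<Psi>\<^sub>P\<close> is the given block of \<open>P\<close>.\<close>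
  have D: "transpose \<Xi> ** matrix_inv \<Delta> ** \<Xi> = D"
  proof -
    have "transpose \<Xi> ** X = - (D ** N)" using eqs(2) by (simp add: eq_neg_iff_add_eq_0)
    then have "transpose \<Xi> ** matrix_inv \<Delta> ** \<Xi> = D ** N ** matrix_inv (\<Xi> ** N) ** \<Xi>"
      by (simp add: inv\<Delta> matrix_mul_assoc)
    also have "matrix_inv (\<Xi> ** N) = matrix_inv N ** matrix_inv \<Xi>"
    proof (rule matrix_inv_eqI(2))
      have "\<Xi> ** N ** (matrix_inv N ** matrix_inv \<Xi>) = \<Xi> ** (N ** matrix_inv N) ** matrix_inv \<Xi>"
        by (simp add: matrix_mul_assoc)
      then show "\<Xi> ** N ** (matrix_inv N ** matrix_inv \<Xi>) = mat 1"
        using matrix_inv_inverse(1)[OF eqs(5)] matrix_inv_inverse(1)[OF inv(2)] by simp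
    qed
    also have "D ** N ** (matrix_inv N ** matrix_inv \<Xi>) ** \<Xi> = D ** (N ** matrix_inv N) ** (matrix_inv \<Xi> ** \<Xi>)"
      by (simp add: matrix_mul_assoc)
    also have "\<dots> = D" using matrix_inv_inverse(1)[OF eqs(5)] matrix_inv_inverse(2)[OF inv(2)] by simp
    finally show ?thesis .
  qed
  have Phi: "Phi_LQG A B C z = ((\<gamma>, blk 0 (blk12 K ** N) (\<Xi> ** blk21 K) (Phi_M A B C K P), X, Y, \<Gamma>), \<Xi>)"
    by (simp add: z X_def N_def Y_def \<Xi>_def)
  define E1 where "E1 = blk (mat 1) 0 (Y ** B) \<Xi>"
  define E2 where "E2 = blk (mat 1) (C ** X) 0 N"
  have E: "invertible E1" "invertible E2"
    using inv eqs by (simp_all add: E1_def E2_def invertible_blk_lower invertible_blk_upper)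
  have "E1 ** K ** E2 = blk 0 (blk12 K ** N) (\<Xi> ** blk21 K) (Phi_M A B C K P - Y ** A ** X)"
    unfolding E1_def E2_def controller_factorization
    by (simp add: K Phi_M_def X_def N_def Y_def \<Xi>_def)
  then have "Psi_K A B C (blk 0 (blk12 K ** N) (\<Xi> ** blk21 K) (Phi_M A B C K P)) X Y \<Xi>
      = matrix_inv E1 ** (E1 ** K ** E2) ** matrix_inv E2"
    unfolding Psi_K_def \<Delta>_def[symmetric] N blk_blocks by (simp add: E1_def E2_def)
  also have "\<dots> = (matrix_inv E1 ** E1) ** K ** (E2 ** matrix_inv E2)" by (simp add: matrix_mul_assoc)
  also have "\<dots> = K" using E by (simp add: matrix_inv_inverse)
  finally show "Psi_LQG A B C (Phi_LQG A B C z) = z"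
    unfolding Phi Psi_LQG.simps Psi_P_def \<Delta>_def[symmetric] D using eqs(6) by (simp add: z)
  have "X ** Y - mat 1 = - transpose (\<Xi> ** N)"
  proof -
    have "transpose (Y ** X + \<Xi> ** N) = mat 1" by (simp add: eqs(1))
    then show ?thesis by (simp add: transpose_add matrix_transpose_mul eqs(3,7) eq_neg_iff_add_eq_0 algebra_simps)
  qed
  moreover have "invertible (- transpose (\<Xi> ** N))"
    using transpose_invertible[OF \<Xi>N] by (simp add: invertible_iff_ker)
  ultimately show "Phi_LQG A B C z \<in> Psi_dom"
    unfolding Phi Psi_dom_iff using eqs sym inv by (simp add: V0_iff symmat_def)
qed

lemma Phi_Psi:
  fixes A :: "real^'n^'n" and B :: "real^'m^'n" and C :: "real^'n^'p"
  assumes "w \<in> Psi_dom"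
  shows "Phi_LQG A B C (Psi_LQG A B C w) = w" "Psi_LQG A B C w \<in> Phi_dom"
proof -
  obtain \<gamma> \<Lambda> X Y \<Gamma> \<Xi> where w: "w = ((\<gamma>, \<Lambda>, X, Y, \<Gamma>), \<Xi>)" by (metis prod.collapse)
  have \<Lambda>: "blk11 \<Lambda> = 0" and sym: "X \<in> symmat" "Y \<in> symmat" "\<Gamma> \<in> symmat"
    and inv: "invertible X" "invertible (X ** Y - mat 1)" "invertible \<Xi>"
    using assms unfolding w Psi_dom_iff by (simp_all add: V0_iff)
  define \<Delta> where "\<Delta> = Y - matrix_inv X"
  define N where "N = - (matrix_inv \<Xi> ** \<Delta> ** X)"
  define D where "D = transpose \<Xi> ** matrix_inv \<Delta> ** \<Xi>"
  define P where "P = blk Y \<Xi> (transpose \<Xi>) D"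
  have X1: "X ** matrix_inv X = mat 1" "matrix_inv X ** X = mat 1"
    and \<Xi>1: "\<Xi> ** matrix_inv \<Xi> = mat 1" "matrix_inv \<Xi> ** \<Xi> = mat 1"
    using inv matrix_inv_inverse by blast+
  have sX: "transpose (matrix_inv X) = matrix_inv X"
    using transpose_matrix_inv[OF inv(1)] symmat_D[OF sym(1)] by simp
  have "X ** \<Delta> = X ** Y - mat 1" by (simp add: \<Delta>_def matrix_mul_diff X1)
  then have "invertible (matrix_inv X ** (X ** \<Delta>))"
    using invertible_mult[OF invertible_matrix_inv[OF inv(1)] inv(2)] by simp
  then have i\<Delta>: "invertible \<Delta>" by (simp add: matrix_mul_assoc X1)
  have \<Delta>1: "\<Delta> ** matrix_inv \<Delta> = mat 1" "matrix_inv \<Delta> ** \<Delta> = mat 1"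
    using i\<Delta> matrix_inv_inverse by blast+
  have s\<Delta>: "transpose \<Delta> = \<Delta>" using symmat_D[OF sym(2)] by (simp add: \<Delta>_def transpose_diff sX)
  have s\<Delta>': "transpose (matrix_inv \<Delta>) = matrix_inv \<Delta>" using transpose_matrix_inv[OF i\<Delta>] s\<Delta> by simp
  have sD: "transpose D = D" by (simp add: D_def matrix_transpose_mul s\<Delta>' matrix_mul_assoc)
  have iD: "invertible D" unfolding D_def
    by (intro invertible_mult transpose_invertible inv invertible_matrix_inv i\<Delta>)
  have i\<Xi>T: "invertible (transpose \<Xi>)" by (intro transpose_invertible inv)
  have iN: "invertible N"
  proof -
    have "invertible (matrix_inv \<Xi> ** \<Delta> ** X)" by (intro invertible_mult inv invertible_matrix_inv i\<Delta>)
    then show ?thesis by (simp add: N_def invertible_iff_ker)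
  qed
  have symP: "P \<in> symmat" using sym by (simp add: P_def blk_symmat_iff) (simp add: symmat_def sD)
  have iP: "invertible P" unfolding invertible_iff_ker
  proof (intro allI impI)
    fix v assume v: "P *v v = 0"
    obtain x y where vxy: "v = vcat x y" by (rule vcat_exhaust)
    have 1: "Y *v x + \<Xi> *v y = 0" and "transpose \<Xi> *v x + D *v y = 0"
      using v unfolding vxy P_def blk_mult_vcat by simp_all
    then have "transpose \<Xi> *v (x + matrix_inv \<Delta> *v (\<Xi> *v y)) = 0"
      by (simp add: D_def matrix_vector_right_distrib matrix_vector_mul_assoc[symmetric])
    then have x: "x + matrix_inv \<Delta> *v (\<Xi> *v y) = 0" using i\<Xi>T invertible_iff_ker by blast
    then have "\<Delta> *v (x + matrix_inv \<Delta> *v (\<Xi> *v y)) = 0" by simp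
    then have "\<Delta> *v x + \<Xi> *v y = 0"
      by (simp add: matrix_vector_right_distrib matrix_vector_mul_assoc \<Delta>1 matrix_mul_assoc)
    with 1 have "Y *v x - \<Delta> *v x = 0" by (simp add: eq_neg_iff_add_eq_0[symmetric])
    then have "matrix_inv X *v x = 0" by (simp add: \<Delta>_def matrix_vector_mult_diff_rdistrib)
    then have x0: "x = 0" using invertible_matrix_inv[OF inv(1)] invertible_iff_ker by blast
    then have "\<Xi> *v y = 0" using 1 by simp
    then have "y = 0" using inv(3) invertible_iff_ker by blast
    then show "v = 0" using x0 vxy by simp
  qed
  \<comment> \<open>This identifies the first block column of \<open>P\<inverse>\<close> without computing the rest.\<close>
  have col: "P ** blkv X N = blkv (mat 1) 0"
  proof -
    have "Y ** X + \<Xi> ** N = mat 1"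
    proof -
      have "\<Xi> ** N = - ((\<Xi> ** matrix_inv \<Xi>) ** \<Delta> ** X)" by (simp add: N_def matrix_mul_assoc)
      then show ?thesis by (simp add: \<Xi>1 \<Delta>_def matrix_mul_diff X1)
    qed
    moreover have "transpose \<Xi> ** X + D ** N = 0"
    proof -
      have "D ** N = - (transpose \<Xi> ** (matrix_inv \<Delta> ** ((\<Xi> ** matrix_inv \<Xi>) ** \<Delta>)) ** X)"
        by (simp add: N_def D_def matrix_mul_assoc)
      then show ?thesis by (simp add: \<Xi>1 \<Delta>1)
    qed
    ultimately show ?thesis by (simp add: P_def blk_mult_blkv)
  qed
  have PX: "blk11 (matrix_inv P) = X" and PN: "blk21 (matrix_inv P) = N"
  proof -
    have "blkv X N = (matrix_inv P ** P) ** blkv X N" using matrix_inv_inverse(2)[OF iP] by simp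
    also have "\<dots> = matrix_inv P ** blkv (mat 1) 0" by (simp add: col flip: matrix_mul_assoc)
    also have "\<dots> = blk (blk11 (matrix_inv P)) (blk12 (matrix_inv P)) (blk21 (matrix_inv P)) (blk22 (matrix_inv P)) ** blkv (mat 1) 0"
      by (simp add: blk_collapse)
    also have "\<dots> = blkv (blk11 (matrix_inv P)) (blk21 (matrix_inv P))" by (simp add: blk_mult_blkv)
    finally have eq: "blkv X N = blkv (blk11 (matrix_inv P)) (blk21 (matrix_inv P))" .
    have "blkv X N $ Inl i = blkv (blk11 (matrix_inv P)) (blk21 (matrix_inv P)) $ Inl i"
      "blkv X N $ Inr i = blkv (blk11 (matrix_inv P)) (blk21 (matrix_inv P)) $ Inr i" for i
      by (simp_all only: eq)
    then show "blk11 (matrix_inv P) = X" "blk21 (matrix_inv P) = N" by (simp_all add: vec_eq_iff)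
  qed
  define E1 where "E1 = blk (mat 1) 0 (Y ** B) \<Xi>"
  define E2 where "E2 = blk (mat 1) (C ** X) 0 N"
  have E: "invertible E1" "invertible E2"
    using inv iN by (simp_all add: E1_def E2_def invertible_blk_lower invertible_blk_upper)
  define K where "K = Psi_K A B C \<Lambda> X Y \<Xi>"
  have K: "K = matrix_inv E1 ** blk 0 (blk12 \<Lambda>) (blk21 \<Lambda>) (blk22 \<Lambda> - Y ** A ** X) ** matrix_inv E2"
    unfolding K_def Psi_K_def \<Delta>_def[symmetric] N_def[symmetric] E1_def E2_def ..
  have "E1 ** K ** E2 = (E1 ** matrix_inv E1) ** blk 0 (blk12 \<Lambda>) (blk21 \<Lambda>) (blk22 \<Lambda> - Y ** A ** X) ** (matrix_inv E2 ** E2)"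
    by (simp add: K matrix_mul_assoc)
  then have "E1 ** K ** E2 = blk 0 (blk12 \<Lambda>) (blk21 \<Lambda>) (blk22 \<Lambda> - Y ** A ** X)"
    using E by (simp add: matrix_inv_inverse)
  then have K0: "blk11 K = 0"
    and F: "blk12 K ** N = blk12 \<Lambda>" and H: "\<Xi> ** blk21 K = blk21 \<Lambda>"
    and M: "\<Xi> ** blk21 K ** C ** X + Y ** B ** blk12 K ** N + \<Xi> ** blk22 K ** N = blk22 \<Lambda> - Y ** A ** X"
    unfolding E1_def E2_def controller_factorization by auto
  have Psi: "Psi_LQG A B C w = (K, \<gamma>, P, \<Gamma>)"
    by (simp add: w K_def Psi_P_def P_def D_def \<Delta>_def)
  show "Psi_LQG A B C w \<in> Phi_dom" unfolding Psi Phi_dom_iff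
    using K0 symP sym iP inv iD by (simp add: V0_iff P_def)
  have "Phi_M A B C K P = (\<Xi> ** blk21 K ** C ** X + Y ** B ** blk12 K ** N + \<Xi> ** blk22 K ** N) + Y ** A ** X"
    unfolding Phi_M_def PX PN by (simp add: P_def add_ac)
  then have "Phi_M A B C K P = blk22 \<Lambda>" by (simp add: M)
  then show "Phi_LQG A B C (Psi_LQG A B C w) = w"
    unfolding Psi Phi_LQG.simps PX PN using F H blk_collapse[of \<Lambda>] by (simp add: w P_def \<Lambda>)
qed

section \<open>Congruence of the matrix inequalities\<close>

lemma congruence_blk_diag:
  fixes T :: "real^'n^'n" and d :: "real^'m^'m"
  shows "transpose (blk T 0 0 (mat 1)) ** blk a b c d ** blk T 0 0 (mat 1)
    = blk (transpose T ** a ** T) (transpose T ** b) (c ** T) d"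
  by (simp add: transpose_blk blk_mult)

lemma invertible_blk_diag:
  fixes T :: "real^'n^'n"
  assumes "invertible T" shows "invertible (blk T 0 0 (mat 1 :: real^'m^'m))"
  unfolding invertible_iff_ker
proof (intro allI impI)
  fix v assume v: "blk T 0 0 (mat 1 :: real^'m^'m) *v v = 0"
  obtain x y where "v = vcat x y" by (rule vcat_exhaust)
  then show "v = 0" using v assms by (auto simp: blk_mult_vcat invertible_iff_ker)
qed

text \<open>The matrix inequalities of the lifted set and of the convex set are congruent by \<open>T = [X, I; N, 0]\<close>,
  extended by an identity block.\<close>

lemma lmi_congruence:
  fixes A :: "real^'n^'n" and B :: "real^'m^'n" and C :: "real^'n^'p"
  assumes Phi_dom: "(K, \<gamma>, P, \<Gamma>) \<in> Phi_dom"
    and Phi: "Phi_LQG A B C (K, \<gamma>, P, \<Gamma>) = ((\<gamma>', \<Lambda>, X, Y, \<Gamma>'), \<Xi>)"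
  shows "posdef (blk X (mat 1) (mat 1) Y) \<longleftrightarrow> posdef P"
    and "psd (- calA A B C W V \<gamma>' (blk12 \<Lambda>) (blk21 \<Lambda>) (blk22 \<Lambda>) X Y) \<longleftrightarrow> psd (lyapunov_lmi (Acl A B C K) (Bcl B W V K) \<gamma> P)"
    and "posdef (- calA A B C W V \<gamma>' (blk12 \<Lambda>) (blk21 \<Lambda>) (blk22 \<Lambda>) X Y) \<longleftrightarrow> posdef (lyapunov_lmi (Acl A B C K) (Bcl B W V K) \<gamma> P)"
    and "psd (calB Q R (blk12 \<Lambda>) X Y \<Gamma>') \<longleftrightarrow> psd (blk P (transpose (Ccl C Q R K)) (Ccl C Q R K) \<Gamma>)"
proof -
  define N where "N = blk21 (matrix_inv P)"
  define D where "D = blk22 P"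
  have X: "X = blk11 (matrix_inv P)" and Y: "Y = blk11 P" and \<Xi>: "\<Xi> = blk12 P" and \<gamma>: "\<gamma>' = \<gamma>" and \<Gamma>: "\<Gamma>' = \<Gamma>"
    and \<Lambda>: "\<Lambda> = blk 0 (blk12 K ** N) (\<Xi> ** blk21 K) (Phi_M A B C K P)"
    using Phi by (auto simp: N_def)
  have K: "blk11 K = 0" and sym: "P \<in> symmat" and inv: "invertible P" "invertible \<Xi>" "invertible D"
    using Phi_dom unfolding Phi_dom_iff by (simp_all add: V0_iff \<Xi> D_def)
  note eqs = inverse_block_equations[OF sym inv(1) inv(2,3)[unfolded \<Xi> D_def],
      folded X N_def Y \<Xi> D_def]
  define T1 where "T1 = blk X (mat 1) N 0"
  \<comment> \<open>\<open>T2\<close> is \<open>P T1\<close>, free of inverses.\<close>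
  define T2 where "T2 = blk (mat 1) Y 0 (transpose \<Xi>)"
  have iT1: "invertible T1" unfolding invertible_iff_ker
  proof (intro allI impI)
    fix v assume v: "T1 *v v = 0"
    obtain x y where vxy: "v = vcat x y" by (rule vcat_exhaust)
    have "X *v x + y = 0" "N *v x = 0" using v by (auto simp: vxy T1_def blk_mult_vcat)
    moreover from this have "x = 0" using eqs(5) invertible_iff_ker by blast
    ultimately show "v = 0" by (simp add: vxy)
  qed
  have PT1: "P ** T1 = T2"
    by (subst eqs(6)) (simp add: T1_def T2_def blk_mult eqs(1,2))
  have T1P: "transpose T1 ** P = transpose T2"
    using arg_cong[OF PT1, of transpose] by (simp add: matrix_transpose_mul symmat_D[OF sym])
  have tr1: "transpose T1 = blk X (transpose N) (mat 1) 0" by (simp add: T1_def transpose_blk eqs(3))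
  have tr2: "transpose T2 = blk (mat 1) 0 Y \<Xi>" by (simp add: T2_def transpose_blk eqs(7))
  have XY: "X ** Y + transpose N ** transpose \<Xi> = mat 1"
    using arg_cong[OF eqs(1), of transpose] by (simp add: transpose_add matrix_transpose_mul eqs(3,7))
  have c1: "transpose T1 ** P ** T1 = blk X (mat 1) (mat 1) Y"
  proof -
    have "transpose T1 ** P ** T1 = transpose T1 ** T2" by (simp add: PT1 flip: matrix_mul_assoc)
    then show ?thesis by (simp add: tr1 T2_def blk_mult XY)
  qed
  show "posdef (blk X (mat 1) (mat 1) Y) \<longleftrightarrow> posdef P"
    using posdef_congruence_iff[OF iT1, of P] by (simp add: c1)
  let ?A = "Acl A B C K" and ?B = "Bcl B W V K" and ?C = "Ccl C Q R K"
  define Z where "Z = blk (A ** X + B ** blk12 \<Lambda>) A (blk22 \<Lambda>) (Y ** A + blk21 \<Lambda> ** C)"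
  have Z: "transpose T2 ** ?A ** T1 = Z"
    by (simp add: tr2 T1_def Acl_def K blk_mult Z_def \<Lambda> Phi_M_def X[symmetric] Y[symmetric] N_def[symmetric]
      \<Xi>[symmetric] matrix_mul_add matrix_mul_assoc add_ac)
  have Zt: "transpose T1 ** transpose ?A ** T2 = transpose Z"
    using arg_cong[OF Z, of transpose] by (simp add: matrix_transpose_mul matrix_mul_assoc)
  have H: "blk21 \<Lambda> = \<Xi> ** blk21 K" by (simp add: \<Lambda>)
  have PB: "transpose T1 ** (P ** ?B) = blkv (B1 W) (Y ** B1 W + blk21 \<Lambda> ** D21 V)"
  proof -
    have "transpose T1 ** (P ** ?B) = blk (msqrt W) 0 (Y ** msqrt W) (blk21 \<Lambda> ** msqrt V)"
      by (simp add: matrix_mul_assoc T1P tr2 Bcl_def K blk_mult H)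
    then show ?thesis
      by (simp add: B1_def D21_def mult_blkh blk_eq_blkv) (simp add: vec_eq_iff forall_sum)
  qed
  have BP: "transpose ?B ** P ** T1 = transpose (transpose T1 ** (P ** ?B))"
    by (simp add: matrix_transpose_mul symmat_D[OF sym] matrix_mul_assoc)
  have AP: "transpose T1 ** (transpose ?A ** P + P ** ?A) ** T1 = transpose Z + Z"
  proof -
    have "transpose T1 ** (transpose ?A ** P + P ** ?A) ** T1
      = transpose T1 ** transpose ?A ** (P ** T1) + (transpose T1 ** P) ** ?A ** T1"
      by (simp add: matrix_mul_add matrix_mul_assoc)
    then show ?thesis by (simp add: PT1 T1P Z Zt)
  qed
  define TT where "TT = blk T1 0 0 (mat 1 :: real^('n+'p)^('n+'p))"
  have "transpose TT ** lyapunov_lmi ?A ?B \<gamma> P ** TT = - calA A B C W V \<gamma>' (blk12 \<Lambda>) (blk21 \<Lambda>) (blk22 \<Lambda>) X Y"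
  proof -
    have "transpose TT ** lyapunov_lmi ?A ?B \<gamma> P ** TT = - blk (transpose Z + Z) (transpose T1 ** (P ** ?B))
       (transpose (transpose T1 ** (P ** ?B))) (- mat \<gamma>)"
      by (simp add: lyapunov_lmi_def TT_def congruence_blk_diag AP BP)
    then show ?thesis
      by (simp add: PB calA_def \<gamma> transpose_blkv Z_def transpose_blk blk_add add_ac transpose_add)
  qed
  moreover have "invertible TT" unfolding TT_def by (rule invertible_blk_diag[OF iT1])
  ultimately show "psd (- calA A B C W V \<gamma>' (blk12 \<Lambda>) (blk21 \<Lambda>) (blk22 \<Lambda>) X Y) \<longleftrightarrow> psd (lyapunov_lmi ?A ?B \<gamma> P)"
    "posdef (- calA A B C W V \<gamma>' (blk12 \<Lambda>) (blk21 \<Lambda>) (blk22 \<Lambda>) X Y) \<longleftrightarrow> posdef (lyapunov_lmi ?A ?B \<gamma> P)"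
    using psd_congruence_iff[of TT "lyapunov_lmi ?A ?B \<gamma> P"] posdef_congruence_iff[of TT "lyapunov_lmi ?A ?B \<gamma> P"] by simp_all
  define TC where "TC = blk T1 0 0 (mat 1 :: real^('n+'m)^('n+'m))"
  have CT: "?C ** T1 = blkh (C1 Q ** X + D12 R ** blk12 \<Lambda>) (C1 Q)"
  proof -
    have "?C ** T1 = blk (msqrt Q ** X) (msqrt Q) (msqrt R ** blk12 \<Lambda>) 0"
      by (simp add: T1_def Ccl_def K blk_mult \<Lambda> matrix_mul_assoc)
    then show ?thesis
      by (simp add: C1_def D12_def blkv_mult blk_eq_blkh) (simp add: vec_eq_iff forall_sum)
  qed
  have "transpose TC ** blk P (transpose ?C) ?C \<Gamma> ** TC = calB Q R (blk12 \<Lambda>) X Y \<Gamma>'"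
  proof -
    have "transpose TC ** blk P (transpose ?C) ?C \<Gamma> ** TC = blk (blk X (mat 1) (mat 1) Y) (transpose (?C ** T1)) (?C ** T1) \<Gamma>"
      by (simp add: TC_def congruence_blk_diag c1 matrix_transpose_mul)
    then show ?thesis by (simp add: CT calB_def \<Gamma> transpose_blkh)
  qed
  moreover have "invertible TC" unfolding TC_def by (rule invertible_blk_diag[OF iT1])
  ultimately show "psd (calB Q R (blk12 \<Lambda>) X Y \<Gamma>') \<longleftrightarrow> psd (blk P (transpose ?C) ?C \<Gamma>)"
    using psd_congruence_iff[of TC "blk P (transpose ?C) ?C \<Gamma>"] by simp
qed

lemma posdef_blk_blocks:
  assumes "posdef (blk a b c d)" shows "posdef a" "posdef d"
proof -
  have c: "c = transpose b" using assms by (simp add: posdef_def blk_symmat_iff)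
  have pos: "x \<noteq> 0 \<or> y \<noteq> 0 \<Longrightarrow> 0 < x \<bullet> (a *v x) + 2 * (x \<bullet> (b *v y)) + y \<bullet> (d *v y)" for x y
    using assms unfolding c posdef_blk_iff by blast
  have "0 < x \<bullet> (a *v x)" if "x \<noteq> 0" for x using pos[of x 0] that by simp
  moreover have "0 < y \<bullet> (d *v y)" if "y \<noteq> 0" for y using pos[of 0 y] that by simp
  ultimately show "posdef a" "posdef d" using assms by (simp_all add: posdef_def blk_symmat_iff)
qed

lemma L_LQG_subset_Phi_dom: "L_LQG A B C Q R W V \<subseteq> Phi_dom"
proof
  fix z assume z: "z \<in> L_LQG A B C Q R W V"
  obtain K \<gamma> P \<Gamma> where zz: "z = (K, \<gamma>, P, \<Gamma>)" by (cases z) auto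
  have P: "posdef P" using z by (simp add: zz L_LQG_def)
  then have "posdef (blk22 P)" using posdef_blk_blocks(2) blk_collapse by metis
  then show "z \<in> Phi_dom" using z P unfolding zz Phi_dom_iff
    by (simp add: L_LQG_def GL_def psd_def posdef_iff_psd_invertible)
qed

lemma F_LQG_subset_Psi_dom:
  fixes A :: "real^'n^'n"
  shows "F_LQG A B C Q R W V \<times> GL \<subseteq> Psi_dom"
proof
  fix w assume w: "w \<in> F_LQG A B C Q R W V \<times> (GL :: (real^'n^'n) set)"
  obtain \<gamma> \<Lambda> X Y \<Gamma> \<Xi> where ww: "w = ((\<gamma>, \<Lambda>, X, Y, \<Gamma>), \<Xi>)" by (metis prod.collapse)
  have p: "posdef (blk X (mat 1) (mat 1) Y)" using w by (simp add: ww F_LQG_def)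
  then have X: "posdef X" by (rule posdef_blk_blocks(1))
  have "invertible (X ** Y - mat 1)" unfolding invertible_iff_ker
  proof (intro allI impI)
    fix v assume "(X ** Y - mat 1) *v v = 0"
    then have XY: "X *v (Y *v v) = v" by (simp add: matrix_vector_mult_diff_rdistrib matrix_vector_mul_assoc)
    have "posdef (blk X (mat 1) (transpose (mat 1)) Y)" using p by simp
    then have "v \<noteq> 0 \<Longrightarrow> 0 < (Y *v v) \<bullet> (X *v (Y *v v)) + 2 * ((Y *v v) \<bullet> (mat 1 *v (- v))) + (- v) \<bullet> (Y *v (- v))"
      unfolding posdef_blk_iff by (metis neg_equal_0_iff_equal)
    then show "v = 0" by (auto simp: XY inner_commute)
  qed
  then show "w \<in> Psi_dom" using w X unfolding ww Psi_dom_iff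
    by (simp add: F_LQG_def GL_def psd_def posdef_iff_psd_invertible)
qed

lemma Phi_mem_iff:
  assumes "z \<in> Phi_dom"
  shows "Phi_LQG A B C z \<in> F_LQG A B C Q R W V \<times> GL \<longleftrightarrow> z \<in> L_LQG A B C Q R W V"
proof -
  obtain K \<gamma> P \<Gamma> where z: "z = (K, \<gamma>, P, \<Gamma>)" by (cases z) auto
  obtain \<gamma>' \<Lambda> X Y \<Gamma>' \<Xi> where Phi: "Phi_LQG A B C z = ((\<gamma>', \<Lambda>, X, Y, \<Gamma>'), \<Xi>)" by (metis prod.collapse)
  note c = lmi_congruence[OF assms[unfolded z] Phi[unfolded z]]
  have Psi_dom: "((\<gamma>', \<Lambda>, X, Y, \<Gamma>'), \<Xi>) \<in> Psi_dom" using Psi_Phi(2)[OF assms, of A B C] by (simp add: Phi)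
  have "\<gamma>' = \<gamma>" "\<Gamma>' = \<Gamma>" using Phi by (auto simp: z)
  then show ?thesis
    using Psi_dom assms c(1,2) c(4)[of Q R] unfolding Phi unfolding z Psi_dom_iff Phi_dom_iff
    by (auto simp: F_LQG_def L_LQG_def GL_def lyapunov_lmi_def[symmetric])
qed

lemma Phi_smooth: "Ck_on k E Phi_dom (Phi_LQG A B C)"
proof -
  have *: "Phi_LQG A B C z = ((fst (snd z),
       blk 0 (blk12 (fst z) ** blk21 (matrix_inv (fst (snd (snd z)))))
           (blk12 (fst (snd (snd z))) ** blk21 (fst z)) (Phi_M A B C (fst z) (fst (snd (snd z)))),
       blk11 (matrix_inv (fst (snd (snd z)))), blk11 (fst (snd (snd z))), snd (snd (snd z))),
      blk12 (fst (snd (snd z))))" for z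
    by (cases z) simp
  show ?thesis unfolding *[abs_def] Phi_M_def
    by (intro Ck_on_intros) (simp_all add: Phi_dom_def)
qed

lemma Psi_smooth: "Ck_on k E Psi_dom (Psi_LQG A B C)"
proof -
  have *: "Psi_LQG A B C w = (Psi_K A B C (fst (snd (fst w))) (fst (snd (snd (fst w)))) (fst (snd (snd (snd (fst w))))) (snd w),
     fst (fst w), Psi_P (fst (snd (snd (fst w)))) (fst (snd (snd (snd (fst w))))) (snd w), snd (snd (snd (snd (fst w)))))" for w
    by (cases w rule: prod.exhaust, cases "fst w") auto
  have inv: "invertible X" "invertible \<Xi>" "invertible (Y - matrix_inv X)"
    "invertible (blk (mat 1) 0 (Y ** B) \<Xi>)" "invertible (blk (mat 1) (C ** X) 0 (- (matrix_inv \<Xi> ** (Y - matrix_inv X) ** X)))"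
    if "w \<in> Psi_dom" "X = fst (snd (snd (fst w)))" "Y = fst (snd (snd (snd (fst w))))" "\<Xi> = snd w" for w X Y \<Xi>
  proof -
    show 1: "invertible X" "invertible \<Xi>" using that by (simp_all add: Psi_dom_def)
    have "X ** (Y - matrix_inv X) = X ** Y - mat 1" by (simp add: matrix_mul_diff matrix_inv_inverse 1)
    then have "invertible (matrix_inv X ** (X ** (Y - matrix_inv X)))"
      using that by (auto simp: Psi_dom_def intro!: invertible_mult invertible_matrix_inv)
    then show 2: "invertible (Y - matrix_inv X)" by (simp add: matrix_mul_assoc matrix_inv_inverse 1)
    show "invertible (blk (mat 1) 0 (Y ** B) \<Xi>)" by (rule invertible_blk_lower[OF 1(2)])
    have "invertible (matrix_inv \<Xi> ** (Y - matrix_inv X) ** X)"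
      by (intro invertible_mult invertible_matrix_inv 1 2)
    then have "invertible (- (matrix_inv \<Xi> ** (Y - matrix_inv X) ** X))" by (simp add: invertible_iff_ker)
    then show "invertible (blk (mat 1) (C ** X) 0 (- (matrix_inv \<Xi> ** (Y - matrix_inv X) ** X)))"
      by (rule invertible_blk_upper)
  qed
  show ?thesis unfolding *[abs_def] Psi_K_def Psi_P_def
    by (intro Ck_on_intros) (auto intro: inv)
qed

lemma Phi_LQG_image: "Phi_LQG A B C ` Phi_dom = Psi_dom"
proof
  show "Phi_LQG A B C ` Phi_dom \<subseteq> Psi_dom" using Psi_Phi(2) by blast
  show "Psi_dom \<subseteq> Phi_LQG A B C ` Phi_dom" using Phi_Psi[of _ A B C] by (metis imageI subsetI)
qed

lemma inj_on_Phi: "inj_on (Phi_LQG A B C) Phi_dom"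
  by (rule inj_on_inverseI[of _ "Psi_LQG A B C"]) (rule Psi_Phi(1))

lemma bij_betw_Phi: "bij_betw (Phi_LQG A B C) (L_LQG A B C Q R W V) (F_LQG A B C Q R W V \<times> GL)"
proof (rule bij_betw_byWitness[where f' = "Psi_LQG A B C"])
  show "\<forall>z\<in>L_LQG A B C Q R W V. Psi_LQG A B C (Phi_LQG A B C z) = z"
    using L_LQG_subset_Phi_dom Psi_Phi(1) by blast
  show "\<forall>w\<in>F_LQG A B C Q R W V \<times> GL. Phi_LQG A B C (Psi_LQG A B C w) = w"
    using F_LQG_subset_Psi_dom Phi_Psi(1) by blast
  show "Phi_LQG A B C ` L_LQG A B C Q R W V \<subseteq> F_LQG A B C Q R W V \<times> GL"
    using L_LQG_subset_Phi_dom Phi_mem_iff by blast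
  show "Psi_LQG A B C ` (F_LQG A B C Q R W V \<times> GL) \<subseteq> L_LQG A B C Q R W V"
  proof
    fix z assume "z \<in> Psi_LQG A B C ` (F_LQG A B C Q R W V \<times> GL)"
    then obtain w where w: "w \<in> F_LQG A B C Q R W V \<times> GL" "z = Psi_LQG A B C w" by blast
    then have "w \<in> Psi_dom" using F_LQG_subset_Psi_dom by blast
    then have "z \<in> Phi_dom" "Phi_LQG A B C z = w" using Phi_Psi w(2) by simp_all
    then show "z \<in> L_LQG A B C Q R W V" using Phi_mem_iff w(1) by metis
  qed
qed

text \<open>The extension of \<open>\<Phi>\<close> to \<open>Phi_dom\<close> is given by the same formula.\<close>

lemma Phi_diffeo: "Cr_diffeo r E_L E_F (L_LQG A B C Q R W V) (F_LQG A B C Q R W V \<times> GL) (Phi_LQG A B C)"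
  unfolding Cr_diffeo_def
proof (intro conjI exI[of _ Phi_dom] exI[of _ "Phi_LQG A B C"] ballI refl)
  show "L_LQG A B C Q R W V \<subseteq> E_L" using L_LQG_subset_Phi_dom Phi_dom_def by blast
  show "F_LQG A B C Q R W V \<times> GL \<subseteq> E_F" using F_LQG_subset_Psi_dom Psi_dom_def by blast
  show "Cr_on r E_F (Phi_LQG A B C ` Phi_dom) (inv_into Phi_dom (Phi_LQG A B C))"
    unfolding Cr_on_def Phi_LQG_image
  proof (intro allI impI)
    fix k
    show "Ck_on k E_F Psi_dom (inv_into Phi_dom (Phi_LQG A B C))"
    proof (rule Ck_on_cong[OF Psi_smooth[of k E_F A B C]])
      show "inv_into Phi_dom (Phi_LQG A B C) w = Psi_LQG A B C w" if "w \<in> Psi_dom" for w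
        using that Phi_Psi[of w A B C] inv_into_f_f[OF inj_on_Phi] by metis
    qed
  qed
qed (simp_all add: bij_betw_Phi openin_Phi_dom L_LQG_subset_Phi_dom Cr_on_def Phi_smooth inj_on_Phi Phi_LQG_image openin_Psi_dom)

section \<open>A strictly feasible point\<close>

lemma transpose_mpow:
  fixes A :: "real^'n^'n"
  shows "transpose (mpow A k) = mpow (transpose A) k"
proof (induction k)
  case (Suc k)
  have comm: "mpow M j ** M = M ** mpow M j" for M :: "real^'n^'n" and j
    by (induction j) (simp_all add: mpow_def flip: matrix_mul_assoc)
  have "transpose (mpow A (Suc k)) = transpose (A ** mpow A k)" by (simp add: mpow_def)
  also have "\<dots> = mpow (transpose A) k ** transpose A" by (simp add: matrix_transpose_mul Suc)
  also have "\<dots> = mpow (transpose A) (Suc k)" by (simp add: comm) (simp add: mpow_def)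
  finally show ?case .
qed (simp add: mpow_def)

lemma observable_iff_controllable: "observable C A \<longleftrightarrow> controllable (transpose A) (transpose C)"
proof -
  have "rows (C ** mpow A k) = columns (mpow (transpose A) k ** transpose C)" for k
    using columns_transpose[of "C ** mpow A k"] by (simp add: matrix_transpose_mul transpose_mpow)
  then show ?thesis by (simp add: observable_def controllable_def)
qed

lemma controllable_kernel:
  fixes A :: "real^'n^'n" and B :: "real^'m^'n"
  assumes "controllable A B" and x: "\<And>k. transpose B *v (transpose (mpow A k) *v x) = 0"
  shows "x = 0"
proof -
  let ?S = "\<Union>k<CARD('n). columns (mpow A k ** B)"
  have "span ?S = UNIV"
    using assms(1) dim_eq_full[of ?S] by (simp add: controllable_def)
  moreover have "orthogonal x c" if "c \<in> ?S" for c
  proof -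
    obtain k j where c: "c = column j (mpow A k ** B)" using \<open>c \<in> ?S\<close> by (auto simp: columns_def)
    have "c \<bullet> x = (transpose (mpow A k ** B) *v x) $ j"
      by (simp add: c column_def inner_vec_def matrix_vector_mult_def transpose_def)
    also have "\<dots> = 0" using x[of k] by (simp add: matrix_transpose_mul matrix_vector_mul_assoc)
    finally show ?thesis by (simp add: orthogonal_def inner_commute)
  qed
  ultimately have "orthogonal x x" using orthogonal_to_span[of x ?S x] by simp
  then show ?thesis by (simp add: orthogonal_def)
qed

text \<open>Bass's shift: for large \<open>b\<close> the matrix \<open>-(A + b I)\<close> is Hurwitz, and \<open>X\<close> is its Gramian.  The kernel of \<open>X\<close> is invariant under \<open>A\<^sup>T\<close> and
  is annihilated by \<open>B\<^sup>T\<close>, hence trivial if \<open>(A, B)\<close> is controllable.\<close>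

lemma controllable_gramian:
  fixes A :: "real^'n^'n" and B :: "real^'m^'n"
  assumes "controllable A B"
  obtains X b where "b > 0" "posdef X" "A ** X + X ** transpose A + (2 * b) *\<^sub>R X = B ** transpose B"
proof -
  obtain k where k: "k > 0" "\<And>x y. \<bar>x \<bullet> (A *v y)\<bar> \<le> k * (norm x * norm y)"
    using quadratic_form_bound by blast
  define b where "b = k + 1"
  define A' where "A' = - (A + b *\<^sub>R mat 1)"
  have "hurwitz A'"
  proof (rule posdef_lyapunov_hurwitz[of "mat 1"])
    show "posdef (mat 1 :: real^'n^'n)" by (simp add: posdef_def)
    have eq: "- (transpose A' ** mat 1 + mat 1 ** A') = transpose A + A + (2 * b) *\<^sub>R mat 1"
    proof -
      have "(2 * b) *\<^sub>R (mat 1 :: real^'n^'n) = b *\<^sub>R mat 1 + b *\<^sub>R mat 1"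
        by (metis mult_2 scaleR_left_distrib)
      then show ?thesis by (simp add: A'_def transpose_uminus transpose_diff transpose_scalar)
    qed
    have "0 < x \<bullet> ((transpose A + A + (2 * b) *\<^sub>R mat 1) *v x)" if "x \<noteq> 0" for x
    proof -
      have "\<bar>x \<bullet> (A *v x)\<bar> \<le> k * (x \<bullet> x)" using k(2)[of x x] by (simp add: dot_square_norm power2_eq_square)
      moreover have quad: "x \<bullet> ((transpose A + A + (2 * b) *\<^sub>R mat 1) *v x) = 2 * (x \<bullet> (A *v x)) + 2 * b * (x \<bullet> x)"
        by (simp add: matrix_vector_mult_add_rdistrib inner_add_right inner_transpose inner_commute
            scaleR_matrix_vector_assoc[symmetric])
      moreover have "x \<bullet> x > 0" using that by simp
      moreover have "2 * b * (x \<bullet> x) = 2 * (k * (x \<bullet> x)) + 2 * (x \<bullet> x)" by (simp add: b_def algebra_simps)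
      ultimately show ?thesis unfolding quad by linarith
    qed
    then show "posdef (- (transpose A' ** mat 1 + mat 1 ** A'))"
      unfolding eq by (simp add: posdef_def symmat_def transpose_add transpose_scalar add.commute)
  qed
  then obtain X where lyap: "A' ** X + X ** transpose A' + B ** transpose B = 0" by (rule lyapunov_exists)
  have psdX: "psd X" by (rule lyapunov_psd[OF \<open>hurwitz A'\<close> lyap psd_gram])
  then have sym: "X \<in> symmat" by (simp add: psd_def)
  have group: "(- a - p) + (- c - p) + d = 0 \<Longrightarrow> a + c + (p + p) = d" for a c d p :: "real^'n^'n"
    by (simp add: vec_eq_iff) (smt (verit))
  have eq: "A ** X + X ** transpose A + (2 * b) *\<^sub>R X = B ** transpose B"
  proof -
    have "A' ** X = - (A ** X) - b *\<^sub>R X"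
      by (simp add: A'_def matrix_mul_add matrix_mul_diff)
    moreover have "X ** transpose A' = - (X ** transpose A) - b *\<^sub>R X"
      by (simp add: A'_def transpose_diff transpose_uminus transpose_scalar matrix_mul_diff)
    moreover have "(2 * b) *\<^sub>R X = b *\<^sub>R X + b *\<^sub>R X" by (metis mult_2 scaleR_left_distrib)
    ultimately show ?thesis using lyap group by metis
  qed
  have ker: "transpose B *v x = 0 \<and> X *v (transpose A *v x) = 0" if x: "X *v x = 0" for x
  proof -
    have v: "X *v (transpose A *v x) = B *v (transpose B *v x)"
    proof -
      have "(A ** X + X ** transpose A + (2 * b) *\<^sub>R X) *v x = X *v (transpose A *v x)"
        using x by (simp add: matrix_vector_mult_add_rdistrib scaleR_matrix_vector_assoc[symmetric]
            flip: matrix_vector_mul_assoc)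
      then show ?thesis by (simp add: eq flip: matrix_vector_mul_assoc)
    qed
    have "(transpose B *v x) \<bullet> (transpose B *v x) = x \<bullet> (B *v (transpose B *v x))"
      using inner_transpose[of "transpose B *v x" B x] by (simp add: inner_commute)
    also have "\<dots> = 0" using x symmat_inner[OF sym, of x "transpose A *v x"] by (simp flip: v)
    finally show ?thesis using v by simp
  qed
  have "transpose B *v (transpose (mpow A k) *v x) = 0" if "X *v x = 0" for x k
    using that
  proof (induction k arbitrary: x)
    case 0
    then show ?case using ker by (simp add: mpow_def)
  next
    case (Suc k)
    have "transpose (mpow A (Suc k)) = transpose (mpow A k) ** transpose A"
      by (simp add: mpow_def matrix_transpose_mul)
    then show ?case using Suc.IH[of "transpose A *v x"] ker[OF Suc.prems]
      by (simp flip: matrix_vector_mul_assoc)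
  qed
  then have "x = 0" if "X *v x = 0" for x using controllable_kernel[OF assms] that by blast
  then have "posdef X" using psdX by (simp add: posdef_iff_psd_invertible invertible_iff_ker)
  then show ?thesis using that[of b X] eq k(1) by (simp add: b_def)
qed

lemma posdef_blk_diag:
  fixes a :: "real^'n^'n" and d :: "real^'m^'m"
  assumes "posdef a" "posdef d" shows "posdef (blk a 0 0 d)"
proof -
  have nn: "0 \<le> x \<bullet> (a *v x)" "0 \<le> y \<bullet> (d *v y)" for x y
    using assms posdef_imp_psd unfolding psd_def by blast+
  have "posdef (blk a 0 (transpose 0) d)" unfolding posdef_blk_iff
    using assms nn by (auto simp: posdef_def intro: add_pos_nonneg add_nonneg_pos)
  then show ?thesis by simp
qed

lemma posdef_coupled_scaling:
  fixes X Y :: "real^'n^'n"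
  assumes "posdef X" "posdef Y"
  obtains t where "t > 0" "posdef (blk (t *\<^sub>R X) (mat 1) (mat 1) (t *\<^sub>R Y))"
proof -
  obtain c where c: "c > 0" "\<And>x. c * (x \<bullet> x) \<le> x \<bullet> (X *v x)" using posdef_bound assms(1) by blast
  obtain d where d: "d > 0" "\<And>x. d * (x \<bullet> x) \<le> x \<bullet> (Y *v x)" using posdef_bound assms(2) by blast
  \<comment> \<open>With \<open>t c \<ge> 2\<close> and \<open>t d \<ge> 2\<close> the diagonal terms exceed \<open>|2 (x \<bullet> y)| \<le> x \<bullet> x + y \<bullet> y\<close>.\<close>
  define t where "t = 2 / c + 2 / d"
  have t: "t > 0" "t * c \<ge> 2" "t * d \<ge> 2" using c d by (simp_all add: t_def add_pos_pos field_simps)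
  have "0 < x \<bullet> ((t *\<^sub>R X) *v x) + 2 * (x \<bullet> (mat 1 *v y)) + y \<bullet> ((t *\<^sub>R Y) *v y)" if "x \<noteq> 0 \<or> y \<noteq> 0" for x y
  proof -
    have "2 * (x \<bullet> x) \<le> t * c * (x \<bullet> x)" "2 * (y \<bullet> y) \<le> t * d * (y \<bullet> y)"
      using t by (simp_all add: mult_right_mono)
    moreover have "t * c * (x \<bullet> x) \<le> t * (x \<bullet> (X *v x))" "t * d * (y \<bullet> y) \<le> t * (y \<bullet> (Y *v y))"
      using c(2)[of x] d(2)[of y] t(1) by (simp_all add: mult.assoc)
    moreover have "0 \<le> (x + y) \<bullet> (x + y)" by simp
    then have "0 \<le> x \<bullet> x + 2 * (x \<bullet> y) + y \<bullet> y" by (simp add: inner_add_left inner_add_right inner_commute)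
    moreover have "0 < x \<bullet> x + y \<bullet> y" using that by (auto intro: add_pos_nonneg add_nonneg_pos)
    ultimately have "0 < t * (x \<bullet> (X *v x)) + 2 * (x \<bullet> y) + t * (y \<bullet> (Y *v y))" by linarith
    then show ?thesis by (simp add: scaleR_matrix_vector_assoc[symmetric])
  qed
  then have "posdef (blk (t *\<^sub>R X) (mat 1) (transpose (mat 1)) (t *\<^sub>R Y))"
    unfolding posdef_blk_iff using assms by (simp add: posdef_def symmat_scaleR)
  then show ?thesis using that t(1) by simp
qed

text \<open>Take \<open>X\<close>, \<open>Y\<close> as large multiples of the shifted Gramians \<open>X\<^sub>0\<close>, \<open>Y\<^sub>0\<close> of \<open>(A, B)\<close> and \<open>(A\<^sup>T, C\<^sup>T)\<close>, and set
  \<open>F = -t B\<^sup>T\<close>, \<open>H = -t C\<^sup>T\<close>, \<open>M = -A\<^sup>T\<close>.  The leading block of \<open>\<A>\<close> becomes block diagonal with the blocks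
  \<open>-t (2 b X\<^sub>0 + B B\<^sup>T)\<close> and \<open>-t (2 c Y\<^sub>0 + C\<^sup>T C)\<close>, and large \<open>\<Gamma>\<close> and \<open>\<gamma>\<close> take care of the remaining conditions.\<close>

lemma F_LQG_strictly_feasible:
  fixes A :: "real ^ 'n ^ 'n" and B :: "real ^ 'm ^ 'n" and C :: "real ^ 'n ^ 'p"
  assumes "controllable A B" "observable C A"
  obtains \<gamma> \<Lambda> X Y \<Gamma> where "(\<gamma>, \<Lambda>, X, Y, \<Gamma>) \<in> F_LQG A B C Q R W V"
    "posdef (- calA A B C W V \<gamma> (blk12 \<Lambda>) (blk21 \<Lambda>) (blk22 \<Lambda>) X Y)"
proof -
  obtain X0 b where X0: "b > 0" "posdef X0" "A ** X0 + X0 ** transpose A + (2 * b) *\<^sub>R X0 = B ** transpose B"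
    using controllable_gramian[OF assms(1)] .
  obtain Y0 c where Y0: "c > 0" "posdef Y0"
    "transpose A ** Y0 + Y0 ** transpose (transpose A) + (2 * c) *\<^sub>R Y0 = transpose C ** transpose (transpose C)"
    using controllable_gramian[OF assms(2)[unfolded observable_iff_controllable]] .
  obtain t where t: "t > 0" "posdef (blk (t *\<^sub>R X0) (mat 1) (mat 1) (t *\<^sub>R Y0))"
    using posdef_coupled_scaling[OF X0(2) Y0(2)] .
  define X where "X = t *\<^sub>R X0"
  define Y where "Y = t *\<^sub>R Y0"
  define F where "F = - (t *\<^sub>R transpose B)"
  define H where "H = - (t *\<^sub>R transpose C)"
  define \<Lambda> where "\<Lambda> = blk (0 :: real^'p^'m) F H (- transpose A)"
  have sX: "transpose X0 = X0" "transpose Y0 = Y0" using X0(2) Y0(2) by (simp_all add: posdef_def symmat_def)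
  define N1 where "N1 = t *\<^sub>R ((2 * b) *\<^sub>R X0 + B ** transpose B)"
  define N2 where "N2 = t *\<^sub>R ((2 * c) *\<^sub>R Y0 + transpose C ** C)"
  have "posdef ((2 * b) *\<^sub>R X0)" "posdef ((2 * c) *\<^sub>R Y0)" by (intro posdef_scaleR X0 Y0; use X0(1) Y0(1) in simp)+
  then have "posdef N1" "posdef N2"
    using t psd_gram[of B] psd_gram[of "transpose C"] unfolding N1_def N2_def
    by (auto intro!: posdef_scaleR posdef_add_psd)
  then have N: "posdef (blk N1 0 0 N2)" by (rule posdef_blk_diag)
  have 1: "A ** X + B ** F + transpose (A ** X + B ** F) = - N1"
  proof -
    have "A ** X + B ** F + transpose (A ** X + B ** F)
       = (t *\<^sub>R (A ** X0) - t *\<^sub>R (B ** transpose B)) + (t *\<^sub>R (X0 ** transpose A) - t *\<^sub>R (B ** transpose B))"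
      by (simp add: X_def F_def transpose_diff matrix_transpose_mul transpose_scalar sX)
    moreover have "X0 ** transpose A = B ** transpose B - (2 * b) *\<^sub>R X0 - A ** X0"
      using X0(3) by (metis add.commute add_diff_cancel_left' add_diff_cancel_right')
    ultimately show ?thesis by (simp add: N1_def scaleR_right_distrib scaleR_right_diff_distrib)
  qed
  have 2: "Y ** A + H ** C + transpose (Y ** A + H ** C) = - N2"
  proof -
    have "Y ** A + H ** C + transpose (Y ** A + H ** C)
       = (t *\<^sub>R (Y0 ** A) - t *\<^sub>R (transpose C ** C)) + (t *\<^sub>R (transpose A ** Y0) - t *\<^sub>R (transpose C ** C))"
      by (simp add: Y_def H_def transpose_diff matrix_transpose_mul transpose_scalar sX)
    moreover have "transpose A ** Y0 = transpose C ** C - (2 * c) *\<^sub>R Y0 - Y0 ** A"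
      using Y0(3) unfolding transpose_transpose by (metis add_diff_cancel_right')
    ultimately show ?thesis by (simp add: N2_def scaleR_right_distrib scaleR_right_diff_distrib)
  qed
  define E where "E = - blkv (B1 W :: real^('n+'p)^'n) (Y ** B1 W + H ** D21 V)"
  obtain k where k: "k > 0" "\<And>g. g \<ge> k \<Longrightarrow> posdef (blk (blk N1 0 0 N2) E (transpose E) (mat g))"
    using posdef_blk_large[OF N] by blast
  define E' where "E' = blkv (transpose (C1 Q ** X + D12 R ** F)) (transpose (C1 Q :: real^'n^('n+'m)))"
  have p: "posdef (blk X (mat 1) (mat 1) Y)" using t(2) by (simp add: X_def Y_def)
  obtain l where l: "l > 0" "\<And>g. g \<ge> l \<Longrightarrow> posdef (blk (blk X (mat 1) (mat 1) Y) E' (transpose E') (mat g))"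
    using posdef_blk_large[OF p] by blast
  define \<Gamma> where "\<Gamma> = (mat l :: real^('n+'m)^('n+'m))"
  define \<gamma> where "\<gamma> = max k (trace \<Gamma>)"
  have calA: "- calA A B C W V \<gamma> (blk12 \<Lambda>) (blk21 \<Lambda>) (blk22 \<Lambda>) X Y = blk (blk N1 0 0 N2) E (transpose E) (mat \<gamma>)"
    by (simp add: calA_def \<Lambda>_def 1 2 E_def blk_uminus transpose_uminus transpose_blkv)
  have calB: "calB Q R (blk12 \<Lambda>) X Y \<Gamma> = blk (blk X (mat 1) (mat 1) Y) E' (transpose E') (mat l)"
    by (simp add: calB_def \<Lambda>_def E'_def \<Gamma>_def transpose_blkv)
  have pA: "posdef (- calA A B C W V \<gamma> (blk12 \<Lambda>) (blk21 \<Lambda>) (blk22 \<Lambda>) X Y)"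
    unfolding calA by (rule k(2)) (simp add: \<gamma>_def)
  have pB: "posdef (calB Q R (blk12 \<Lambda>) X Y \<Gamma>)" unfolding calB by (rule l(2)) simp
  have "psd \<Gamma>" using psd_blk_lower[OF posdef_imp_psd[OF pB[unfolded calB]]] by (simp add: \<Gamma>_def)
  then have "(\<gamma>, \<Lambda>, X, Y, \<Gamma>) \<in> F_LQG A B C Q R W V"
    using p posdef_imp_psd[OF pA] posdef_imp_psd[OF pB]
    by (simp add: F_LQG_def V0_iff \<Lambda>_def[THEN arg_cong[of _ _ blk11]] X_def Y_def symmat_def sX transpose_scalar)
      (simp add: \<gamma>_def)
  then show ?thesis using that pA by blast
qed

section \<open>Approximation by strictly feasible points\<close>

lemma posdef_convex: "psd M \<Longrightarrow> posdef N \<Longrightarrow> 0 < t \<Longrightarrow> t \<le> 1 \<Longrightarrow> posdef ((1 - t) *\<^sub>R M + t *\<^sub>R N)"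
  using posdef_add_psd[of "t *\<^sub>R N" "(1 - t) *\<^sub>R M"] by (simp add: add.commute posdef_scaleR psd_scaleR)

lemma psd_convex: "psd M \<Longrightarrow> psd N \<Longrightarrow> 0 < t \<Longrightarrow> t \<le> 1 \<Longrightarrow> psd ((1 - t) *\<^sub>R M + t *\<^sub>R N)"
  by (intro psd_add psd_scaleR) auto

lemma calA_affine:
  "calA A B C W V ((1 - t) * \<gamma> + t * \<gamma>') ((1 - t) *\<^sub>R F + t *\<^sub>R F') ((1 - t) *\<^sub>R H + t *\<^sub>R H')
      ((1 - t) *\<^sub>R M + t *\<^sub>R M') ((1 - t) *\<^sub>R X + t *\<^sub>R X') ((1 - t) *\<^sub>R Y + t *\<^sub>R Y')
   = (1 - t) *\<^sub>R calA A B C W V \<gamma> F H M X Y + t *\<^sub>R calA A B C W V \<gamma>' F' H' M' X' Y'"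
  unfolding calA_def matrix_mul_add matrix_mul_scaleR transpose_add transpose_scalar
  by (simp add: vec_eq_iff forall_sum mat_def transpose_def algebra_simps)

lemma calB_affine:
  "calB Q R ((1 - t) *\<^sub>R F + t *\<^sub>R F') ((1 - t) *\<^sub>R X + t *\<^sub>R X') ((1 - t) *\<^sub>R Y + t *\<^sub>R Y') ((1 - t) *\<^sub>R G + t *\<^sub>R G')
   = (1 - t) *\<^sub>R calB Q R F X Y G + t *\<^sub>R calB Q R F' X' Y' G'"
  unfolding calB_def matrix_mul_add matrix_mul_scaleR transpose_add transpose_scalar
  by (simp add: vec_eq_iff forall_sum mat_def transpose_def algebra_simps)

text \<open>A segment that joins a point of the convex set to a strictly feasible one stays in the set, and all its points except possibly
  the first end point are strictly feasible for the first inequality.\<close>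

lemma F_LQG_convex_strict:
  assumes w: "(\<gamma>, \<Lambda>, X, Y, \<Gamma>) \<in> F_LQG A B C Q R W V" and w': "(\<gamma>', \<Lambda>', X', Y', \<Gamma>') \<in> F_LQG A B C Q R W V"
    and strict: "posdef (- calA A B C W V \<gamma>' (blk12 \<Lambda>') (blk21 \<Lambda>') (blk22 \<Lambda>') X' Y')"
    and t: "0 < t" "t \<le> 1"
    and v: "((1 - t) *\<^sub>R (\<gamma>, \<Lambda>, X, Y, \<Gamma>) + t *\<^sub>R (\<gamma>', \<Lambda>', X', Y', \<Gamma>')) = (\<gamma>'', \<Lambda>'', X'', Y'', \<Gamma>'')"
  shows "(\<gamma>'', \<Lambda>'', X'', Y'', \<Gamma>'') \<in> F_LQG A B C Q R W V"
    and "posdef (- calA A B C W V \<gamma>'' (blk12 \<Lambda>'') (blk21 \<Lambda>'') (blk22 \<Lambda>'') X'' Y'')"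
proof -
  have e: "\<gamma>'' = (1 - t) * \<gamma> + t * \<gamma>'" "\<Lambda>'' = (1 - t) *\<^sub>R \<Lambda> + t *\<^sub>R \<Lambda>'" "X'' = (1 - t) *\<^sub>R X + t *\<^sub>R X'"
    "Y'' = (1 - t) *\<^sub>R Y + t *\<^sub>R Y'" "\<Gamma>'' = (1 - t) *\<^sub>R \<Gamma> + t *\<^sub>R \<Gamma>'"
    using v by (auto simp: algebra_simps)
  have bl: "blk11 \<Lambda>'' = (1 - t) *\<^sub>R blk11 \<Lambda> + t *\<^sub>R blk11 \<Lambda>'" "blk12 \<Lambda>'' = (1 - t) *\<^sub>R blk12 \<Lambda> + t *\<^sub>R blk12 \<Lambda>'"
    "blk21 \<Lambda>'' = (1 - t) *\<^sub>R blk21 \<Lambda> + t *\<^sub>R blk21 \<Lambda>'" "blk22 \<Lambda>'' = (1 - t) *\<^sub>R blk22 \<Lambda> + t *\<^sub>R blk22 \<Lambda>'"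
    unfolding e(2) by (simp_all add: blk11_def blk12_def blk21_def blk22_def vec_eq_iff)
  note ww = w[unfolded F_LQG_def, simplified] and ww' = w'[unfolded F_LQG_def, simplified]
  have cA: "- calA A B C W V \<gamma>'' (blk12 \<Lambda>'') (blk21 \<Lambda>'') (blk22 \<Lambda>'') X'' Y'' =
     (1 - t) *\<^sub>R (- calA A B C W V \<gamma> (blk12 \<Lambda>) (blk21 \<Lambda>) (blk22 \<Lambda>) X Y)
      + t *\<^sub>R (- calA A B C W V \<gamma>' (blk12 \<Lambda>') (blk21 \<Lambda>') (blk22 \<Lambda>') X' Y')"
    unfolding bl e(1,3,4) calA_affine by simp
  show pA: "posdef (- calA A B C W V \<gamma>'' (blk12 \<Lambda>'') (blk21 \<Lambda>'') (blk22 \<Lambda>'') X'' Y'')"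
    unfolding cA by (intro posdef_convex strict t) (use ww in simp)
  have "psd (calB Q R (blk12 \<Lambda>'') X'' Y'' \<Gamma>'')"
    unfolding bl e(3,4,5) calB_affine by (intro psd_convex t) (use ww ww' in simp_all)
  moreover have "blk X'' (mat 1) (mat 1) Y'' = (1 - t) *\<^sub>R blk X (mat 1) (mat 1) Y + t *\<^sub>R blk X' (mat 1) (mat 1) Y'"
    by (simp add: e blk_add blk_scaleR scaleR_left_distrib[symmetric])
  then have "posdef (blk X'' (mat 1) (mat 1) Y'')"
    by (simp only:) (intro posdef_convex posdef_imp_psd t; use ww ww' in simp)
  moreover have "psd \<Gamma>''" unfolding e(5) by (intro psd_convex t) (use ww ww' in simp_all)
  moreover have "trace \<Gamma>'' \<le> \<gamma>''" unfolding e trace_add trace_scaleR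
    by (intro add_mono mult_left_mono) (use ww ww' t in auto)
  moreover have "blk11 \<Lambda>'' = 0" using bl(1) ww ww' by (simp add: V0_iff)
  moreover have "X'' \<in> symmat" "Y'' \<in> symmat" unfolding e
    by (intro symmat_add symmat_scaleR; use ww ww' in simp)+
  ultimately show "(\<gamma>'', \<Lambda>'', X'', Y'', \<Gamma>'') \<in> F_LQG A B C Q R W V"
    using posdef_imp_psd[OF pA] by (simp add: F_LQG_def V0_iff)
qed

text \<open>Strictness of the first inequality forces \<open>A\<^sub>c\<^sub>l\<close> to be Hurwitz and \<open>\<gamma> > 0\<close>, after which the Gramian bound applies.\<close>

lemma strict_L_LQG_epi:
  fixes A :: "real ^ 'n ^ 'n" and B :: "real ^ 'm ^ 'n" and C :: "real ^ 'n ^ 'p"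
  assumes z: "(K, \<gamma>, P, \<Gamma>) \<in> L_LQG A B C Q R W V"
    and strict: "posdef (lyapunov_lmi (Acl A B C K) (Bcl B W V K) \<gamma> P)"
  shows "(K, \<gamma>) \<in> epi_ge (C0 A B C) (J_LQG A B C Q R W V)"
proof -
  have P: "posdef P" and K: "K \<in> V0" and tr: "trace \<Gamma> \<le> \<gamma>"
    and L2: "psd (blk P (transpose (Ccl C Q R K)) (Ccl C Q R K) \<Gamma>)"
    using z by (auto simp: L_LQG_def)
  have hur: "hurwitz (Acl A B C K)" by (rule posdef_lyapunov_lmi_hurwitz[OF P strict])
  then have C0: "K \<in> C0 A B C" using K by (simp add: C0_def)
  have sym: "P \<in> symmat" using P by (simp add: posdef_def)
  have "posdef (mat \<gamma> :: real^('n+'p)^('n+'p))"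
    by (rule posdef_blk_blocks(2)[OF strict[unfolded lyapunov_lmi_blk[OF sym]]])
  then have "0 < axis i 1 \<bullet> (mat \<gamma> *v axis i (1::real) :: real^('n+'p))" for i
    unfolding posdef_def by (metis axis_eq_0_iff zero_neq_one)
  then have \<gamma>: "\<gamma> > 0" by (simp add: inner_axis)
  obtain X where X: "Acl A B C K ** X + X ** transpose (Acl A B C K) + Bcl B W V K ** transpose (Bcl B W V K) = 0"
    using lyapunov_exists[OF hur] .
  have "trace (Ccl C Q R K ** X ** transpose (Ccl C Q R K)) \<le> \<gamma> * trace \<Gamma>"
    by (rule lmi_gramian_bound[OF hur P \<gamma> posdef_imp_psd[OF strict] L2 X])
  also have "\<dots> \<le> \<gamma>\<^sup>2" using tr \<gamma> by (simp add: power2_eq_square)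
  finally have "J_LQG A B C Q R W V K \<le> \<gamma>"
    unfolding J_LQG_gramian[OF C0 X] using \<gamma> by (simp add: real_le_lsqrt real_sqrt_le_iff')
  then show ?thesis using C0 by (simp add: epi_ge_def)
qed

lemma L_LQG_closure:
  fixes A :: "real ^ 'n ^ 'n" and B :: "real ^ 'm ^ 'n" and C :: "real ^ 'n ^ 'p"
  assumes "controllable A B" "observable C A"
  shows "(\<lambda>(K, \<gamma>, P, \<Gamma>). (K, \<gamma>)) ` L_LQG A B C Q R W V \<subseteq> closure (epi_ge (C0 A B C) (J_LQG A B C Q R W V))"
proof
  fix y assume "y \<in> (\<lambda>(K, \<gamma>, P, \<Gamma>). (K, \<gamma>)) ` L_LQG A B C Q R W V"
  then obtain z where z: "z \<in> L_LQG A B C Q R W V" and y: "y = (fst z, fst (snd z))"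
    by (auto simp: split_def)
  define w where "w = Phi_LQG A B C z"
  have z_dom: "z \<in> Phi_dom" using z L_LQG_subset_Phi_dom by blast
  have w: "w \<in> F_LQG A B C Q R W V \<times> GL" using Phi_mem_iff[OF z_dom] z by (simp add: w_def)
  obtain \<gamma>1 \<Lambda>1 X1 Y1 \<Gamma>1 where s: "(\<gamma>1, \<Lambda>1, X1, Y1, \<Gamma>1) \<in> F_LQG A B C Q R W V"
    "posdef (- calA A B C W V \<gamma>1 (blk12 \<Lambda>1) (blk21 \<Lambda>1) (blk22 \<Lambda>1) X1 Y1)"
    using F_LQG_strictly_feasible[OF assms] by blast
  define f1 where "f1 = (\<gamma>1, \<Lambda>1, X1, Y1, \<Gamma>1)"
  define f where "f n = (let t = inverse (real (Suc n)) in (1 - t) *\<^sub>R fst w + t *\<^sub>R f1)" for n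
  define zz where "zz n = Psi_LQG A B C (f n, snd w)" for n
  have fF: "(f n, snd w) \<in> F_LQG A B C Q R W V \<times> GL" and
    epi: "(fst (zz n), fst (snd (zz n))) \<in> epi_ge (C0 A B C) (J_LQG A B C Q R W V)" for n
  proof -
    define t where "t = inverse (real (Suc n))"
    have t: "0 < t" "t \<le> 1" by (simp_all add: t_def field_simps)
    obtain \<gamma> \<Lambda> X Y \<Gamma> where fw: "fst w = (\<gamma>, \<Lambda>, X, Y, \<Gamma>)" by (metis prod.collapse)
    obtain \<gamma>2 \<Lambda>2 X2 Y2 \<Gamma>2 where f2: "f n = (\<gamma>2, \<Lambda>2, X2, Y2, \<Gamma>2)" by (metis prod.collapse)
    have "(1 - t) *\<^sub>R (\<gamma>, \<Lambda>, X, Y, \<Gamma>) + t *\<^sub>R (\<gamma>1, \<Lambda>1, X1, Y1, \<Gamma>1) = (\<gamma>2, \<Lambda>2, X2, Y2, \<Gamma>2)"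
      using f2 unfolding f_def Let_def t_def[symmetric] fw f1_def .
    moreover have "(\<gamma>, \<Lambda>, X, Y, \<Gamma>) \<in> F_LQG A B C Q R W V" using w by (simp add: mem_Times_iff fw)
    ultimately have F2: "(\<gamma>2, \<Lambda>2, X2, Y2, \<Gamma>2) \<in> F_LQG A B C Q R W V"
      "posdef (- calA A B C W V \<gamma>2 (blk12 \<Lambda>2) (blk21 \<Lambda>2) (blk22 \<Lambda>2) X2 Y2)"
      using F_LQG_convex_strict[OF _ s t] by blast+
    then show m: "(f n, snd w) \<in> F_LQG A B C Q R W V \<times> GL" using w by (simp add: f2 mem_Times_iff)
    then have Psi_dom: "(f n, snd w) \<in> Psi_dom" using F_LQG_subset_Psi_dom by blast
    have Phi_dom: "zz n \<in> Phi_dom" and Phi: "Phi_LQG A B C (zz n) = (f n, snd w)"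
      using Phi_Psi[OF Psi_dom, of A B C] by (simp_all add: zz_def)
    have L: "zz n \<in> L_LQG A B C Q R W V" using Phi_mem_iff[OF Phi_dom] m Phi by metis
    obtain K \<gamma>3 P \<Gamma>3 where zn: "zz n = (K, \<gamma>3, P, \<Gamma>3)" by (metis prod.collapse)
    have "posdef (lyapunov_lmi (Acl A B C K) (Bcl B W V K) \<gamma>3 P)"
      using lmi_congruence(3)[OF Phi_dom[unfolded zn] Phi[unfolded zn f2]] F2(2) by blast
    then show "(fst (zz n), fst (snd (zz n))) \<in> epi_ge (C0 A B C) (J_LQG A B C Q R W V)"
      using strict_L_LQG_epi L zn by auto
  qed
  have t0: "(\<lambda>n. inverse (real (Suc n))) \<longlonglongrightarrow> 0" by (rule LIMSEQ_inverse_real_of_nat)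
  have "(\<lambda>n. (1 - inverse (real (Suc n))) *\<^sub>R fst w + inverse (real (Suc n)) *\<^sub>R f1)
     \<longlonglongrightarrow> (1 - 0) *\<^sub>R fst w + 0 *\<^sub>R f1"
    by (intro tendsto_intros t0)
  then have "f \<longlonglongrightarrow> fst w" by (simp add: f_def[abs_def] Let_def del: of_nat_Suc)
  then have lim: "(\<lambda>n. (f n, snd w)) \<longlonglongrightarrow> w"
    using tendsto_Pair[OF _ tendsto_const, of f "fst w" sequentially "snd w"] by simp
  have in_dom: "w \<in> Psi_dom" "(f n, snd w) \<in> Psi_dom" for n
    using subsetD[OF F_LQG_subset_Psi_dom] w fF by blast+
  have "continuous_on Psi_dom (Psi_LQG A B C)" using Psi_smooth[of 0 UNIV A B C] by simp
  then have "zz \<longlonglongrightarrow> Psi_LQG A B C w"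
    unfolding zz_def[abs_def]
    by (rule continuous_on_tendsto_compose[OF _ lim]) (use in_dom in \<open>auto intro!: always_eventually\<close>)
  also have "Psi_LQG A B C w = z" unfolding w_def by (rule Psi_Phi(1)[OF z_dom])
  finally have "(\<lambda>n. (fst (zz n), fst (snd (zz n)))) \<longlonglongrightarrow> y"
    unfolding y by (intro tendsto_intros)
  then show "y \<in> closure (epi_ge (C0 A B C) (J_LQG A B C Q R W V))"
    unfolding closure_sequential using epi by (intro exI[of _ "\<lambda>n. (fst (zz n), fst (snd (zz n)))"]) auto
qed

theorem proposition4p4:
  fixes A :: "real ^ 'n ^ 'n" and B :: "real ^ 'm ^ 'n" and C :: "real ^ 'n ^ 'p"
    and Q W :: "real ^ 'n ^ 'n" and R :: "real ^ 'm ^ 'm" and V :: "real ^ 'p ^ 'p"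
  assumes "psd Q" and "posdef R" and "psd W" and "posdef V"
    and "controllable A (msqrt W)" and "controllable A B"
    and "observable (msqrt Q) A" and "observable C A"
  shows "epi_gt (C0 A B C) (J_LQG A B C Q R W V)
           \<subseteq> (\<lambda>(K, \<gamma>, P, \<Gamma>). (K, \<gamma>)) ` L_LQG A B C Q R W V
    \<and> (\<lambda>(K, \<gamma>, P, \<Gamma>). (K, \<gamma>)) ` L_LQG A B C Q R W V
           \<subseteq> closure (epi_ge (C0 A B C) (J_LQG A B C Q R W V))
    \<and> Cr_diffeo 2 E_L E_F (L_LQG A B C Q R W V) (F_LQG A B C Q R W V \<times> GL) (Phi_LQG A B C)
    \<and> Cr_diffeo \<infinity> E_L E_F (L_LQG A B C Q R W V) (F_LQG A B C Q R W V \<times> GL) (Phi_LQG A B C)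
    \<and> (\<forall>z \<in> F_LQG A B C Q R W V \<times> GL.
           inv_into (L_LQG A B C Q R W V) (Phi_LQG A B C) z = Psi_LQG A B C z)"
proof (intro conjI ballI)
  show "epi_gt (C0 A B C) (J_LQG A B C Q R W V)
      \<subseteq> (\<lambda>(K, \<gamma>, P, \<Gamma>). (K, \<gamma>)) ` L_LQG A B C Q R W V"
    by (rule epi_gt_subset)
  show "(\<lambda>(K, \<gamma>, P, \<Gamma>). (K, \<gamma>)) ` L_LQG A B C Q R W V
      \<subseteq> closure (epi_ge (C0 A B C) (J_LQG A B C Q R W V))"
    by (rule L_LQG_closure[OF assms(6,8)])
  fix z assume z: "z \<in> F_LQG A B C Q R W V \<times> (GL :: (real ^ 'n ^ 'n) set)"
  let ?L = "L_LQG A B C Q R W V"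
  have Psi_dom: "z \<in> Psi_dom" using z F_LQG_subset_Psi_dom by blast
  have "Psi_LQG A B C z \<in> ?L"
    using Phi_mem_iff[OF Phi_Psi(2)[OF Psi_dom]] Phi_Psi(1)[OF Psi_dom] z by metis
  then show "inv_into ?L (Phi_LQG A B C) z = Psi_LQG A B C z"
    using inv_into_f_f[OF bij_betw_imp_inj_on[OF bij_betw_Phi]] Phi_Psi(1)[OF Psi_dom] by metis
qed (rule Phi_diffeo)+

end
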